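(* Assume the standing assumptions (A) on the real-valued functions $p,Q,r,s$ hold, and in addition: (i) $p\in W^1_{2,loc}(\mathbb{R})$ and $p(x)>0$ for all $x\in\mathbb{R}$; (ii) $\displaystyle\int_{-\infty}^{0}p^{-1/2}(t)\,dt=\int_{0}^{\infty}p^{-1/2}(t)\,dt=\infty$. If the preminimal operator $\mathrm{L}_{00}$ is bounded from below in $L^2(\mathbb{R})$ (i.e. there is $\gamma\in\mathbb{R}$ with $(\mathrm{L}_{00}u,u)_{L^2(\mathbb{R})}\ge\gamma\|u\|^2_{L^2(\mathbb{R})}$ for all $u\in\mathrm{Dom}(\mathrm{L}_{00})$), then $\mathrm{L}_{00}$ is essentially self-adjoint and $\mathrm{L}_{00}^*=\mathrm{L}=\mathrm{L}^*$.
   Context: Standing assumptions (A): $p,Q,r,s:\mathbb{R}\to\mathbb{R}$ are real-valued measurable functions with $\frac{1}{\sqrt{|p|}},\frac{Q}{\sqrt{|p|}},\frac{r}{\sqrt{|p|}}\in L^2_{loc}(\mathbb{R})$, $s\in L^1_{loc}(\mathbb{R})$, $\frac1p\neq0$ a.e.; set $q=Q'+s$ (derivative in the sense of distributions). These data define the formal expression $l[u]=-(pu')'+qu+i((ru)'+ru')$, interpreted quasi-differentially via the quasi-derivatives $u^{[0]}:=u$, $u^{[1]}:=pu'-(Q+ir)u$, $u^{[2]}:=(u^{[1]})'+\frac{Q-ir}{p}u^{[1]}+\left(\frac{Q^2+r^2}{p}-s\right)u$, and $l[u]:=-u^{[2]}$ for $u$ with $u,u^{[1]}\in\mathrm{AC}_{loc}(\mathbb{R})$.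 The maximal operator $\mathrm{L}$ in $L^2(\mathbb{R})$: $\mathrm{L}u:=l[u]$, $\mathrm{Dom}(\mathrm{L}):=\{u\in L^2(\mathbb{R}): u,u^{[1]}\in\mathrm{AC}_{loc}(\mathbb{R}),\ l[u]\in L^2(\mathbb{R})\}$. The preminimal operator $\mathrm{L}_{00}$ is the restriction of $\mathrm{L}$ to $\{u\in\mathrm{Dom}(\mathrm{L}):\mathrm{supp}\,u\text{ compact}\}$. The minimal operator $\mathrm{L}_0$ is the closure of $\mathrm{L}_{00}$. *)

theory Defs
  imports "HOL-Analysis.Analysis"
begin

definition AC_on :: "real set \<Rightarrow> (real \<Rightarrow> 'a::real_normed_vector) \<Rightarrow> bool" where
  "AC_on S f \<longleftrightarrow>
     (\<forall>e>0. \<exists>d>0. \<forall>(n::nat) (a::nat \<Rightarrow> real) (b::nat \<Rightarrow> real).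
        (\<forall>k<n. a k \<le> b k \<and> {a k..b k} \<subseteq> S) \<and>
        (\<forall>j<n. \<forall>k<n. j \<noteq> k \<longrightarrow> {a j<..<b j} \<inter> {a k<..<b k} = {}) \<and>
        (\<Sum>k<n. b k - a k) < d
        \<longrightarrow> (\<Sum>k<n. norm (f (b k) - f (a k))) < e)"

definition AC_loc :: "(real \<Rightarrow> 'a::real_normed_vector) \<Rightarrow> bool" where
  "AC_loc f \<longleftrightarrow> (\<forall>a b. AC_on {a..b} f)"

definition L1_loc :: "(real \<Rightarrow> real) \<Rightarrow> bool" where
  "L1_loc f \<longleftrightarrow> f \<in> borel_measurable lebesgue \<and>
     (\<forall>a b. set_integrable lebesgue {a..b} f)"

definition L2_loc :: "(real \<Rightarrow> real) \<Rightarrow> bool" where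
  "L2_loc f \<longleftrightarrow> f \<in> borel_measurable lebesgue \<and>
     (\<forall>a b. set_integrable lebesgue {a..b} (\<lambda>x. (f x)\<^sup>2))"

definition test_fun :: "(real \<Rightarrow> real) \<Rightarrow> bool" where
  "test_fun \<phi> \<longleftrightarrow>
     (\<exists>D::nat \<Rightarrow> real \<Rightarrow> real. D 0 = \<phi> \<and>
        (\<forall>n x. (D n has_real_derivative D (Suc n) x) (at x))) \<and>
     (\<exists>c. \<forall>x. \<bar>x\<bar> > c \<longrightarrow> \<phi> x = 0)"

definition W12_loc :: "(real \<Rightarrow> real) \<Rightarrow> bool" where
  "W12_loc f \<longleftrightarrow> L2_loc f \<and>
     (\<exists>g. L2_loc g \<and>
        (\<forall>\<phi> \<phi>'. test_fun \<phi> \<and> (\<forall>x. (\<phi> has_real_derivative \<phi>' x) (at x)) \<longrightarrow>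
            (LINT x|lebesgue. f x * \<phi>' x) = - (LINT x|lebesgue. g x * \<phi> x)))"

definition L2 :: "(real \<Rightarrow> complex) \<Rightarrow> bool" where
  "L2 u \<longleftrightarrow> u \<in> borel_measurable lebesgue \<and> integrable lebesgue (\<lambda>x. (cmod (u x))\<^sup>2)"

definition ip :: "(real \<Rightarrow> complex) \<Rightarrow> (real \<Rightarrow> complex) \<Rightarrow> complex" where
  "ip u v = (LINT x|lebesgue. u x * cnj (v x))"

definition nrm2 :: "(real \<Rightarrow> complex) \<Rightarrow> real" where
  "nrm2 u = (LINT x|lebesgue. (cmod (u x))\<^sup>2)"

text \<open>A (possibly unbounded) operator in \<open>L^2(\<real>)\<close> is represented by its graph, a set of
  pairs \<open>(u, Tu)\<close> of \<open>L^2\<close> representatives.  Elements of \<open>L^2\<close> are equivalence classes modulo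
  equality a.e., hence operators are compared modulo a.e. equality of both components.\<close>
type_synonym op_graph = "((real \<Rightarrow> complex) \<times> (real \<Rightarrow> complex)) set"

definition ae_eq :: "(real \<Rightarrow> complex) \<Rightarrow> (real \<Rightarrow> complex) \<Rightarrow> bool" where
  "ae_eq u v \<longleftrightarrow> (AE x in lebesgue. u x = v x)"

definition op_le :: "op_graph \<Rightarrow> op_graph \<Rightarrow> bool" where
  "op_le G H \<longleftrightarrow> (\<forall>(u,f)\<in>G. \<exists>(v,g)\<in>H. ae_eq u v \<and> ae_eq f g)"

definition op_eq :: "op_graph \<Rightarrow> op_graph \<Rightarrow> bool" where
  "op_eq G H \<longleftrightarrow> op_le G H \<and> op_le H G"

definition adjoint :: "op_graph \<Rightarrow> op_graph" where
  "adjoint G = {(v,w). L2 v \<and> L2 w \<and> (\<forall>(u,f)\<in>G. ip f v = ip u w)}"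

definition op_closure :: "op_graph \<Rightarrow> op_graph" where
  "op_closure G = {(u,f). L2 u \<and> L2 f \<and>
     (\<exists>X::nat \<Rightarrow> (real \<Rightarrow> complex) \<times> (real \<Rightarrow> complex). (\<forall>n. X n \<in> G) \<and>
        (\<lambda>n. nrm2 (\<lambda>x. fst (X n) x - u x)) \<longlonglongrightarrow> 0 \<and>
        (\<lambda>n. nrm2 (\<lambda>x. snd (X n) x - f x)) \<longlonglongrightarrow> 0)}"

definition self_adjoint :: "op_graph \<Rightarrow> bool" where
  "self_adjoint G \<longleftrightarrow> op_eq G (adjoint G)"

definition essentially_self_adjoint :: "op_graph \<Rightarrow> bool" where
  "essentially_self_adjoint G \<longleftrightarrow> self_adjoint (op_closure G)"

definition bounded_below :: "op_graph \<Rightarrow> bool" where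
  "bounded_below G \<longleftrightarrow> (\<exists>\<gamma>::real. \<forall>(u,f)\<in>G.
      Im (ip f u) = 0 \<and> Re (ip f u) \<ge> \<gamma> * nrm2 u)"

text \<open>Standing assumptions (A).  (The coefficient \<open>q = Q' + s\<close> enters the expression only
  through \<open>Q\<close> and \<open>s\<close>, via the quasi-derivatives.)\<close>
definition standing_A :: "(real \<Rightarrow> real) \<Rightarrow> (real \<Rightarrow> real) \<Rightarrow> (real \<Rightarrow> real) \<Rightarrow> (real \<Rightarrow> real) \<Rightarrow> bool" where
  "standing_A p Q r s \<longleftrightarrow>
     p \<in> borel_measurable lebesgue \<and> Q \<in> borel_measurable lebesgue \<and>
     r \<in> borel_measurable lebesgue \<and> s \<in> borel_measurable lebesgue \<and>
     L2_loc (\<lambda>x. 1 / sqrt \<bar>p x\<bar>) \<and> L2_loc (\<lambda>x. Q x / sqrt \<bar>p x\<bar>) \<and>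
     L2_loc (\<lambda>x. r x / sqrt \<bar>p x\<bar>) \<and> L1_loc s \<and>
     (AE x in lebesgue. 1 / p x \<noteq> 0)"

definition is_qd1 :: "(real \<Rightarrow> real) \<Rightarrow> (real \<Rightarrow> real) \<Rightarrow> (real \<Rightarrow> real) \<Rightarrow>
    (real \<Rightarrow> complex) \<Rightarrow> (real \<Rightarrow> complex) \<Rightarrow> bool" where
  "is_qd1 p Q r u u1 \<longleftrightarrow>
     (AE x in lebesgue. \<exists>d. (u has_vector_derivative d) (at x) \<and>
        u1 x = of_real (p x) * d - (of_real (Q x) + \<i> * of_real (r x)) * u x)"

definition l_expr :: "(real \<Rightarrow> real) \<Rightarrow> (real \<Rightarrow> real) \<Rightarrow> (real \<Rightarrow> real) \<Rightarrow> (real \<Rightarrow> real) \<Rightarrow>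
    (real \<Rightarrow> complex) \<Rightarrow> (real \<Rightarrow> complex) \<Rightarrow> bool" where
  "l_expr p Q r s u f \<longleftrightarrow>
     (\<exists>u1. AC_loc u \<and> AC_loc u1 \<and> is_qd1 p Q r u u1 \<and>
        (AE x in lebesgue. \<exists>d1. (u1 has_vector_derivative d1) (at x) \<and>
           f x = - (d1 + (of_real (Q x) - \<i> * of_real (r x)) / of_real (p x) * u1 x
                    + of_real (((Q x)\<^sup>2 + (r x)\<^sup>2) / p x - s x) * u x)))"

definition L_max :: "(real \<Rightarrow> real) \<Rightarrow> (real \<Rightarrow> real) \<Rightarrow> (real \<Rightarrow> real) \<Rightarrow> (real \<Rightarrow> real) \<Rightarrow> op_graph" where
  "L_max p Q r s = {(u,f). L2 u \<and> L2 f \<and> l_expr p Q r s u f}"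

definition L_00 :: "(real \<Rightarrow> real) \<Rightarrow> (real \<Rightarrow> real) \<Rightarrow> (real \<Rightarrow> real) \<Rightarrow> (real \<Rightarrow> real) \<Rightarrow> op_graph" where
  "L_00 p Q r s = {(u,f). (u,f) \<in> L_max p Q r s \<and> (\<exists>c. \<forall>x. \<bar>x\<bar> > c \<longrightarrow> u x = 0)}"

definition L_0 :: "(real \<Rightarrow> real) \<Rightarrow> (real \<Rightarrow> real) \<Rightarrow> (real \<Rightarrow> real) \<Rightarrow> (real \<Rightarrow> real) \<Rightarrow> op_graph" where
  "L_0 p Q r s = op_closure (L_00 p Q r s)"

end

(*
  A solution v in L^2 of l[v] = (\<gamma> - 1) v is multiplied by a compactly supported cut-off \<phi>. With
  the Lagrange terms cancelling, the form of \<phi> v is (\<gamma> - 1) |\<phi> v|^2 plus the integral of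
  p \<phi>'^2 |v|^2, and p \<phi>'^2 can be made uniformly small because p^(-1/2) is not integrable at either
  end; hence v = 0. The regularity of p is what makes \<phi> v an element of the domain. The adjoint
  of the preminimal operator is the maximal one by Green's formula: on a bounded interval, every
  right-hand side orthogonal to the solutions of l[u] = 0 comes from a compactly supported u.
  Finally, the best approximation of a vector by the range of L_00 + 1 - \<gamma> has its residual in the
  trivial kernel just described, so this range is dense and the closure of L_00 is its adjoint.
*)
theory Submission
  imports Defs
begin

subsection \<open>The fundamental theorem of calculus for absolutely continuous functions\<close>

text \<open>The coefficients of the expression are merely locally integrable combinations of
  \<open>p\<close>, \<open>Q\<close>, \<open>r\<close>, \<open>s\<close>, so the equation is read as
  a first-order system for \<open>u\<close> and its quasi-derivative, valid almost everywhere. This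
  rests on both halves of the fundamental theorem of calculus for absolutely continuous functions.

  Two demands force the shape of the cut-off. Smallness of p \<phi>'^2 suggests \<phi>' proportional
  to p^(-1/2). The quasi-derivative of \<phi> v is \<phi> v1 + p \<phi>' v, so p \<phi>' has to be
  absolutely continuous, and its derivative has to be locally square integrable because it
  multiplies v in l[\<phi> v]. Here \<open>W12_loc p\<close> enters: by du Bois-Reymond's argument p
  agrees a.e. with a primitive of an \<open>L2_loc\<close> function. The term Q \<phi>' v is square
  integrable because p^(1/2) \<phi>' is bounded.

  The point \<gamma> - 1 lies one below the lower bound. This gap absorbs the form of \<phi> v in
  the kernel estimate, and it makes L_00 + 1 - \<gamma> coercive, so that convergence of images
  forces convergence of arguments.\<close>

lemma AC_on_finite_family:
  fixes f :: "real \<Rightarrow> 'a::real_normed_vector"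
  assumes "AC_on S f" "e > 0"
  shows "\<exists>d>0. \<forall>(I::'i set) lo hi. finite I \<longrightarrow> (\<forall>i\<in>I. lo i \<le> hi i \<and> {lo i..hi i} \<subseteq> S) \<longrightarrow>
      (\<forall>i\<in>I. \<forall>j\<in>I. i \<noteq> j \<longrightarrow> {lo i<..<hi i} \<inter> {lo j<..<hi j} = {}) \<longrightarrow>
      (\<Sum>i\<in>I. hi i - lo i) < d \<longrightarrow> (\<Sum>i\<in>I. norm (f (hi i) - f (lo i))) < e"
proof -
  obtain d where d: "d > 0" and D: "\<forall>(n::nat) a b.
        (\<forall>k<n. a k \<le> b k \<and> {a k..b k} \<subseteq> S) \<and>
        (\<forall>j<n. \<forall>k<n. j \<noteq> k \<longrightarrow> {a j<..<b j} \<inter> {a k<..<b k} = {}) \<and>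
        (\<Sum>k<n. b k - a k) < d \<longrightarrow> (\<Sum>k<n. norm (f (b k) - f (a k))) < e"
    using assms(1)[unfolded AC_on_def, THEN spec, THEN mp, OF assms(2)] by (elim exE conjE) (rule that)
  show ?thesis
  proof (intro exI[of _ d] conjI d allI impI)
    fix I :: "'i set" and lo hi
    assume fin: "finite I" and i: "\<forall>i\<in>I. lo i \<le> hi i \<and> {lo i..hi i} \<subseteq> S"
      and dj: "\<forall>i\<in>I. \<forall>j\<in>I. i \<noteq> j \<longrightarrow> {lo i<..<hi i} \<inter> {lo j<..<hi j} = {}"
      and s: "(\<Sum>i\<in>I. hi i - lo i) < d"
    \<comment> \<open>Tagged divisions are finite sets of pairs, while \<open>AC_on\<close> numbers
      its intervals; the bijection carries the estimate over to arbitrary finite index sets.\<close>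
    obtain h where h: "bij_betw h {..<card I} I"
      using ex_bij_betw_nat_finite[OF fin] by (auto simp: atLeast0LessThan)
    have hI: "h k \<in> I" if "k < card I" for k using h that by (auto simp: bij_betw_def)
    have hinj: "h j \<noteq> h k" if "j < card I" "k < card I" "j \<noteq> k" for j k
      using h that by (auto simp: bij_betw_def inj_on_def)
    have "(\<Sum>k<card I. norm (f (hi (h k)) - f (lo (h k)))) < e"
    proof (rule D[rule_format, of "card I" "\<lambda>k. lo (h k)" "\<lambda>k. hi (h k)", OF conjI[OF _ conjI]])
      show "(\<Sum>k<card I. hi (h k) - lo (h k)) < d"
        using s sum.reindex_bij_betw[OF h, of "\<lambda>i. hi i - lo i"] by simp
      show "\<forall>k<card I. lo (h k) \<le> hi (h k) \<and> {lo (h k)..hi (h k)} \<subseteq> S"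
        using i hI by blast
      show "\<forall>j<card I. \<forall>k<card I. j \<noteq> k \<longrightarrow> {lo (h j)<..<hi (h j)} \<inter> {lo (h k)<..<hi (h k)} = {}"
        by (intro allI impI dj[rule_format] hI hinj)
    qed
    then show "(\<Sum>i\<in>I. norm (f (hi i) - f (lo i))) < e"
      using sum.reindex_bij_betw[OF h, of "\<lambda>i. norm (f (hi i) - f (lo i))"] by simp
  qed
qed

text \<open>On the exceptional null set \<open>N\<close> the gauge stays inside an open superset of \<open>N\<close> of small
  measure, where absolute continuity controls the increments directly.\<close>

lemma AC_on_imp_has_integral:
  fixes u :: "real \<Rightarrow> 'a::euclidean_space"
  assumes ab: "a \<le> b" and AC: "AC_on {a..b} u"
    and der: "AE x in lebesgue. x \<in> {a..b} \<longrightarrow> (u has_vector_derivative d x) (at x)"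
  shows "(d has_integral (u b - u a)) {a..b}"
proof -
  obtain N0 where N0: "N0 \<in> null_sets lebesgue"
    and N0d: "\<And>x. x \<notin> N0 \<Longrightarrow> x \<in> {a..b} \<Longrightarrow> (u has_vector_derivative d x) (at x)"
    using der unfolding eventually_ae_filter by auto
  define N where "N = N0 \<inter> {a..b}"
  have N: "negligible N" unfolding N_def
    using N0 by (meson inf_le1 negligible_iff_null_sets negligible_subset)
  \<comment> \<open>With the integrand zero on \<open>N\<close>, a Riemann term tagged in
    \<open>N\<close> leaves only the increment of \<open>u\<close>, which absolute continuity
    bounds.\<close>
  define g where "g = (\<lambda>x. if x \<in> N then 0 else d x)"
  have gd: "(u has_vector_derivative g x) (at x within {a..b})" if "x \<in> {a..b} - N" for x
    using N0d that unfolding N_def g_def by (auto intro: has_vector_derivative_at_within)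
  have "(g has_integral (u b - u a)) {a..b}"
    unfolding has_integral_factor_content box_real[symmetric]
  proof safe
    fix e :: real assume e: "e > 0"
    show "\<exists>\<gamma>. gauge \<gamma> \<and> (\<forall>p. p tagged_division_of (cbox a b) \<and> \<gamma> fine p \<longrightarrow>
      norm ((\<Sum>(x, k)\<in>p. measure lborel k *\<^sub>R g x) - (u b - u a)) \<le> e * measure lborel (cbox a b))"
    proof (cases "a = b")
      case True
      have triv: "norm ((\<Sum>(x, k)\<in>p. measure lborel k *\<^sub>R g x) - (u b - u a)) \<le> e * measure lborel (cbox a b)"
        if p: "p tagged_division_of (cbox a b)" for p
      proof -
        have "(\<Sum>(x, k)\<in>p. measure lborel k *\<^sub>R g x) = 0"
          by (rule sum_content_null[OF _ p]) (simp add: True)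
        then show ?thesis using True by simp
      qed
      show ?thesis
        by (intro exI[of _ "\<lambda>x. ball x 1"] conjI gauge_trivial allI impI, elim conjE, rule triv)
    next
      case False
      with ab have ab': "a < b" by simp
      \<comment> \<open>The tolerance \<open>e * (b - a)\<close> is halved: \<open>e1\<close> for
        all intervals tagged in \<open>N\<close> together, \<open>e2 * (b - a)\<close> for the
        others. Positivity of \<open>e1\<close> needs \<open>a < b\<close>, hence the separate
        degenerate case.\<close>
      define e1 where "e1 = e * (b - a) / 2"
      have e1: "e1 > 0" using e ab' by (simp add: e1_def)
      obtain \<delta> where \<delta>: "\<delta> > 0" and \<delta>D: "\<forall>(I::(real \<times> real set) set) lo hi. finite I \<longrightarrow>
          (\<forall>i\<in>I. lo i \<le> hi i \<and> {lo i..hi i} \<subseteq> {a..b}) \<longrightarrow>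
          (\<forall>i\<in>I. \<forall>j\<in>I. i \<noteq> j \<longrightarrow> {lo i<..<hi i} \<inter> {lo j<..<hi j} = {}) \<longrightarrow>
          (\<Sum>i\<in>I. hi i - lo i) < \<delta> \<longrightarrow> (\<Sum>i\<in>I. norm (u (hi i) - u (lo i))) < e1"
        using AC_on_finite_family[OF AC e1] by (elim exE conjE) (rule that)
      obtain T where T: "open T" "N \<subseteq> T" "T - N \<in> lmeasurable" "emeasure lebesgue (T - N) < ennreal \<delta>"
        using sets_lebesgue_outer_open[OF negligible_imp_sets[OF N] \<delta>] by metis
      have Nn: "N \<in> null_sets lebesgue" using N by (simp only: negligible_iff_null_sets)
      have Tu: "(T - N) \<union> N = T" using T(2) by blast
      have Tm: "T \<in> lmeasurable"
        using fmeasurable.Un[OF T(3) negligible_imp_measurable[OF N]] unfolding Tu .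
      have "emeasure lebesgue (T - N) = ennreal (measure lebesgue (T - N))"
        using emeasure_eq_measure2[OF T(3)] .
      then have "measure lebesgue (T - N) < \<delta>" using T(4) by (metis ennreal_less_iff measure_nonneg)
      then have Tme: "measure lebesgue T < \<delta>"
        using measure_Diff_null_set[OF fmeasurableD[OF Tm] Nn] by metis
      define e2 where "e2 = e / 2"
      have e2: "e2 > 0" using e by (simp add: e2_def)
      have "\<forall>x\<in>{a..b} - N. \<exists>r>0. \<forall>y\<in>{a..b}. norm (y-x) < r \<longrightarrow> norm (u y - u x - (y-x) *\<^sub>R g x) \<le> e2 * norm (y-x)"
        using gd e2 unfolding has_vector_derivative_def has_derivative_within_alt by blast
      then obtain r where r: "\<And>x. x \<in> {a..b} - N \<Longrightarrow> 0 < r x"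
         "\<And>x y. \<lbrakk>x \<in> {a..b} - N; y \<in> {a..b}; norm (y-x) < r x\<rbrakk>
             \<Longrightarrow> norm (u y - u x - (y-x) *\<^sub>R g x) \<le> e2 * norm (y-x)"
        by metis
      define \<gamma> where "\<gamma> x = (if x \<in> N then T else if x \<in> {a..b} then ball x (r x) else ball x 1)" for x
      have ga: "gauge \<gamma>" using T r(1) unfolding gauge_def \<gamma>_def by auto
      have main: "norm ((\<Sum>(x, k)\<in>p. measure lborel k *\<^sub>R g x) - (u b - u a)) \<le> e * measure lborel (cbox a b)"
        if ptag: "p tagged_division_of cbox a b" and fine: "\<gamma> fine p" for p
      proof -
        have fp: "finite p" using ptag by auto
        have K: "\<exists>l h. K = {l..h} \<and> l \<le> x \<and> x \<le> h \<and> a \<le> l \<and> h \<le> b \<and> Inf K = l \<and> Sup K = h \<and> measure lborel K = h - l" if xK: "(x,K) \<in> p" for x K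
        proof -
          obtain l h where lh: "K = cbox l h" using tagged_division_ofD(4)[OF ptag xK] by blast
          have "x \<in> K" "K \<subseteq> cbox a b" using ptag that by blast+
          then show ?thesis using lh by (intro exI[of _ l] exI[of _ h]) auto
        qed
        have K': "Inf (snd i) \<le> Sup (snd i)" "{Inf (snd i)<..<Sup (snd i)} \<subseteq> snd i"
          "{Inf (snd i)..Sup (snd i)} \<subseteq> {a..b}" "interior (snd i) = {Inf (snd i)<..<Sup (snd i)}"
          "measure lebesgue {Inf (snd i)<..<Sup (snd i)} = Sup (snd i) - Inf (snd i)" if iP: "i \<in> p" for i
        proof -
          obtain l h where lh: "snd i = {l..h}" "l \<le> h" "a \<le> l" "h \<le> b" "Inf (snd i) = l" "Sup (snd i) = h"
          proof -
            have "(fst i, snd i) \<in> p" using iP by simp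
            from K[OF this] that show ?thesis by (elim exE conjE) (metis order_trans)
          qed
          show "Inf (snd i) \<le> Sup (snd i)" unfolding lh(5,6) by (rule lh(2))
          show "{Inf (snd i)<..<Sup (snd i)} \<subseteq> snd i" unfolding lh(5,6) unfolding lh(1) by auto
          show "{Inf (snd i)..Sup (snd i)} \<subseteq> {a..b}" unfolding lh(5,6) using lh(3,4) by auto
          show "interior (snd i) = {Inf (snd i)<..<Sup (snd i)}" unfolding lh(5,6) unfolding lh(1) by simp
          show "measure lebesgue {Inf (snd i)<..<Sup (snd i)} = Sup (snd i) - Inf (snd i)"
            unfolding lh(5,6) using lh(2) by simp
        qed
        have ba: "b - a = (\<Sum>(x,K)\<in>p. Sup K - Inf K)" "u b - u a = (\<Sum>(x,K)\<in>p. u(Sup K) - u(Inf K))"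
          using additive_tagged_division_1[where f= "\<lambda>x. x"] additive_tagged_division_1[where f= u]
            ab ptag by auto
        define p1 where "p1 = {xk\<in>p. fst xk \<in> N}"
        define p2 where "p2 = {xk\<in>p. fst xk \<notin> N}"
        have pp: "p = p1 \<union> p2" "p1 \<inter> p2 = {}" "finite p1" "finite p2" using fp by (auto simp: p1_def p2_def)
        let ?t = "\<lambda>(x,K). measure lborel K *\<^sub>R g x - (u(Sup K) - u(Inf K))"
        have tagp: "p tagged_partial_division_of cbox a b" using ptag by (auto simp: tagged_division_of_def)
        have disj: "{Inf (snd i)<..<Sup (snd i)} \<inter> {Inf (snd j)<..<Sup (snd j)} = {}"
          if "i \<in> p" "j \<in> p" "i \<noteq> j" for i j
        proof -
          have "interior (snd i) \<inter> interior (snd j) = {}"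
            using tagged_partial_division_ofD(5)[OF tagp, of "fst i" "snd i" "fst j" "snd j"] that
            by (simp add: prod_eq_iff)
          moreover have "interior (snd i) = {Inf (snd i)<..<Sup (snd i)}" if "i \<in> p" for i
            by (rule K'(4)[OF that])
          ultimately show ?thesis using that by blast
        qed
        have "(\<Sum>i\<in>p1. norm (u (Sup (snd i)) - u (Inf (snd i)))) < e1"
        proof (rule \<delta>D[rule_format, of p1 "\<lambda>i. Inf (snd i)" "\<lambda>i. Sup (snd i)", OF pp(3)])
          show "Inf (snd i) \<le> Sup (snd i) \<and> {Inf (snd i)..Sup (snd i)} \<subseteq> {a..b}" if "i \<in> p1" for i
            using K'(1,3)[of i] that pp by blast
          show "{Inf (snd i)<..<Sup (snd i)} \<inter> {Inf (snd j)<..<Sup (snd j)} = {}"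
            if "i \<in> p1" "j \<in> p1" "i \<noteq> j" for i j using disj that pp by auto
          have "(\<Sum>i\<in>p1. Sup (snd i) - Inf (snd i)) = (\<Sum>i\<in>p1. measure lebesgue {Inf (snd i)<..<Sup (snd i)})"
            by (intro sum.cong refl K'(5)[symmetric]) (use pp in auto)
          also have "... = measure lebesgue (\<Union>i\<in>p1. {Inf (snd i)<..<Sup (snd i)})"
          proof (rule measure_UNION'[symmetric])
            show "pairwise (\<lambda>i j. disjnt {Inf (snd i)<..<Sup (snd i)} {Inf (snd j)<..<Sup (snd j)}) p1"
              using disj pp unfolding pairwise_def disjnt_def by auto
          qed (use pp in auto)
          also have "... \<le> measure lebesgue T"
          proof (rule measure_mono_fmeasurable[OF _ _ Tm])
            have "snd i \<subseteq> T" if "i \<in> p1" for i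
            proof -
              have "(fst i, snd i) \<in> p" "fst i \<in> N" using that by (simp_all add: p1_def)
              then have "snd i \<subseteq> \<gamma> (fst i)" using fineD[OF fine] by blast
              then show ?thesis using \<open>fst i \<in> N\<close> by (simp add: \<gamma>_def)
            qed
            moreover have "{Inf (snd i)<..<Sup (snd i)} \<subseteq> snd i" if "i \<in> p1" for i
              using K'(2)[of i] that pp by blast
            ultimately show "(\<Union>i\<in>p1. {Inf (snd i)<..<Sup (snd i)}) \<subseteq> T" by blast
          qed (use pp in auto)
          also have "... < \<delta>" by (rule Tme)
          finally show "(\<Sum>i\<in>p1. Sup (snd i) - Inf (snd i)) < \<delta>" .
        qed
        moreover have "norm (\<Sum>i\<in>p1. ?t i) \<le> (\<Sum>i\<in>p1. norm (u (Sup (snd i)) - u (Inf (snd i))))"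
          by (rule sum_norm_le) (auto simp: p1_def g_def split: prod.splits simp: norm_minus_commute)
        ultimately have s1: "norm (\<Sum>i\<in>p1. ?t i) \<le> e1" by simp
        have "norm (\<Sum>i\<in>p2. ?t i) \<le> (\<Sum>i\<in>p2. e2 * (Sup (snd i) - Inf (snd i)))"
        proof (rule sum_norm_le)
          fix i assume i: "i \<in> p2"
          obtain x k where xk: "i = (x,k)" by (cases i)
          obtain l h where lh: "k = {l..h}" "l \<le> x" "x \<le> h" "a \<le> l" "h \<le> b" "Inf k = l" "Sup k = h" "measure lborel k = h - l"

          proof -
            have "(x, k) \<in> p" using i xk pp by simp
            from K[OF this] that show ?thesis by (elim exE conjE) metis
          qed
          have xN: "x \<in> {a..b} - N" using i lh xk by (auto simp: p2_def)
          have "(x, k) \<in> p" "x \<notin> N" using i xk by (simp_all add: p2_def)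
          then have "k \<subseteq> ball x (r x)" using fineD[OF fine, of x k] xN by (simp add: \<gamma>_def)
          then have kr: "norm (h - x) < r x" "norm (l - x) < r x"
            using lh(1-3) by (auto simp: subset_eq dist_real_def abs_minus_commute
                dest: bspec[of _ _ h] bspec[of _ _ l])
          \<comment> \<open>The increment over \<open>{l..h}\<close> is compared through the tag
            \<open>x\<close>. Since \<open>x\<close> lies between \<open>l\<close> and
            \<open>h\<close>, the two errors add up to exactly \<open>e2 * (h - l)\<close>.\<close>
          have 1: "norm (u h - u x - (h-x) *\<^sub>R g x) \<le> e2 * norm (h-x)"
            by (rule r(2)[OF xN]) (use kr lh(2-5) in auto)
          have 2: "norm (u l - u x - (l-x) *\<^sub>R g x) \<le> e2 * norm (l-x)"
            by (rule r(2)[OF xN]) (use kr lh(2-5) in auto)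
          have eq: "(h - l) *\<^sub>R g x - (u h - u l) = (u l - u x - (l-x) *\<^sub>R g x) - (u h - u x - (h-x) *\<^sub>R g x)"
            by (simp add: algebra_simps)
          have "norm ((h - l) *\<^sub>R g x - (u h - u l)) \<le> e2 * norm (l-x) + e2 * norm (h-x)"
            unfolding eq using 1 2 norm_triangle_ineq4 by (meson add_mono order_trans)
          also have "... = e2 * (h - l)" using lh by (simp add: algebra_simps)
          finally show "norm (?t i) \<le> e2 * (Sup (snd i) - Inf (snd i))" using lh xk by simp
        qed
        also have "... \<le> (\<Sum>i\<in>p. e2 * (Sup (snd i) - Inf (snd i)))"
          using pp fp K'(1) e2 by (intro sum_mono2 mult_nonneg_nonneg) auto
        also have "... = e2 * (b - a)" using ba(1) by (simp add: sum_distrib_left split_def)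
        finally have s2: "norm (\<Sum>i\<in>p2. ?t i) \<le> e2 * (b - a)" .
        have "(\<Sum>(x, k)\<in>p. measure lborel k *\<^sub>R g x) - (u b - u a) = (\<Sum>i\<in>p. ?t i)"
          by (simp add: ba(2) split_def sum_subtractf)
        also have "... = (\<Sum>i\<in>p1. ?t i) + (\<Sum>i\<in>p2. ?t i)"
          using pp by (simp add: sum.union_disjoint)
        finally have "norm ((\<Sum>(x, k)\<in>p. measure lborel k *\<^sub>R g x) - (u b - u a)) \<le> e1 + e2 * (b - a)"
          using norm_triangle_le[OF add_mono[OF s1 s2]] by simp
        also have "... = e * measure lborel (cbox a b)" using ab by (simp add: e1_def e2_def field_simps)
        finally show ?thesis .
      qed
      show ?thesis by (intro exI[of _ \<gamma>] conjI ga allI impI, elim conjE, rule main)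
    qed
  qed
  then show ?thesis
    by (rule has_integral_spike[OF N, rotated]) (auto simp: g_def)
qed

text \<open>The intervals on which the difference quotient is off by more than \<open>\<epsilon>\<close> form a Vitali cover of the
  exceptional set; by Henstock's lemma every finite disjoint subfamily has small total length.\<close>

lemma negligible_bad_difference_quotient:
  fixes f :: "real \<Rightarrow> 'a::euclidean_space"
  assumes f: "f integrable_on {a..b}" and eps: "\<epsilon> > 0"
  shows "negligible {x\<in>{a<..<b}. \<forall>\<delta>>0. \<exists>y. \<bar>y - x\<bar> < \<delta> \<and>
    norm (integral {a..y} f - integral {a..x} f - (y - x) *\<^sub>R f x) > \<epsilon> * \<bar>y - x\<bar>}" (is "negligible ?E")
proof -
  define F where "F = (\<lambda>y. integral {a..y} f)"
  have Fd: "F y - F x = integral {x..y} f" if "a \<le> x" "x \<le> y" "y \<le> b" for x y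
  proof -
    have "f integrable_on {a..y}" using f that by (meson atLeastatMost_subset_iff integrable_on_subinterval order_refl)
    then show ?thesis using Henstock_Kurzweil_Integration.integral_combine[of a x y f] that by (simp add: F_def algebra_simps)
  qed
  show ?thesis unfolding negligible_outer_le
  proof (intro allI impI)
    fix e :: real assume e: "e > 0"
    \<comment> \<open>A bad interval contributes at least \<open>\<epsilon>\<close> times its length
      to the Henstock sum, so the tolerance \<open>\<epsilon> * e\<close> bounds the total length by
      \<open>e\<close>.\<close>
    obtain \<gamma> where ga: "gauge \<gamma>" and \<gamma>: "\<And>p. \<lbrakk>p tagged_partial_division_of (cbox a b); \<gamma> fine p\<rbrakk> \<Longrightarrow>
             sum (\<lambda>(x,k). norm(measure lborel k *\<^sub>R f x - integral k f)) p < \<epsilon> * e"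
      by (rule Henstock_lemma[OF f[folded box_real(2)] mult_pos_pos[OF eps e]]) (rule that)
    \<comment> \<open>An index is a pair of a bad point and a witness for it; \<open>c\<close> and
      \<open>r\<close> present the interval between them as a ball, the form in which Vitali's
      theorem takes its cover.\<close>
    define c where "c i = (fst i + snd i) / 2" for i :: "real \<times> real"
    define r where "r i = \<bar>snd i - fst i\<bar> / 2" for i :: "real \<times> real"
    define K where "K = {i. fst i \<in> ?E \<and> snd i \<noteq> fst i \<and> cball (c i) (r i) \<subseteq> \<gamma> (fst i) \<inter> {a..b}
       \<and> norm (F (snd i) - F (fst i) - (snd i - fst i) *\<^sub>R f (fst i)) > \<epsilon> * \<bar>snd i - fst i\<bar>}"
    have cb: "cball (c i) (r i) = {min (fst i) (snd i)..max (fst i) (snd i)}" for i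
      by (auto simp: cball_eq_atLeastAtMost c_def r_def abs_real_def field_simps min_def max_def)
    obtain C where C: "countable C" "C \<subseteq> K"
       "pairwise (\<lambda>i j. disjnt (cball (c i) (r i)) (cball (c j) (r j))) C"
       "negligible(?E - (\<Union>i \<in> C. cball (c i) (r i)))"
    proof (rule Vitali_covering_theorem_cballs[of K r ?E c])
      show "0 < r i" if "i \<in> K" for i using that by (auto simp: K_def r_def)
      show "\<exists>i. i \<in> K \<and> x \<in> cball (c i) (r i) \<and> r i < d" if x: "x \<in> ?E" and d: "0 < d" for x d
      proof -
        have "open (\<gamma> x \<inter> {a<..<b})" "x \<in> \<gamma> x \<inter> {a<..<b}" using ga x by (auto simp: gauge_def)
        then obtain s where s: "s > 0" "ball x s \<subseteq> \<gamma> x \<inter> {a<..<b}" by (meson open_contains_ball)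
        obtain y where y: "\<bar>y - x\<bar> < min s d"
          "norm (F y - F x - (y - x) *\<^sub>R f x) > \<epsilon> * \<bar>y - x\<bar>"
          using x s d unfolding F_def by (smt (verit) mem_Collect_eq)
        have yx: "y \<noteq> x" using y(2) by auto
        have "cball (c (x,y)) (r (x,y)) \<subseteq> ball x s" unfolding cb using y(1) by (auto simp: dist_real_def)
        then have "(x,y) \<in> K" using x yx y(2) s by (auto simp: K_def)
        moreover have "x \<in> cball (c (x,y)) (r (x,y))" unfolding cb by auto
        moreover have "r (x,y) < d" using y(1) by (auto simp: r_def)
        ultimately show ?thesis by blast
      qed
    qed
    have bd: "measure lebesgue (\<Union>i\<in>D. cball (c i) (r i)) \<le> e" if D: "D \<subseteq> C" "finite D" for D
    proof -
      let ?p = "(\<lambda>i. (fst i, cball (c i) (r i))) ` D"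
      have DK: "D \<subseteq> K" using D C by auto
      have dj: "cball (c i) (r i) \<inter> cball (c j) (r j) = {}" if "i \<in> D" "j \<in> D" "i \<noteq> j" for i j
        using C(3) D that unfolding pairwise_def disjnt_def by auto
      have inj: "inj_on (\<lambda>i. (fst i, cball (c i) (r i))) D"
      proof (rule inj_onI, rule ccontr)
        fix i j assume ij: "i \<in> D" "j \<in> D" "i \<noteq> j" "(fst i, cball (c i) (r i)) = (fst j, cball (c j) (r j))"
        then have "cball (c i) (r i) = {}" using dj[of i j] by simp
        then show False unfolding cb by auto
      qed
      have "?p tagged_partial_division_of cbox a b"
        unfolding tagged_partial_division_of_def
      proof (intro conjI allI impI)
        show "finite ?p" using D by simp
        fix x k assume xk: "(x,k) \<in> ?p"
        then show "x \<in> k" by (auto simp: cb)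
        show "k \<subseteq> cbox a b" using xk DK by (auto simp: K_def)
        show "\<exists>a b. k = cbox a b" using xk by (auto simp: cb simp flip: box_real)
      next
        fix x k x' k' assume "(x,k) \<in> ?p \<and> (x',k') \<in> ?p \<and> (x,k) \<noteq> (x',k')"
        then obtain i j where "i \<in> D" "j \<in> D" "i \<noteq> j" "k = cball (c i) (r i)" "k' = cball (c j) (r j)"
          by auto
        then show "interior k \<inter> interior k' = {}" using dj[of i j] interior_subset by blast
      qed
      moreover have "\<gamma> fine ?p" unfolding fine_def using DK by (auto simp: K_def)
      ultimately have "sum (\<lambda>(x,k). norm(measure lborel k *\<^sub>R f x - integral k f)) ?p < \<epsilon> * e" by (rule \<gamma>)
      then have s: "(\<Sum>i\<in>D. norm (measure lborel (cball (c i) (r i)) *\<^sub>R f (fst i) - integral (cball (c i) (r i)) f)) < \<epsilon> * e"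
        by (simp add: sum.reindex[OF inj] o_def)
      have "\<epsilon> * (\<Sum>i\<in>D. measure lebesgue (cball (c i) (r i))) =
         (\<Sum>i\<in>D. \<epsilon> * measure lebesgue (cball (c i) (r i)))" by (simp add: sum_distrib_left)
      also have "\<dots> \<le> (\<Sum>i\<in>D. norm (measure lborel (cball (c i) (r i)) *\<^sub>R f (fst i) - integral (cball (c i) (r i)) f))"
      proof (rule sum_mono)
        fix i assume i: "i \<in> D"
        obtain x y where xy: "i = (x,y)" by (cases i)
        have iK: "(x,y) \<in> K" using i DK xy by auto
        have cbi: "{min x y..max x y} \<subseteq> {a..b}" using iK unfolding K_def cb by auto
        then have ab: "a \<le> min x y" "max x y \<le> b" by auto
        have big: "norm (F y - F x - (y - x) *\<^sub>R f x) > \<epsilon> * \<bar>y - x\<bar>" using iK by (simp add: K_def)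
        have me: "measure lborel {min x y..max x y} = \<bar>y - x\<bar>" by (auto simp: min_def max_def)
        have "norm (\<bar>y - x\<bar> *\<^sub>R f x - integral {min x y..max x y} f) = norm (F y - F x - (y - x) *\<^sub>R f x)"
        proof (cases "x \<le> y")
          case True then show ?thesis using Fd[of x y] ab by (simp add: min_def max_def norm_minus_commute)
        next
          case False
          then have "(x - y) *\<^sub>R f x - (F x - F y) = F y - F x - (y - x) *\<^sub>R f x" by (simp add: algebra_simps)
          then show ?thesis using False Fd[of y x] ab by (simp add: min_def max_def)
        qed
        then show "\<epsilon> * measure lebesgue (cball (c i) (r i)) \<le> norm (measure lborel (cball (c i) (r i)) *\<^sub>R f (fst i) - integral (cball (c i) (r i)) f)"
          using big me unfolding cb xy by simp
      qed
      also have "... < \<epsilon> * e" by (rule s)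
      finally have "(\<Sum>i\<in>D. measure lebesgue (cball (c i) (r i))) \<le> e" using eps by simp
      then show ?thesis
        using measure_UNION_le[OF D(2), of "\<lambda>i. cball (c i) (r i)" lebesgue] by fastforce
    qed
    let ?T = "(?E - (\<Union>i \<in> C. cball (c i) (r i))) \<union> (\<Union>i \<in> C. cball (c i) (r i))"
    have T1: "(\<Union>i \<in> C. cball (c i) (r i)) \<in> lmeasurable"
      by (rule fmeasurable_UN_bound[OF C(1) _ bd]) auto
    have T2: "measure lebesgue (\<Union>i \<in> C. cball (c i) (r i)) \<le> e"
      by (rule measure_UN_bound[OF C(1) _ bd]) auto
    have "?T \<in> lmeasurable" using T1 C(4) negligible_imp_measurable by blast
    moreover have "measure lebesgue ?T \<le> e"
      using T2 measure_Un_le[OF negligible_imp_sets[OF C(4)] fmeasurableD[OF T1]]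
        negligible_imp_measure0[OF C(4)] by linarith
    ultimately show "\<exists>T. ?E \<subseteq> T \<and> T \<in> lmeasurable \<and> measure lebesgue T \<le> e"
      by (intro exI[of _ ?T] conjI) (simp_all only: Un_Diff_cancel2 Un_upper1)
  qed
qed

text \<open>A failure of differentiability at \<open>x\<close> already shows at some tolerance
  \<open>1 / (n + 1)\<close>, so the exceptional set lies in countably many of the null sets above.
  This is Lebesgue's differentiation theorem for the gauge integral.\<close>

theorem AE_integral_has_vector_derivative:
  fixes f :: "real \<Rightarrow> 'a::euclidean_space"
  assumes f: "f integrable_on {a..b}"
  shows "AE x in lebesgue. x \<in> {a<..<b} \<longrightarrow> ((\<lambda>y. integral {a..y} f) has_vector_derivative f x) (at x)"
proof -
  let ?E = "\<lambda>\<epsilon>. {x\<in>{a<..<b}. \<forall>\<delta>>0. \<exists>y. \<bar>y - x\<bar> < \<delta> \<and>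
    norm (integral {a..y} f - integral {a..x} f - (y - x) *\<^sub>R f x) > \<epsilon> * \<bar>y - x\<bar>}"
  have "negligible (\<Union>n. ?E (inverse (real (Suc n))))"
    by (intro negligible_Union_nat negligible_bad_difference_quotient[OF f]) simp
  then have N: "(\<Union>n. ?E (inverse (real (Suc n)))) \<in> null_sets lebesgue" by (simp only: negligible_iff_null_sets)
  show ?thesis
  proof (rule AE_I'[OF N], rule subsetI)
    fix x assume x: "x \<in> {x \<in> space lebesgue. \<not> (x \<in> {a<..<b} \<longrightarrow> ((\<lambda>y. integral {a..y} f) has_vector_derivative f x) (at x))}"
    then have xab: "x \<in> {a<..<b}" and nd: "\<not> ((\<lambda>y. integral {a..y} f) has_vector_derivative f x) (at x)" by auto
    obtain e where e: "e > 0" "\<And>d. d > 0 \<Longrightarrow> \<exists>y. norm (y-x) < d \<and>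
        \<not> norm (integral {a..y} f - integral {a..x} f - (y - x) *\<^sub>R f x) \<le> e * norm (y - x)"
      using nd unfolding has_vector_derivative_def has_derivative_at_alt
      by (auto simp: bounded_linear_scaleR_left)
    obtain n where n: "inverse (real (Suc n)) < e" using e(1) reals_Archimedean by blast
    have "x \<in> ?E (inverse (real (Suc n)))"
    proof (intro CollectI conjI xab allI impI)
      fix d :: real assume "d > 0"
      then obtain y where y: "\<bar>y-x\<bar> < d" "norm (integral {a..y} f - integral {a..x} f - (y - x) *\<^sub>R f x) > e * \<bar>y - x\<bar>"
        using e(2)[of d] by (auto simp: not_le)
      moreover have "inverse (real (Suc n)) * \<bar>y - x\<bar> \<le> e * \<bar>y - x\<bar>" using n by (intro mult_right_mono) auto
      ultimately show "\<exists>y. \<bar>y-x\<bar> < d \<and> norm (integral {a..y} f - integral {a..x} f - (y - x) *\<^sub>R f x) > inverse (real (Suc n)) * \<bar>y - x\<bar>"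
        by fastforce
    qed
    then show "x \<in> (\<Union>n. ?E (inverse (real (Suc n))))" by blast
  qed
qed

subsection \<open>Locally integrable functions and their primitives\<close>

text \<open>Absolute gauge integrability on a set is Lebesgue integrability there, so this notion
  links the gauge form of the fundamental theorem with the Lebesgue integrals in which the Hilbert
  space is phrased.\<close>

definition loc_int :: "(real \<Rightarrow> 'a::euclidean_space) \<Rightarrow> bool" where
  "loc_int f \<longleftrightarrow> (\<forall>a b. f absolutely_integrable_on {a..b})"

lemma loc_intD: "loc_int f \<Longrightarrow> f absolutely_integrable_on {a..b}"
  by (simp add: loc_int_def)

lemma loc_int_integrable: "loc_int f \<Longrightarrow> f integrable_on {a..b}"
  using loc_intD set_lebesgue_integral_eq_integral(1) by blast

lemma loc_int_add: "loc_int f \<Longrightarrow> loc_int g \<Longrightarrow> loc_int (\<lambda>x. f x + g x)"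
  unfolding loc_int_def by (simp add: set_integral_add)

lemma loc_int_diff: "loc_int f \<Longrightarrow> loc_int g \<Longrightarrow> loc_int (\<lambda>x. f x - g x)"
  unfolding loc_int_def by (simp add: set_integral_diff)

lemma loc_int_linear: "loc_int f \<Longrightarrow> bounded_linear h \<Longrightarrow> loc_int (\<lambda>x. h (f x))"
  unfolding loc_int_def using absolutely_integrable_linear[where f=f and h=h] by (simp add: o_def)

lemma loc_int_minus: "loc_int f \<Longrightarrow> loc_int (\<lambda>x. - f x)"
  using loc_int_linear[of f uminus] by (simp add: bounded_linear_minus bounded_linear_ident)

lemma loc_int_norm: "loc_int f \<Longrightarrow> loc_int (\<lambda>x. norm (f x))"
  unfolding loc_int_def using absolutely_integrable_norm[where f=f] by (simp add: o_def)

lemma loc_int_bilinear_continuous: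
  fixes g :: "real \<Rightarrow> 'b::euclidean_space" and f :: "real \<Rightarrow> 'a::euclidean_space"
    and h :: "'b \<Rightarrow> 'a \<Rightarrow> 'c::euclidean_space"
  assumes "bilinear h" "continuous_on UNIV g" "loc_int f"
  shows "loc_int (\<lambda>x. h (g x) (f x))"
  unfolding loc_int_def
proof (intro allI)
  fix a b :: real
  have c: "continuous_on {a..b} g" using assms(2) continuous_on_subset by blast
  show "(\<lambda>x. h (g x) (f x)) absolutely_integrable_on {a..b}"
  proof (rule absolutely_integrable_bounded_measurable_product[OF assms(1)])
    show "g \<in> borel_measurable (lebesgue_on {a..b})"
      by (rule continuous_imp_measurable_on_sets_lebesgue[OF c]) auto
    show "bounded (g ` {a..b})" using compact_continuous_image[OF c] compact_imp_bounded by blast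
  qed (use assms loc_intD in auto)
qed

lemma bilinear_complex_times: "bilinear ((*) :: complex \<Rightarrow> complex \<Rightarrow> complex)"
  by (simp add: bilinear_conv_bounded_bilinear bounded_bilinear_mult)

lemma loc_int_mult_continuous:
  fixes g :: "real \<Rightarrow> complex"
  shows "continuous_on UNIV g \<Longrightarrow> loc_int f \<Longrightarrow> loc_int (\<lambda>x. g x * f x)"
  by (rule loc_int_bilinear_continuous[OF bilinear_complex_times])

lemma loc_int_mult_continuous_right:
  fixes g :: "real \<Rightarrow> complex"
  shows "continuous_on UNIV g \<Longrightarrow> loc_int f \<Longrightarrow> loc_int (\<lambda>x. f x * g x)"
  using loc_int_mult_continuous[of g f] by (simp add: mult.commute)

lemma loc_int_mult_continuous_real:
  fixes g :: "real \<Rightarrow> real"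
  shows "continuous_on UNIV g \<Longrightarrow> loc_int f \<Longrightarrow> loc_int (\<lambda>x. g x * f x)"
  by (rule loc_int_bilinear_continuous[OF bilinear_times])

lemma loc_int_continuous: "continuous_on UNIV f \<Longrightarrow> loc_int f"
  unfolding loc_int_def
  by (meson absolutely_integrable_continuous_real continuous_on_subset subset_UNIV)

lemma loc_int_bound:
  fixes f :: "real \<Rightarrow> 'a::euclidean_space" and g :: "real \<Rightarrow> real"
  assumes "f \<in> borel_measurable lebesgue" "loc_int g" "\<And>x. norm (f x) \<le> g x"
  shows "loc_int f"
  unfolding loc_int_def
proof (intro allI)
  fix a b :: real
  show "f absolutely_integrable_on {a..b}"
    by (rule measurable_bounded_by_integrable_imp_absolutely_integrable[of _ _ g])
      (use assms loc_int_integrable measurable_restrict_space1 in auto)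
qed

lemma loc_int_imp_measurable:
  fixes f :: "real \<Rightarrow> 'a::euclidean_space"
  assumes "loc_int f" shows "f \<in> borel_measurable lebesgue"
proof (rule borel_measurable_LIMSEQ_metric)
  show "(\<lambda>x. indicator {- real n..real n} x *\<^sub>R f x) \<in> borel_measurable lebesgue" for n
    using loc_intD[OF assms, of "- real n" "real n"] unfolding set_integrable_def by (rule borel_measurable_integrable)
  show "(\<lambda>n. indicator {- real n..real n} x *\<^sub>R f x) \<longlonglongrightarrow> f x" for x
  proof (rule tendsto_eventually)
    obtain N where "\<bar>x\<bar> \<le> real N" using real_arch_simple by blast
    then show "\<forall>\<^sub>F n in sequentially. indicator {- real n..real n} x *\<^sub>R f x = f x"
      by (intro eventually_sequentiallyI[of N]) (auto simp: indicator_def)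
  qed
qed

text \<open>For \<open>x < t\<close> the first integral runs over an empty interval, for
  \<open>x > t\<close> the second one does. The result is the oriented integral from
  \<open>t\<close> to \<open>x\<close>, usable on both sides of an initial point.\<close>

definition prim :: "real \<Rightarrow> (real \<Rightarrow> 'a::euclidean_space) \<Rightarrow> real \<Rightarrow> 'a" where
  "prim t f x = integral {t..x} f - integral {x..t} f"

lemma prim_self [simp]: "prim t f t = 0"
  by (simp add: prim_def)

lemma prim_diff:
  fixes f :: "real \<Rightarrow> 'a::euclidean_space"
  assumes f: "loc_int f" and xy: "x \<le> y"
  shows "prim t f y - prim t f x = integral {x..y} f"
proof -
  have c: "integral {a..b} f + integral {b..c} f = integral {a..c} f" if "a \<le> b" "b \<le> c" for a b c
    using Henstock_Kurzweil_Integration.integral_combine[OF that loc_int_integrable[OF f]] .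
  have e: "integral {a..b} f = 0" if "b < a" for a b using that by simp
  consider "t \<le> x" | "x \<le> t" "t \<le> y" | "y \<le> t" by linarith
  then show ?thesis
  proof cases
    case 1
    have "integral {x..t} f = 0" "integral {y..t} f = 0" using 1 xy e[of t x] e[of t y] by (cases "t = x"; cases "t = y"; force)+
    then show ?thesis using c[of t x y] 1 xy by (simp add: prim_def algebra_simps)
  next
    case 2
    have "integral {t..x} f = 0" "integral {y..t} f = 0" using 2 e[of x t] e[of t y] by (cases "t = x"; cases "t = y"; force)+
    then show ?thesis using c[of x t y] 2 by (simp add: prim_def algebra_simps)
  next
    case 3
    have "integral {t..x} f = 0" "integral {t..y} f = 0" using 3 xy e[of x t] e[of y t] by (cases "t = x"; cases "t = y"; force)+
    then show ?thesis using c[of x y t] 3 xy by (simp add: prim_def algebra_simps)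
  qed
qed

lemma AE_prim_has_vector_derivative:
  fixes f :: "real \<Rightarrow> 'a::euclidean_space"
  assumes f: "loc_int f"
  shows "AE x in lebesgue. (prim t f has_vector_derivative f x) (at x)"
proof -
  have "AE x in lebesgue. \<forall>n::nat. x \<in> {-real n<..<real n} \<longrightarrow>
      ((\<lambda>y. integral {-real n..y} f) has_vector_derivative f x) (at x)"
    unfolding AE_all_countable using AE_integral_has_vector_derivative[OF loc_int_integrable[OF f]] by blast
  then show ?thesis
  proof eventually_elim
    fix x assume a: "\<forall>n::nat. x \<in> {-real n<..<real n} \<longrightarrow>
      ((\<lambda>y. integral {-real n..y} f) has_vector_derivative f x) (at x)"
    obtain n :: nat where n: "\<bar>x\<bar> < real n" using reals_Archimedean2 by blast
    have xn: "x \<in> {-real n<..<real n}" using n by auto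
    have "((\<lambda>y. prim t f (-real n) + integral {-real n..y} f) has_vector_derivative 0 + f x) (at x)"
      using a[rule_format, OF xn] by (intro has_vector_derivative_add has_vector_derivative_const)
    then have "((\<lambda>y. prim t f (-real n) + integral {-real n..y} f) has_vector_derivative f x) (at x)" by simp
    then show "(prim t f has_vector_derivative f x) (at x)"
    proof (rule has_vector_derivative_transform_within_open[of _ _ _ "{-real n<..<real n}"])
      show "prim t f (-real n) + integral {-real n..y} f = prim t f y" if "y \<in> {-real n<..<real n}" for y
        using prim_diff[OF f, of "-real n" y t] that by (simp add: algebra_simps)
    qed (use xn in auto)
  qed
qed

text \<open>Integrating over the open interiors keeps a shared endpoint of two neighbouring
  intervals from being counted twice; the sum of the truncated integrands is then at most
  \<open>h\<close> at every point.\<close>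

lemma sum_integral_disjoint_le:
  fixes h :: "real \<Rightarrow> real"
  assumes h: "h integrable_on {a..b}" "\<And>x. h x \<ge> 0" and "finite I"
    and i: "\<And>i. i \<in> I \<Longrightarrow> lo i \<le> hi i \<and> {lo i..hi i} \<subseteq> {a..b}"
    and dj: "\<And>i j. i \<in> I \<Longrightarrow> j \<in> I \<Longrightarrow> i \<noteq> j \<Longrightarrow> {lo i<..<hi i} \<inter> {lo j<..<hi j} = {}"
  shows "(\<Sum>i\<in>I. integral {lo i..hi i} h) \<le> integral {a..b} h"
proof (rule has_integral_le)
  show "((\<lambda>x. \<Sum>i\<in>I. if x \<in> {lo i<..<hi i} then h x else 0) has_integral (\<Sum>i\<in>I. integral {lo i..hi i} h)) {a..b}"
  proof (rule has_integral_sum[OF assms(3)])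
    fix k assume k: "k \<in> I"
    have "{lo k<..<hi k} \<subseteq> {lo k..hi k}" by auto
    then have s: "{lo k<..<hi k} \<subseteq> {a..b}" using i[OF k] by blast
    have "h integrable_on {lo k..hi k}" using h(1) i[OF k] integrable_on_subinterval by blast
    then have "(h has_integral integral {lo k..hi k} h) {lo k<..<hi k}"
      using has_integral_Icc_iff_Ioo by blast
    then show "((\<lambda>x. if x \<in> {lo k<..<hi k} then h x else 0) has_integral integral {lo k..hi k} h) {a..b}"
      using has_integral_restrict[OF s] by blast
  qed
  show "(h has_integral integral {a..b} h) {a..b}" using h(1) by blast
  fix x assume "x \<in> {a..b}"
  show "(\<Sum>i\<in>I. if x \<in> {lo i<..<hi i} then h x else 0) \<le> h x"
  proof (cases "\<exists>k\<in>I. x \<in> {lo k<..<hi k}")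
    case True
    then obtain k where k: "k \<in> I" "x \<in> {lo k<..<hi k}" by blast
    have "(\<Sum>i\<in>I. if x \<in> {lo i<..<hi i} then h x else 0) = (\<Sum>i\<in>{k}. if x \<in> {lo i<..<hi i} then h x else 0)"
      using dj[of _ k] k assms(3) by (intro sum.mono_neutral_right) (auto, fastforce)
    then show ?thesis using k by simp
  next
    case False
    then have "(\<Sum>i\<in>I. if x \<in> {lo i<..<hi i} then h x else 0) = 0" by (intro sum.neutral) auto
    then show ?thesis using h(2) by simp
  qed
qed

text \<open>Truncation at height \<open>n\<close>: the norm of \<open>f\<close> is at most
  \<open>n\<close> plus an excess \<open>h n\<close> whose integral over \<open>{a..b}\<close> tends
  to zero by dominated convergence. For a fixed good \<open>n\<close> the bounded part contributes
  only \<open>n\<close> times the total length.\<close>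

lemma AC_loc_prim:
  fixes f :: "real \<Rightarrow> 'a::euclidean_space"
  assumes f: "loc_int f"
  shows "AC_loc (prim t f)"
  unfolding AC_loc_def AC_on_def
proof (intro allI impI)
  fix a b e :: real assume e: "e > 0"
  define g where "g x = norm (f x)" for x
  have g: "loc_int g" unfolding g_def by (rule loc_int_norm[OF f])
  define h where "h n x = max (g x - real n) 0" for n x
  have hm: "h n \<in> borel_measurable lebesgue" for n
    unfolding h_def using loc_int_imp_measurable[OF g] by measurable
  have hi: "loc_int (h n)" for n
    by (rule loc_int_bound[OF hm g]) (auto simp: h_def g_def)
  have "(\<lambda>n. integral {a..b} (h n)) \<longlonglongrightarrow> integral {a..b} (\<lambda>x. 0)"
  proof (rule dominated_convergence(2)[where h=g])
    show "(\<lambda>n. h n x) \<longlonglongrightarrow> 0" for x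
    proof (rule tendsto_eventually)
      obtain N where "g x \<le> real N" using real_arch_simple by blast
      then show "\<forall>\<^sub>F n in sequentially. h n x = 0"
        by (intro eventually_sequentiallyI[of N]) (auto simp: h_def)
    qed
  qed (use hi g loc_int_integrable in \<open>auto simp: h_def g_def\<close>)
  then have "\<forall>\<^sub>F n in sequentially. integral {a..b} (h n) < e / 2"
    using e by (intro order_tendstoD(2)) auto
  then obtain n where n: "integral {a..b} (h n) < e / 2" by (auto simp: eventually_sequentially)
  \<comment> \<open>Half of \<open>e\<close> pays for the excess and half for
    \<open>real n * d\<close>; the added one keeps the denominator positive when
    \<open>n = 0\<close>.\<close>
  define d where "d = e / (2 * (real n + 1))"
  show "\<exists>d>0. \<forall>(m::nat) lo hi. (\<forall>k<m. lo k \<le> hi k \<and> {lo k..hi k} \<subseteq> {a..b}) \<and>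
        (\<forall>j<m. \<forall>k<m. j \<noteq> k \<longrightarrow> {lo j<..<hi j} \<inter> {lo k<..<hi k} = {}) \<and>
        (\<Sum>k<m. hi k - lo k) < d \<longrightarrow> (\<Sum>k<m. norm (prim t f (hi k) - prim t f (lo k))) < e"
  proof (intro exI[of _ d] conjI allI impI; (elim conjE)?)
    show "d > 0" using e by (simp add: d_def)
    fix m :: nat and lo hi
    assume i: "\<forall>k<m. lo k \<le> hi k \<and> {lo k..hi k} \<subseteq> {a..b}"
      and dj: "\<forall>j<m. \<forall>k<m. j \<noteq> k \<longrightarrow> {lo j<..<hi j} \<inter> {lo k<..<hi k} = {}"
      and s: "(\<Sum>k<m. hi k - lo k) < d"
    have "(\<Sum>k<m. norm (prim t f (hi k) - prim t f (lo k))) \<le> (\<Sum>k<m. real n * (hi k - lo k) + integral {lo k..hi k} (h n))"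
    proof (rule sum_mono)
      fix k assume "k \<in> {..<m}"
      then have k: "lo k \<le> hi k" using i by auto
      have "norm (prim t f (hi k) - prim t f (lo k)) \<le> integral {lo k..hi k} g"
        unfolding prim_diff[OF f k] g_def
        using loc_int_integrable[OF f] loc_int_integrable[OF g, unfolded g_def]
        by (intro Henstock_Kurzweil_Integration.integral_norm_bound_integral) auto
      also have "\<dots> \<le> integral {lo k..hi k} (\<lambda>x. real n + h n x)"
        using loc_int_integrable[OF g] loc_int_integrable[OF hi]
        by (intro integral_le Henstock_Kurzweil_Integration.integrable_add) (auto, simp add: h_def)
      also have "\<dots> = real n * (hi k - lo k) + integral {lo k..hi k} (h n)"
        using loc_int_integrable[OF hi] k by (subst Henstock_Kurzweil_Integration.integral_add) auto
      finally show "norm (prim t f (hi k) - prim t f (lo k)) \<le> real n * (hi k - lo k) + integral {lo k..hi k} (h n)" .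
    qed
    also have "\<dots> = real n * (\<Sum>k<m. hi k - lo k) + (\<Sum>k<m. integral {lo k..hi k} (h n))"
      by (simp add: sum.distrib sum_distrib_left)
    also have "\<dots> \<le> real n * d + integral {a..b} (h n)"
      using s i dj by (intro add_mono mult_left_mono sum_integral_disjoint_le loc_int_integrable[OF hi]) (auto simp: h_def)
    also have "\<dots> < e / 2 + e / 2"
    proof (rule add_le_less_mono[OF _ n])
      show "real n * d \<le> e / 2" using e by (simp add: d_def divide_simps)
    qed
    finally show "(\<Sum>k<m. norm (prim t f (hi k) - prim t f (lo k))) < e" by simp
  qed
qed

subsection \<open>Calculus of locally absolutely continuous functions\<close>

text \<open>One comparison principle for sums, products, linear images and Lipschitz compositions:
  in each of them the increments of the new function are controlled on compact intervals by those of
  at most two given ones.\<close>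

lemma AC_loc_dominated:
  fixes u :: "real \<Rightarrow> 'a::real_normed_vector" and v :: "real \<Rightarrow> 'b::real_normed_vector"
    and w :: "real \<Rightarrow> 'c::real_normed_vector"
  assumes u: "AC_loc u" and v: "AC_loc v"
    and dom: "\<And>a b. \<exists>C. \<forall>x\<in>{a..b}. \<forall>y\<in>{a..b}. norm (w y - w x) \<le> C * (norm (u y - u x) + norm (v y - v x))"
  shows "AC_loc w"
  unfolding AC_loc_def AC_on_def
proof (intro allI impI)
  fix a b e :: real assume e: "e > 0"
  obtain C0 where C0: "\<forall>x\<in>{a..b}. \<forall>y\<in>{a..b}. norm (w y - w x) \<le> C0 * (norm (u y - u x) + norm (v y - v x))"
    using dom by blast
  \<comment> \<open>The constant supplied by \<open>dom\<close> may have any sign; the enlarged one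
    is positive and can be divided by.\<close>
  define C where "C = \<bar>C0\<bar> + 1"
  have C: "C > 0" "\<And>x y. x \<in> {a..b} \<Longrightarrow> y \<in> {a..b} \<Longrightarrow> norm (w y - w x) \<le> C * (norm (u y - u x) + norm (v y - v x))"
  proof -
    show "C > 0" by (simp add: C_def)
    fix x y assume xy: "x \<in> {a..b}" "y \<in> {a..b}"
    have "C0 * (norm (u y - u x) + norm (v y - v x)) \<le> C * (norm (u y - u x) + norm (v y - v x))"
      by (intro mult_right_mono) (auto simp: C_def)
    then show "norm (w y - w x) \<le> C * (norm (u y - u x) + norm (v y - v x))" using C0 xy by force
  qed
  have e': "e / (2 * C) > 0" using e C(1) by simp
  have *: "\<exists>d>0. \<forall>(n::nat) (lo::nat \<Rightarrow> real) hi.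
        (\<forall>k<n. lo k \<le> hi k \<and> {lo k..hi k} \<subseteq> {a..b}) \<and>
        (\<forall>j<n. \<forall>k<n. j \<noteq> k \<longrightarrow> {lo j<..<hi j} \<inter> {lo k<..<hi k} = {}) \<and>
        (\<Sum>k<n. hi k - lo k) < d \<longrightarrow> (\<Sum>k<n. norm (z (hi k) - z (lo k))) < e / (2 * C)"
    if "AC_loc z" for z :: "real \<Rightarrow> 'd::real_normed_vector"
    using that e' unfolding AC_loc_def AC_on_def by simp
  obtain d1 where d1: "d1 > 0" and D1: "\<forall>(n::nat) (lo::nat \<Rightarrow> real) hi.
        (\<forall>k<n. lo k \<le> hi k \<and> {lo k..hi k} \<subseteq> {a..b}) \<and>
        (\<forall>j<n. \<forall>k<n. j \<noteq> k \<longrightarrow> {lo j<..<hi j} \<inter> {lo k<..<hi k} = {}) \<and>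
        (\<Sum>k<n. hi k - lo k) < d1 \<longrightarrow> (\<Sum>k<n. norm (u (hi k) - u (lo k))) < e / (2 * C)"
    using *[OF u] by (elim exE conjE) (rule that)
  obtain d2 where d2: "d2 > 0" and D2: "\<forall>(n::nat) (lo::nat \<Rightarrow> real) hi.
        (\<forall>k<n. lo k \<le> hi k \<and> {lo k..hi k} \<subseteq> {a..b}) \<and>
        (\<forall>j<n. \<forall>k<n. j \<noteq> k \<longrightarrow> {lo j<..<hi j} \<inter> {lo k<..<hi k} = {}) \<and>
        (\<Sum>k<n. hi k - lo k) < d2 \<longrightarrow> (\<Sum>k<n. norm (v (hi k) - v (lo k))) < e / (2 * C)"
    using *[OF v] by (elim exE conjE) (rule that)
  show "\<exists>d>0. \<forall>(n::nat) (lo::nat \<Rightarrow> real) hi.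
        (\<forall>k<n. lo k \<le> hi k \<and> {lo k..hi k} \<subseteq> {a..b}) \<and>
        (\<forall>j<n. \<forall>k<n. j \<noteq> k \<longrightarrow> {lo j<..<hi j} \<inter> {lo k<..<hi k} = {}) \<and>
        (\<Sum>k<n. hi k - lo k) < d \<longrightarrow> (\<Sum>k<n. norm (w (hi k) - w (lo k))) < e"
  proof (intro exI[of _ "min d1 d2"] conjI allI impI; (elim conjE)?)
    show "0 < min d1 d2" using d1 d2 by simp
    fix n :: nat and lo hi :: "nat \<Rightarrow> real"
    assume i: "\<forall>k<n. lo k \<le> hi k \<and> {lo k..hi k} \<subseteq> {a..b}"
      and dj: "\<forall>j<n. \<forall>k<n. j \<noteq> k \<longrightarrow> {lo j<..<hi j} \<inter> {lo k<..<hi k} = {}"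
      and s: "(\<Sum>k<n. hi k - lo k) < min d1 d2"
    have 1: "(\<Sum>k<n. norm (u (hi k) - u (lo k))) < e / (2 * C)"
      using D1[rule_format, of n lo hi] i dj s by simp
    have 2: "(\<Sum>k<n. norm (v (hi k) - v (lo k))) < e / (2 * C)"
      using D2[rule_format, of n lo hi] i dj s by simp
    have "(\<Sum>k<n. norm (w (hi k) - w (lo k))) \<le> (\<Sum>k<n. C * (norm (u (hi k) - u (lo k)) + norm (v (hi k) - v (lo k))))"
    proof (rule sum_mono)
      fix k assume "k \<in> {..<n}"
      then have "lo k \<le> hi k" "{lo k..hi k} \<subseteq> {a..b}" using i by auto
      then have "lo k \<in> {a..b}" "hi k \<in> {a..b}" by auto
      then show "norm (w (hi k) - w (lo k)) \<le> C * (norm (u (hi k) - u (lo k)) + norm (v (hi k) - v (lo k)))"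
        by (rule C(2))
    qed
    also have "\<dots> = C * ((\<Sum>k<n. norm (u (hi k) - u (lo k))) + (\<Sum>k<n. norm (v (hi k) - v (lo k))))"
      by (simp add: sum.distrib flip: sum_distrib_left)
    also have "\<dots> < C * (e / (2 * C) + e / (2 * C))"
      using C(1) 1 2 by (intro mult_strict_left_mono add_strict_mono)
    also have "\<dots> = e" using C(1) by (simp add: field_simps)
    finally show "(\<Sum>k<n. norm (w (hi k) - w (lo k))) < e" .
  qed
qed

lemma AC_loc_ident: "AC_loc (\<lambda>x::real. x)"
  unfolding AC_loc_def AC_on_def
proof (intro allI impI)
  fix a b e :: real assume e: "e > 0"
  show "\<exists>d>0. \<forall>(n::nat) (lo::nat \<Rightarrow> real) hi.
        (\<forall>k<n. lo k \<le> hi k \<and> {lo k..hi k} \<subseteq> {a..b}) \<and>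
        (\<forall>j<n. \<forall>k<n. j \<noteq> k \<longrightarrow> {lo j<..<hi j} \<inter> {lo k<..<hi k} = {}) \<and>
        (\<Sum>k<n. hi k - lo k) < d \<longrightarrow> (\<Sum>k<n. norm (hi k - lo k)) < e"
  proof (intro exI[of _ e] conjI allI impI e; (elim conjE)?)
    fix n :: nat and lo hi :: "nat \<Rightarrow> real"
    assume i: "\<forall>k<n. lo k \<le> hi k \<and> {lo k..hi k} \<subseteq> {a..b}" and s: "(\<Sum>k<n. hi k - lo k) < e"
    have "(\<Sum>k<n. norm (hi k - lo k)) = (\<Sum>k<n. hi k - lo k)" using i by (intro sum.cong) auto
    then show "(\<Sum>k<n. norm (hi k - lo k)) < e" using s by simp
  qed
qed

lemma AC_loc_continuous:
  fixes u :: "real \<Rightarrow> 'a::real_normed_vector"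
  assumes "AC_loc u" shows "continuous_on S u"
proof -
  have "isCont u x" for x
    unfolding continuous_at_eps_delta
  proof (intro allI impI)
    fix e :: real assume e: "e > 0"
    obtain d where d: "d > 0" and D: "\<forall>(n::nat) (lo::nat \<Rightarrow> real) hi.
        (\<forall>k<n. lo k \<le> hi k \<and> {lo k..hi k} \<subseteq> {x-1..x+1}) \<and>
        (\<forall>j<n. \<forall>k<n. j \<noteq> k \<longrightarrow> {lo j<..<hi j} \<inter> {lo k<..<hi k} = {}) \<and>
        (\<Sum>k<n. hi k - lo k) < d \<longrightarrow> (\<Sum>k<n. norm (u (hi k) - u (lo k))) < e"
      using assms[unfolded AC_loc_def AC_on_def, THEN spec[of _ "x-1"], THEN spec[of _ "x+1"], THEN spec[of _ e], THEN mp, OF e]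
      by (elim exE conjE) (rule that)
    show "\<exists>d>0. \<forall>x'. dist x' x < d \<longrightarrow> dist (u x') (u x) < e"
    proof (intro exI[of _ "min d 1"] conjI allI impI)
      show "0 < min d 1" using d by simp
      fix y assume y: "dist y x < min d 1"
      have "norm (u (max x y) - u (min x y)) < e"
        using D[rule_format, of 1 "\<lambda>_. min x y" "\<lambda>_. max x y"] y by (auto simp: dist_real_def min_def max_def split: if_splits)
      then show "dist (u y) (u x) < e"
        by (auto simp: dist_norm min_def max_def norm_minus_commute split: if_splits)
    qed
  qed
  then show ?thesis by (simp add: continuous_at_imp_continuous_on)
qed

lemma AC_loc_bounded:
  fixes u :: "real \<Rightarrow> 'a::real_normed_vector"
  assumes "AC_loc u" obtains B where "B \<ge> 0" "\<And>x. x \<in> {a..b} \<Longrightarrow> norm (u x) \<le> B"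
proof -
  have "bounded (u ` {a..b})"
    using compact_continuous_image[OF AC_loc_continuous[OF assms]] compact_imp_bounded by blast
  then obtain B where "\<forall>y\<in>u ` {a..b}. norm y \<le> B" by (auto simp: bounded_iff)
  then have "norm (u x) \<le> max B 0" if "x \<in> {a..b}" for x using that by (simp add: le_max_iff_disj)
  then show ?thesis using that[of "max B 0"] by simp
qed

lemma AC_loc_add: "AC_loc u \<Longrightarrow> AC_loc v \<Longrightarrow> AC_loc (\<lambda>x. u x + v x)"
  by (rule AC_loc_dominated[of u v]) (auto intro!: exI[of _ 1] simp: add_diff_add norm_triangle_ineq)

lemma AC_loc_linear:
  assumes "AC_loc u" "bounded_linear h" shows "AC_loc (\<lambda>x. h (u x))"
proof (rule AC_loc_dominated[OF assms(1) assms(1)])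
  fix a b
  obtain K where K: "K > 0" "\<And>x. norm (h x) \<le> norm x * K" using bounded_linear.pos_bounded[OF assms(2)] by blast
  show "\<exists>C. \<forall>x\<in>{a..b}. \<forall>y\<in>{a..b}. norm (h (u y) - h (u x)) \<le> C * (norm (u y - u x) + norm (u y - u x))"
  proof (intro exI[of _ K] ballI)
    fix x y
    have "norm (h (u y) - h (u x)) \<le> K * norm (u y - u x)"
      using K(2)[of "u y - u x"] by (simp add: linear_diff bounded_linear.linear[OF assms(2)] mult.commute)
    also have "\<dots> \<le> K * (norm (u y - u x) + norm (u y - u x))" using K by simp
    finally show "norm (h (u y) - h (u x)) \<le> K * (norm (u y - u x) + norm (u y - u x))" .
  qed
qed

lemma AC_loc_mult:
  fixes u v :: "real \<Rightarrow> 'a::real_normed_algebra"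
  assumes u: "AC_loc u" and v: "AC_loc v" shows "AC_loc (\<lambda>x. u x * v x)"
proof (rule AC_loc_dominated[OF u v])
  fix a b
  obtain B where B: "B \<ge> 0" "\<And>x. x \<in> {a..b} \<Longrightarrow> norm (u x) \<le> B" using AC_loc_bounded[OF u] by blast
  obtain D where D: "D \<ge> 0" "\<And>x. x \<in> {a..b} \<Longrightarrow> norm (v x) \<le> D" using AC_loc_bounded[OF v] by blast
  show "\<exists>C. \<forall>x\<in>{a..b}. \<forall>y\<in>{a..b}. norm (u y * v y - u x * v x) \<le> C * (norm (u y - u x) + norm (v y - v x))"
  proof (intro exI[of _ "B + D"] ballI)
    fix x y assume xy: "x \<in> {a..b}" "y \<in> {a..b}"
    have "u y * v y - u x * v x = (u y - u x) * v y + u x * (v y - v x)" by (simp add: algebra_simps)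
    then have "norm (u y * v y - u x * v x) \<le> norm (u y - u x) * norm (v y) + norm (u x) * norm (v y - v x)"
      by (metis add_mono norm_mult_ineq norm_triangle_le)
    also have "\<dots> \<le> norm (u y - u x) * D + B * norm (v y - v x)"
      using B D xy by (intro add_mono mult_left_mono mult_right_mono) auto
    also have "\<dots> \<le> (B + D) * (norm (u y - u x) + norm (v y - v x))"
      using B(1) D(1) by (simp add: algebra_simps)
    finally show "norm (u y * v y - u x * v x) \<le> (B + D) * (norm (u y - u x) + norm (v y - v x))" .
  qed
qed

text \<open>The set \<open>S\<close> confines the Lipschitz condition to values that
  \<open>u\<close> takes. It is meant for the inverse square root of \<open>t + \<epsilon>\<close>,
  which is Lipschitz on the half-line \<open>t \<ge> 0\<close> but singular at
  \<open>- \<epsilon>\<close>.\<close>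

lemma AC_loc_lipschitz_comp:
  fixes u :: "real \<Rightarrow> real" and h :: "real \<Rightarrow> 'a::real_normed_vector"
  assumes u: "AC_loc u" and h: "\<And>B. \<exists>C. \<forall>s\<in>S. \<forall>t\<in>S. \<bar>s\<bar> \<le> B \<longrightarrow> \<bar>t\<bar> \<le> B \<longrightarrow> norm (h s - h t) \<le> C * \<bar>s - t\<bar>"
    and S: "range u \<subseteq> S"
  shows "AC_loc (\<lambda>x. h (u x))"
proof (rule AC_loc_dominated[OF u u])
  fix a b
  obtain B where B: "B \<ge> 0" "\<And>x. x \<in> {a..b} \<Longrightarrow> norm (u x) \<le> B" using AC_loc_bounded[OF u] by blast
  obtain C where C: "\<And>s t. s \<in> S \<Longrightarrow> t \<in> S \<Longrightarrow> \<bar>s\<bar> \<le> B \<Longrightarrow> \<bar>t\<bar> \<le> B \<Longrightarrow> norm (h s - h t) \<le> C * \<bar>s - t\<bar>"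
    using h[of B] by blast
  show "\<exists>C. \<forall>x\<in>{a..b}. \<forall>y\<in>{a..b}. norm (h (u y) - h (u x)) \<le> C * (norm (u y - u x) + norm (u y - u x))"
  \<comment> \<open>The factor one half compensates for \<open>u\<close> filling both slots of
    \<open>AC_loc_dominated\<close>.\<close>
  proof (intro exI[of _ "C/2"] ballI)
    fix x y assume "x \<in> {a..b}" "y \<in> {a..b}"
    then show "norm (h (u y) - h (u x)) \<le> C/2 * (norm (u y - u x) + norm (u y - u x))"
      using C[of "u y" "u x"] B(2)[of x] B(2)[of y] S by auto
  qed
qed

lemma AC_loc_C1_comp:
  fixes u h h' :: "real \<Rightarrow> real"
  assumes u: "AC_loc u" and h: "\<And>x. (h has_real_derivative h' x) (at x)" and h': "continuous_on UNIV h'"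
  shows "AC_loc (\<lambda>x. h (u x))"
proof (rule AC_loc_lipschitz_comp[OF u, where S = UNIV])
  fix B :: real
  have "compact (h' ` {-B..B})"
    using h' by (meson compact_continuous_image compact_Icc continuous_on_subset subset_UNIV)
  then obtain C where C: "\<And>x. x \<in> {-B..B} \<Longrightarrow> norm (h' x) \<le> C"
    using compact_imp_bounded bounded_iff by (metis imageI)
  have "norm (h s - h t) \<le> C * norm (s - t)" if "\<bar>s\<bar> \<le> B" "\<bar>t\<bar> \<le> B" for s t
  proof (rule field_differentiable_bound[of "{-B..B}" h h'])
    show "(h has_field_derivative h' z) (at z within {-B..B})" for z
      using h by (rule has_field_derivative_at_within)
  qed (use C that in auto)
  then show "\<exists>C. \<forall>s\<in>UNIV. \<forall>t\<in>UNIV. \<bar>s\<bar> \<le> B \<longrightarrow> \<bar>t\<bar> \<le> B \<longrightarrow> norm (h s - h t) \<le> C * \<bar>s - t\<bar>"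
    by auto
qed simp

lemma AC_loc_C1:
  fixes h h' :: "real \<Rightarrow> real"
  assumes "\<And>x. (h has_real_derivative h' x) (at x)" and "continuous_on UNIV h'"
  shows "AC_loc h"
  using AC_loc_C1_comp[OF AC_loc_ident assms] .

lemma AC_loc_has_integral:
  fixes u :: "real \<Rightarrow> 'a::euclidean_space"
  assumes "AC_loc u" "AE x in lebesgue. (u has_vector_derivative d x) (at x)" "a \<le> b"
  shows "(d has_integral (u b - u a)) {a..b}"
  by (rule AC_on_imp_has_integral) (use assms in \<open>auto simp: AC_loc_def elim: eventually_mono\<close>)

subsection \<open>Linear first-order systems with locally integrable coefficients\<close>

lemma loc_int_Pair:
  fixes f :: "real \<Rightarrow> 'a::euclidean_space" and g :: "real \<Rightarrow> 'b::euclidean_space"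
  assumes "loc_int f" "loc_int g" shows "loc_int (\<lambda>x. (f x, g x))"
proof -
  have "loc_int (\<lambda>x. (f x, 0::'b) + (0::'a, g x))"
    by (intro loc_int_add loc_int_linear[OF assms(1)] loc_int_linear[OF assms(2)])
      (auto intro!: bounded_linear_Pair bounded_linear_ident bounded_linear_zero)
  then show ?thesis by simp
qed

lemma prim_norm_le:
  fixes g :: "real \<Rightarrow> 'a::euclidean_space"
  assumes g: "loc_int g" and h: "loc_int h"
    and le: "\<And>s. s \<in> {min t x..max t x} \<Longrightarrow> norm (g s) \<le> h s"
  shows "norm (prim t g x) \<le> integral {min t x..max t x} h"
proof -
  have *: "norm (integral {min t x..max t x} g) \<le> integral {min t x..max t x} h"
    using loc_int_integrable[OF g] loc_int_integrable[OF h] le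
    by (intro Henstock_Kurzweil_Integration.integral_norm_bound_integral) auto
  show ?thesis
  proof (cases "t \<le> x")
    case True then show ?thesis using * prim_diff[OF g True, of t] by simp
  next
    case False then have "x \<le> t" by simp
    then have "prim t g x = - integral {x..t} g" using prim_diff[OF g \<open>x \<le> t\<close>, of t] by (metis add.inverse_inverse diff_0 prim_self)
    then show ?thesis using * \<open>x \<le> t\<close> by simp
  qed
qed

lemma prim_sub:
  fixes f g :: "real \<Rightarrow> 'a::euclidean_space"
  assumes "loc_int f" "loc_int g"
  shows "prim t f x - prim t g x = prim t (\<lambda>s. f s - g s) x"
  unfolding prim_def using assms
  by (simp add: Henstock_Kurzweil_Integration.integral_diff loc_int_integrable algebra_simps)

lemma AC_loc_const: "AC_loc (\<lambda>x. c)"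
  by (rule AC_loc_dominated[OF AC_loc_ident AC_loc_ident]) (auto intro!: exI[of _ 0])

text \<open>Picard iteration; measuring differences relative to the weight
  \<open>exp (2 P) + exp (- 2 P)\<close>, where \<open>P' = k\<close>, makes the iteration a contraction with factor
  one half on all of the line.\<close>

theorem linear_Picard:
  fixes G :: "real \<Rightarrow> 'a::euclidean_space \<Rightarrow> 'a"
  assumes Gi: "\<And>Y. continuous_on UNIV Y \<Longrightarrow> loc_int (\<lambda>x. G x (Y x))"
    and k: "loc_int k" "\<And>x. k x \<ge> 0"
    and Lip: "\<And>x y z. norm (G x y - G x z) \<le> k x * norm (y - z)"
  shows "\<exists>Y. continuous_on UNIV Y \<and> (\<forall>x. Y x = c + prim t (\<lambda>s. G s (Y s)) x)"
proof -
  define P where "P = prim t k"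
  define E where "E x = exp (2 * P x) + exp (- (2 * P x))" for x
  \<comment> \<open>A primitive of \<open>k * E\<close>, so that the integral of the weight against
    \<open>k\<close> has a closed form.\<close>
  define S where "S x = (exp (2 * P x) - exp (- (2 * P x))) / 2" for x
  have P: "AC_loc P" unfolding P_def by (rule AC_loc_prim[OF k(1)])
  have Pc: "continuous_on UNIV P" by (rule AC_loc_continuous[OF P])
  have Ec: "continuous_on A E" for A unfolding E_def
    by (intro continuous_intros continuous_on_subset[OF Pc]) auto
  have kE: "loc_int (\<lambda>s. k s * E s)"
    using loc_int_mult_continuous_real[OF Ec k(1)] by (simp add: mult.commute)
  have S_AC: "AC_loc S" unfolding S_def
  proof (rule AC_loc_C1_comp[OF P, where h = "\<lambda>y. (exp (2 * y) - exp (- (2 * y))) / 2" and h' = "\<lambda>y. exp (2 * y) + exp (- (2 * y))"])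
    show "((\<lambda>y. (exp (2 * y) - exp (- (2 * y))) / 2) has_real_derivative exp (2 * x) + exp (- (2 * x))) (at x)" for x
      by (auto intro!: derivative_eq_intros simp: field_simps)
  qed (intro continuous_intros)
  have "AE x in lebesgue. (S has_vector_derivative k x * E x) (at x)"
    using AE_prim_has_vector_derivative[OF k(1), of t]
  proof eventually_elim
    fix x assume "(prim t k has_vector_derivative k x) (at x)"
    then have "(P has_real_derivative k x) (at x)" unfolding P_def by (simp add: has_real_derivative_iff_has_vector_derivative)
    then have "(S has_real_derivative k x * E x) (at x)" unfolding S_def E_def
      by (auto intro!: derivative_eq_intros simp: field_simps)
    then show "(S has_vector_derivative k x * E x) (at x)" by (simp add: has_real_derivative_iff_has_vector_derivative)
  qed
  then have Sint: "integral {a..b} (\<lambda>s. k s * E s) = S b - S a" if "a \<le> b" for a b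
    using AC_loc_has_integral[OF S_AC _ that] by (simp add: integral_unique)
  have St: "S t = 0" by (simp add: S_def P_def)
  \<comment> \<open>The contraction factor: the integral is the absolute value of \<open>S x\<close>
    because \<open>S t = 0\<close>. The exponential with positive sign dominates to the right of
    \<open>t\<close>, where \<open>P \<ge> 0\<close>, the other one to the left.\<close>
  have Sb: "integral {min t x..max t x} (\<lambda>s. k s * E s) \<le> E x / 2" for x
  proof -
    have ab: "(a - b) / 2 \<le> (a + b) / 2" "- ((a - b) / 2) \<le> (a + b) / 2" if "a > 0" "b > 0" for a b :: real
      using that by (simp_all add: field_simps)
    have "S x \<le> E x / 2" "- S x \<le> E x / 2"
      unfolding S_def E_def by (rule ab(1), simp, simp, rule ab(2), simp, simp)
    then show ?thesis using Sint[of t x] Sint[of x t] St by (cases "t \<le> x") (simp_all add: min_def max_def)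
  qed
  define Ys where "Ys = rec_nat (\<lambda>x. c) (\<lambda>n Y x. c + prim t (\<lambda>s. G s (Y s)) x)"
  have Y0: "Ys 0 = (\<lambda>x. c)" and YS: "Ys (Suc n) = (\<lambda>x. c + prim t (\<lambda>s. G s (Ys n s)) x)" for n
    by (simp_all add: Ys_def)
  have Yc: "continuous_on UNIV (Ys n)" for n
  proof (induction n)
    case (Suc n) show ?case unfolding YS
      by (intro continuous_intros AC_loc_continuous[OF AC_loc_prim[OF Gi[OF Suc]]])
  qed (simp add: Y0)
  note GY = Gi[OF Yc]
  have dec: "\<exists>C. \<forall>n. \<forall>x\<in>{t-M..t+M}. norm (Ys (Suc n) x - Ys n x) \<le> C * (1/2)^n" for M
  proof -
    let ?J = "{t-M..t+M}"
    have "continuous_on ?J (\<lambda>x. Ys (Suc 0) x - Ys 0 x)"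
      by (intro continuous_on_diff continuous_on_subset[OF Yc]) auto
    then have "bounded ((\<lambda>x. Ys (Suc 0) x - Ys 0 x) ` ?J)"
      using compact_continuous_image compact_imp_bounded by blast
    then obtain C where C: "\<And>x. x \<in> ?J \<Longrightarrow> norm (Ys (Suc 0) x - Ys 0 x) \<le> C"
      unfolding bounded_iff by blast
    have "bounded (E ` ?J)" using compact_continuous_image[OF Ec] compact_imp_bounded by blast
    then obtain B where B: "\<And>x. x \<in> ?J \<Longrightarrow> norm (E x) \<le> B"
      unfolding bounded_iff by blast
    \<comment> \<open>A weight of at least one lets the bound for the first difference be multiplied
      by it, which starts the induction.\<close>
    have E1: "E x \<ge> 1" for x
    proof (cases "P x \<ge> 0")
      case True then have "exp (2 * P x) \<ge> 1" by simp
      then show ?thesis unfolding E_def using exp_gt_zero[of "-(2 * P x)"] by linarith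
    next
      case False then have "exp (-(2 * P x)) \<ge> 1" by simp
      then show ?thesis unfolding E_def using exp_gt_zero[of "2 * P x"] by linarith
    qed
    have main: "norm (Ys (Suc n) x - Ys n x) \<le> \<bar>C\<bar> * (1/2)^n * E x" if "x \<in> ?J" for n x
      using that
    proof (induction n arbitrary: x)
      case 0
      have "\<bar>C\<bar> * 1 \<le> \<bar>C\<bar> * E x" using E1[of x] by (intro mult_left_mono) auto
      then show ?case using C[OF 0] by simp
    next
      case (Suc n)
      have "Ys (Suc (Suc n)) x - Ys (Suc n) x = prim t (\<lambda>s. G s (Ys (Suc n) s) - G s (Ys n s)) x"
        using prim_sub[OF GY[of "Suc n"] GY[of n]] by (simp only: YS[of "Suc n"] YS[of n]) (simp add: YS[symmetric])
      also have "norm \<dots> \<le> integral {min t x..max t x} (\<lambda>s. (\<bar>C\<bar> * (1/2)^n) * (k s * E s))"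
      proof (rule prim_norm_le)
        show "loc_int (\<lambda>s. G s (Ys (Suc n) s) - G s (Ys n s))" by (intro loc_int_diff GY)
        show "loc_int (\<lambda>s. (\<bar>C\<bar> * (1/2)^n) * (k s * E s))"
          by (intro loc_int_mult_continuous_real[OF _ kE] continuous_intros)
        fix s assume "s \<in> {min t x..max t x}"
        then have s: "s \<in> ?J" using Suc.prems by (auto simp: min_def max_def split: if_splits)
        have "norm (G s (Ys (Suc n) s) - G s (Ys n s)) \<le> k s * norm (Ys (Suc n) s - Ys n s)" by (rule Lip)
        also have "\<dots> \<le> k s * (\<bar>C\<bar> * (1/2)^n * E s)" by (intro mult_left_mono Suc.IH s k(2))
        finally show "norm (G s (Ys (Suc n) s) - G s (Ys n s)) \<le> (\<bar>C\<bar> * (1/2)^n) * (k s * E s)" by (simp add: algebra_simps)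
      qed
      also have "\<dots> = (\<bar>C\<bar> * (1/2)^n) * integral {min t x..max t x} (\<lambda>s. k s * E s)" by simp
      also have "\<dots> \<le> (\<bar>C\<bar> * (1/2)^n) * (E x / 2)" by (intro mult_left_mono Sb) auto
      finally show ?case by simp
    qed
    show ?thesis
    proof (intro exI[of _ "\<bar>C\<bar> * B"] allI ballI)
      fix n x assume x: "x \<in> ?J"
      have "\<bar>C\<bar> * (1/2)^n * E x \<le> \<bar>C\<bar> * (1/2)^n * B" using B[OF x] by (intro mult_left_mono) auto
      then show "norm (Ys (Suc n) x - Ys n x) \<le> \<bar>C\<bar> * B * (1/2)^n" using main[OF x, of n] by (simp add: algebra_simps)
    qed
  qed
  define Y where "Y x = c + (\<Sum>n. Ys (Suc n) x - Ys n x)" for x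
  have tel: "(\<Sum>i<n. Ys (Suc i) x - Ys i x) = Ys n x - c" for n x
    using sum_lessThan_telescope[of "\<lambda>i. Ys i x" n] by (simp add: Y0)
  have ul: "uniform_limit {t-M..t+M} Ys Y sequentially" for M
  proof -
    obtain C where C: "\<And>n x. x \<in> {t-M..t+M} \<Longrightarrow> norm (Ys (Suc n) x - Ys n x) \<le> C * (1/2)^n" using dec by blast
    have "uniform_limit {t-M..t+M} (\<lambda>n x. \<Sum>i<n. Ys (Suc i) x - Ys i x) (\<lambda>x. \<Sum>i. Ys (Suc i) x - Ys i x) sequentially"
      by (rule Weierstrass_m_test[OF C]) (auto intro: summable_mult summable_geometric)
    then have "uniform_limit {t-M..t+M} (\<lambda>n x. c + (\<Sum>i<n. Ys (Suc i) x - Ys i x)) (\<lambda>x. c + (\<Sum>i. Ys (Suc i) x - Ys i x)) sequentially"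
      by (intro uniform_limit_intros)
    then show ?thesis unfolding tel Y_def by simp
  qed
  have YcJ: "continuous_on {t-M..t+M} Y" for M
    by (rule uniform_limit_theorem[OF _ ul]) (auto intro!: always_eventually continuous_on_subset[OF Yc])
  have YC: "continuous_on UNIV Y"
    unfolding continuous_on_eq_continuous_at[OF open_UNIV]
  proof
    fix x :: real
    have "x \<in> interior {t-(\<bar>x-t\<bar>+1)..t+(\<bar>x-t\<bar>+1)}" by auto
    then show "isCont Y x" using continuous_on_interior[OF YcJ] by blast
  qed
  have "Y x = c + prim t (\<lambda>s. G s (Y s)) x" for x
  proof -
    define M where "M = \<bar>x - t\<bar>"
    let ?J = "{t-M..t+M}"
    have xJ: "{min t x..max t x} \<subseteq> ?J" "x \<in> ?J" by (auto simp: M_def)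
    define K where "K = integral {min t x..max t x} k"
    have K: "K \<ge> 0" unfolding K_def using k by (intro integral_nonneg loc_int_integrable) auto
    have "(\<lambda>n. prim t (\<lambda>s. G s (Ys n s)) x) \<longlonglongrightarrow> prim t (\<lambda>s. G s (Y s)) x"
    proof (rule LIMSEQ_I)
      fix e :: real assume e: "e > 0"
      define e' where "e' = e / (K + 1)"
      have e': "e' > 0" using e K by (simp add: e'_def)
      obtain N where N: "\<And>n s. n \<ge> N \<Longrightarrow> s \<in> ?J \<Longrightarrow> dist (Ys n s) (Y s) < e'"
        using uniform_limitD[OF ul[of M] e'] unfolding eventually_sequentially by blast
      show "\<exists>no. \<forall>n\<ge>no. norm (prim t (\<lambda>s. G s (Ys n s)) x - prim t (\<lambda>s. G s (Y s)) x) < e"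
      proof (intro exI[of _ N] allI impI)
        fix n assume n: "n \<ge> N"
        have "norm (prim t (\<lambda>s. G s (Ys n s)) x - prim t (\<lambda>s. G s (Y s)) x) = norm (prim t (\<lambda>s. G s (Ys n s) - G s (Y s)) x)"
          using prim_sub[OF GY Gi[OF YC]] by simp
        also have "\<dots> \<le> integral {min t x..max t x} (\<lambda>s. e' * k s)"
        proof (rule prim_norm_le)
          show "loc_int (\<lambda>s. G s (Ys n s) - G s (Y s))" by (intro loc_int_diff GY Gi[OF YC])
          show "loc_int (\<lambda>s. e' * k s)" by (intro loc_int_mult_continuous_real[OF _ k(1)] continuous_intros)
          fix s assume "s \<in> {min t x..max t x}"
          then have s: "s \<in> ?J" using xJ by blast
          have "norm (G s (Ys n s) - G s (Y s)) \<le> k s * norm (Ys n s - Y s)" by (rule Lip)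
          also have "\<dots> \<le> k s * e'" using N[OF n s] k(2) by (intro mult_left_mono) (auto simp: dist_norm)
          finally show "norm (G s (Ys n s) - G s (Y s)) \<le> e' * k s" by (simp add: mult.commute)
        qed
        also have "\<dots> = e' * K" by (simp add: K_def)
        also have "\<dots> < e" using e K by (simp add: e'_def divide_simps)
        finally show "norm (prim t (\<lambda>s. G s (Ys n s)) x - prim t (\<lambda>s. G s (Y s)) x) < e" .
      qed
    qed
    then have "(\<lambda>n. Ys (Suc n) x) \<longlonglongrightarrow> c + prim t (\<lambda>s. G s (Y s)) x"
      unfolding YS by (intro tendsto_intros)
    moreover have "(\<lambda>n. Ys (Suc n) x) \<longlonglongrightarrow> Y x"
      using tendsto_uniform_limitI[OF ul xJ(2)] LIMSEQ_Suc by blast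
    ultimately show ?thesis using LIMSEQ_unique by blast
  qed
  then show ?thesis using YC by blast
qed

subsection \<open>The quasi-differential system\<close>

text \<open>The equation l[u] = f as a system, with \<open>u1\<close> the quasi-derivative of
  \<open>u\<close>. It will be used with \<alpha> = (Q + i r) / p, \<beta> = 1 / p and \<tau> = (Q^2
  + r^2) / p - s. The diagonal \<alpha>, - cnj \<alpha> together with real \<beta> and \<tau>
  encodes the formal symmetry of the expression.\<close>

definition qsol :: "(real \<Rightarrow> complex) \<Rightarrow> (real \<Rightarrow> real) \<Rightarrow> (real \<Rightarrow> real) \<Rightarrow>
    (real \<Rightarrow> complex) \<Rightarrow> (real \<Rightarrow> complex) \<Rightarrow> (real \<Rightarrow> complex) \<Rightarrow> bool" where
  "qsol \<alpha> \<beta> \<tau> f u u1 \<longleftrightarrow> AC_loc u \<and> AC_loc u1 \<and>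
    (AE x in lebesgue. (u has_vector_derivative \<alpha> x * u x + of_real (\<beta> x) * u1 x) (at x)) \<and>
    (AE x in lebesgue. (u1 has_vector_derivative - f x - cnj (\<alpha> x) * u1 x - of_real (\<tau> x) * u x) (at x))"

theorem qsol_exists:
  fixes \<alpha> f :: "real \<Rightarrow> complex"
  assumes a: "loc_int \<alpha>" and b: "loc_int \<beta>" and t: "loc_int \<tau>" and f: "loc_int f"
  shows "\<exists>u u1. qsol \<alpha> \<beta> \<tau> f u u1 \<and> u t0 = c \<and> u1 t0 = d"
proof -
  define G where "G x y = (\<alpha> x * fst y + of_real (\<beta> x) * snd y, - f x - cnj (\<alpha> x) * snd y - of_real (\<tau> x) * fst y)" for x y
  \<comment> \<open>The norm of a pair is bounded by the sum of the norms of its components, and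
    \<alpha> occurs in both of them: hence the factor two.\<close>
  define k where "k x = 2 * norm (\<alpha> x) + norm (\<beta> x) + norm (\<tau> x)" for x
  have bc: "loc_int (\<lambda>x. of_real (\<beta> x) :: complex)" and tc: "loc_int (\<lambda>x. of_real (\<tau> x) :: complex)"
    and ac: "loc_int (\<lambda>x. cnj (\<alpha> x))"
    using loc_int_linear[OF b bounded_linear_of_real] loc_int_linear[OF t bounded_linear_of_real]
      loc_int_linear[OF a bounded_linear_cnj] by auto
  have Gi: "loc_int (\<lambda>x. G x (Y x))" if Y: "continuous_on UNIV Y" for Y
    unfolding G_def
    by (intro loc_int_Pair loc_int_add loc_int_diff loc_int_minus f loc_int_mult_continuous_right a bc tc ac continuous_intros Y)
  have k: "loc_int k"
    unfolding k_def by (intro loc_int_add loc_int_norm loc_int_mult_continuous_real continuous_intros a b t)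
  have Lip: "norm (G x y - G x z) \<le> k x * norm (y - z)" for x y z
  proof -
    let ?d = "fst y - fst z" and ?e = "snd y - snd z"
    have n1: "norm ?d \<le> norm (y - z)" "norm ?e \<le> norm (y - z)"
      by (metis fst_diff norm_fst_le prod.collapse, metis snd_diff norm_snd_le prod.collapse)
    have "G x y - G x z = (\<alpha> x * ?d + of_real (\<beta> x) * ?e, - (cnj (\<alpha> x) * ?e + of_real (\<tau> x) * ?d))"
      by (simp add: G_def algebra_simps)
    then have "norm (G x y - G x z) \<le> norm (\<alpha> x * ?d + of_real (\<beta> x) * ?e) + norm (cnj (\<alpha> x) * ?e + of_real (\<tau> x) * ?d)"
      by (metis norm_Pair_le norm_minus_cancel)
    also have "\<dots> \<le> (norm (\<alpha> x) * norm ?d + norm (\<beta> x) * norm ?e) + (norm (\<alpha> x) * norm ?e + norm (\<tau> x) * norm ?d)"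
      by (intro add_mono norm_triangle_le) (simp_all add: norm_mult)
    also have "\<dots> \<le> (norm (\<alpha> x) * norm (y-z) + norm (\<beta> x) * norm (y-z)) + (norm (\<alpha> x) * norm (y-z) + norm (\<tau> x) * norm (y-z))"
      by (intro add_mono mult_left_mono n1 norm_ge_zero)
    finally show ?thesis by (simp add: k_def algebra_simps)
  qed
  have k0: "k x \<ge> 0" for x by (simp add: k_def)
  obtain Y where Y: "continuous_on UNIV Y" "\<And>x. Y x = (c, d) + prim t0 (\<lambda>s. G s (Y s)) x"
    using linear_Picard[OF Gi k k0 Lip] by blast
  have Yeq: "Y = (\<lambda>x. (c, d) + prim t0 (\<lambda>s. G s (Y s)) x)" using Y(2) by blast
  have YAC: "AC_loc Y" by (subst Yeq) (intro AC_loc_add AC_loc_const AC_loc_prim Gi Y(1))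
  have Yd: "AE x in lebesgue. (Y has_vector_derivative G x (Y x)) (at x)"
    using AE_prim_has_vector_derivative[OF Gi[OF Y(1)], of t0]
  proof eventually_elim
    fix x assume "(prim t0 (\<lambda>s. G s (Y s)) has_vector_derivative G x (Y x)) (at x)"
    then have "((\<lambda>x. (c, d) + prim t0 (\<lambda>s. G s (Y s)) x) has_vector_derivative 0 + G x (Y x)) (at x)"
      by (intro has_vector_derivative_add has_vector_derivative_const)
    then show "(Y has_vector_derivative G x (Y x)) (at x)" using Yeq by simp
  qed
  have "qsol \<alpha> \<beta> \<tau> f (\<lambda>x. fst (Y x)) (\<lambda>x. snd (Y x))"
    unfolding qsol_def
  proof (intro conjI)
    show "AC_loc (\<lambda>x. fst (Y x))" by (rule AC_loc_linear[OF YAC bounded_linear_fst])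
    show "AC_loc (\<lambda>x. snd (Y x))" by (rule AC_loc_linear[OF YAC bounded_linear_snd])
    show "AE x in lebesgue. ((\<lambda>x. fst (Y x)) has_vector_derivative \<alpha> x * fst (Y x) + of_real (\<beta> x) * snd (Y x)) (at x)"
      using Yd by eventually_elim (drule bounded_linear.has_vector_derivative[OF bounded_linear_fst], simp add: G_def)
    show "AE x in lebesgue. ((\<lambda>x. snd (Y x)) has_vector_derivative - f x - cnj (\<alpha> x) * snd (Y x) - of_real (\<tau> x) * fst (Y x)) (at x)"
      using Yd by eventually_elim (drule bounded_linear.has_vector_derivative[OF bounded_linear_snd], simp add: G_def)
  qed
  moreover have "Y t0 = (c, d)" using Y(2)[of t0] by simp
  ultimately show ?thesis by (metis fst_conv snd_conv)
qed

text \<open>The sesquilinear Wronskian of the Cauchy data of two solutions.\<close>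

definition lagrange :: "(real \<Rightarrow> complex) \<Rightarrow> (real \<Rightarrow> complex) \<Rightarrow> (real \<Rightarrow> complex) \<Rightarrow> (real \<Rightarrow> complex) \<Rightarrow> real \<Rightarrow> complex" where
  "lagrange u u1 v v1 x = u x * cnj (v1 x) - u1 x * cnj (v x)"

text \<open>When the bracket is differentiated, the \<alpha> terms cancel because the second
  diagonal entry is - cnj \<alpha>, and the \<beta> and \<tau> terms cancel because these
  coefficients are real. Only the right-hand sides survive.\<close>

theorem green_formula:
  assumes u: "qsol \<alpha> \<beta> \<tau> f u u1" and v: "qsol \<alpha> \<beta> \<tau> g v v1" and ab: "a \<le> b"
  shows "((\<lambda>x. f x * cnj (v x) - u x * cnj (g x)) has_integral
    (lagrange u u1 v v1 b - lagrange u u1 v v1 a)) {a..b}"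
proof (rule AC_loc_has_integral[OF _ _ ab])
  have c: "AC_loc (\<lambda>x. cnj (v x))" "AC_loc (\<lambda>x. cnj (v1 x))"
    using v AC_loc_linear[OF _ bounded_linear_cnj] unfolding qsol_def by blast+
  have "AC_loc (\<lambda>x. u x * cnj (v1 x) + (- (u1 x * cnj (v x))))"
    using u c unfolding qsol_def
    by (intro AC_loc_add AC_loc_mult AC_loc_linear[OF AC_loc_mult] bounded_linear_minus bounded_linear_ident) auto
  then show "AC_loc (lagrange u u1 v v1)" unfolding lagrange_def by simp
  have "AE x in lebesgue. (u has_vector_derivative \<alpha> x * u x + of_real (\<beta> x) * u1 x) (at x)"
    "AE x in lebesgue. (u1 has_vector_derivative - f x - cnj (\<alpha> x) * u1 x - of_real (\<tau> x) * u x) (at x)"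
    "AE x in lebesgue. (v has_vector_derivative \<alpha> x * v x + of_real (\<beta> x) * v1 x) (at x)"
    "AE x in lebesgue. (v1 has_vector_derivative - g x - cnj (\<alpha> x) * v1 x - of_real (\<tau> x) * v x) (at x)"
    using u v unfolding qsol_def by blast+
  then show "AE x in lebesgue. (lagrange u u1 v v1 has_vector_derivative f x * cnj (v x) - u x * cnj (g x)) (at x)"
  proof eventually_elim
    case (elim x)
    note cv = bounded_linear.has_vector_derivative[OF bounded_linear_cnj elim(3)]
      and cv1 = bounded_linear.has_vector_derivative[OF bounded_linear_cnj elim(4)]
    show ?case unfolding lagrange_def
      by (rule has_vector_derivative_eq_rhs[OF has_vector_derivative_diff[OF
          has_vector_derivative_mult[OF elim(1) cv1] has_vector_derivative_mult[OF elim(2) cv]]])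
        (simp add: algebra_simps)
  qed
qed

subsection \<open>Square-integrable functions\<close>

lemma L2_measurable: "L2 u \<Longrightarrow> u \<in> borel_measurable lebesgue"
  by (simp add: L2_def)

lemma L2_integrable: "L2 u \<Longrightarrow> integrable lebesgue (\<lambda>x. (cmod (u x))\<^sup>2)"
  by (simp add: L2_def)

lemma L2_bound:
  assumes "u \<in> borel_measurable lebesgue" "integrable lebesgue g" "AE x in lebesgue. (cmod (u x))\<^sup>2 \<le> g x"
  shows "L2 u"
  unfolding L2_def
proof (intro conjI)
  show "integrable lebesgue (\<lambda>x. (cmod (u x))\<^sup>2)"
    by (rule Bochner_Integration.integrable_bound[OF assms(2)]) (use assms(1,3) in \<open>auto elim: eventually_mono\<close>)
qed (rule assms)

lemma cmod_add_sq_le: "(cmod (a + b))\<^sup>2 \<le> 2 * (cmod a)\<^sup>2 + 2 * (cmod b)\<^sup>2"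
proof -
  have "(cmod (a + b))\<^sup>2 \<le> (cmod a + cmod b)\<^sup>2" by (simp add: norm_triangle_ineq power_mono)
  also have "\<dots> \<le> 2 * (cmod a)\<^sup>2 + 2 * (cmod b)\<^sup>2"
    using zero_le_power2[of "cmod a - cmod b"] by (simp add: power2_sum power2_diff)
  finally show ?thesis .
qed

lemma L2_add: "L2 u \<Longrightarrow> L2 v \<Longrightarrow> L2 (\<lambda>x. u x + v x)"
  by (rule L2_bound[where g = "\<lambda>x. 2 * (cmod (u x))\<^sup>2 + 2 * (cmod (v x))\<^sup>2"])
    (auto intro!: borel_measurable_add simp: L2_integrable L2_measurable cmod_add_sq_le)

lemma L2_cmult: "L2 u \<Longrightarrow> L2 (\<lambda>x. c * u x)"
  by (rule L2_bound[where g = "\<lambda>x. (cmod c)\<^sup>2 * (cmod (u x))\<^sup>2"])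
    (auto intro!: borel_measurable_times simp: L2_integrable L2_measurable norm_mult power_mult_distrib)

lemma L2_diff: "L2 u \<Longrightarrow> L2 v \<Longrightarrow> L2 (\<lambda>x. u x - v x)"
  using L2_add[of u "\<lambda>x. (-1) * v x"] L2_cmult[of v "-1"] by simp

lemma L2_zero: "L2 (\<lambda>x. 0)"
  by (simp add: L2_def)

lemma L2_cong_AE:
  assumes "L2 u" "ae_eq u v" shows "L2 v"
proof (rule L2_bound[OF _ L2_integrable[OF assms(1)]])
  show "v \<in> borel_measurable lebesgue"
    using borel_measurable_AE[OF L2_measurable[OF assms(1)]] assms(2) unfolding ae_eq_def by blast
  show "AE x in lebesgue. (cmod (v x))\<^sup>2 \<le> (cmod (u x))\<^sup>2"
    using assms(2) unfolding ae_eq_def by eventually_elim simp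
qed

lemma L2_mult_integrable:
  assumes "L2 u" "L2 v" shows "integrable lebesgue (\<lambda>x. u x * cnj (v x))"
proof (rule Bochner_Integration.integrable_bound[where f = "\<lambda>x. (cmod (u x))\<^sup>2 + (cmod (v x))\<^sup>2"])
  have [measurable]: "u \<in> borel_measurable lebesgue" "v \<in> borel_measurable lebesgue" using assms by (auto simp: L2_def)
  show "(\<lambda>x. u x * cnj (v x)) \<in> borel_measurable lebesgue"
  proof -
    have "(\<lambda>x. cnj (v x)) \<in> borel_measurable lebesgue"
      by (intro borel_measurable_continuous_on[of cnj v lebesgue]) (auto intro: continuous_intros)
    then show ?thesis by measurable
  qed
  show "AE x in lebesgue. norm (u x * cnj (v x)) \<le> norm ((cmod (u x))\<^sup>2 + (cmod (v x))\<^sup>2)"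
  proof (intro AE_I2)
    fix x
    have "cmod (u x) * cmod (v x) \<le> (cmod (u x))\<^sup>2 + (cmod (v x))\<^sup>2"
      using zero_le_power2[of "cmod (u x) - cmod (v x)"] sum_power2_ge_zero[of "cmod (u x)" "cmod (v x)"]
      unfolding power2_diff by linarith
    then show "norm (u x * cnj (v x)) \<le> norm ((cmod (u x))\<^sup>2 + (cmod (v x))\<^sup>2)" by (simp add: norm_mult)
  qed
qed (simp add: assms L2_integrable)

lemma ip_add_left: "L2 u \<Longrightarrow> L2 v \<Longrightarrow> L2 w \<Longrightarrow> ip (\<lambda>x. u x + v x) w = ip u w + ip v w"
  unfolding ip_def by (simp add: distrib_right L2_mult_integrable)

lemma ip_diff_left: "L2 u \<Longrightarrow> L2 v \<Longrightarrow> L2 w \<Longrightarrow> ip (\<lambda>x. u x - v x) w = ip u w - ip v w"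
  unfolding ip_def by (simp add: left_diff_distrib L2_mult_integrable)

lemma ip_cmult_left: "ip (\<lambda>x. c * u x) w = c * ip u w"
  unfolding ip_def by (simp add: mult.assoc)

lemma ip_commute: "ip v u = cnj (ip u v)"
  unfolding ip_def Bochner_Integration.integral_cnj[symmetric] by (simp add: mult.commute)

lemma ip_add_right: "L2 u \<Longrightarrow> L2 v \<Longrightarrow> L2 w \<Longrightarrow> ip w (\<lambda>x. u x + v x) = ip w u + ip w v"
  by (subst (1 2 3) ip_commute) (simp add: ip_add_left)

lemma ip_diff_right: "L2 u \<Longrightarrow> L2 v \<Longrightarrow> L2 w \<Longrightarrow> ip w (\<lambda>x. u x - v x) = ip w u - ip w v"
  by (subst (1 2 3) ip_commute) (simp add: ip_diff_left)

lemma ip_cmult_right: "ip w (\<lambda>x. c * u x) = cnj c * ip w u"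
  by (subst (1 2) ip_commute) (simp add: ip_cmult_left)

lemma ip_self: "ip u u = of_real (nrm2 u)"
  unfolding ip_def nrm2_def by (simp flip: complex_norm_square integral_of_real of_real_power)

lemma nrm2_nonneg: "nrm2 u \<ge> 0"
  unfolding nrm2_def by (intro integral_nonneg_AE) simp

lemma ip_cong_AE:
  assumes "ae_eq u u'" "ae_eq v v'" "L2 u" "L2 v"
  shows "ip u v = ip u' v'"
  unfolding ip_def
proof (rule integral_cong_AE)
  show "(\<lambda>x. u x * cnj (v x)) \<in> borel_measurable lebesgue"
    using L2_mult_integrable[OF assms(3,4)] by (rule borel_measurable_integrable)
  show "(\<lambda>x. u' x * cnj (v' x)) \<in> borel_measurable lebesgue"
    using L2_mult_integrable[OF L2_cong_AE[OF assms(3,1)] L2_cong_AE[OF assms(4,2)]] by (rule borel_measurable_integrable)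
  show "AE x in lebesgue. u x * cnj (v x) = u' x * cnj (v' x)"
    using assms(1,2) unfolding ae_eq_def by eventually_elim simp
qed

lemma nrm2_cong_AE: "ae_eq u v \<Longrightarrow> L2 u \<Longrightarrow> nrm2 u = nrm2 v"
  using ip_cong_AE[of u v u v] by (simp add: ip_self)

lemma nrm2_zero_iff: "L2 u \<Longrightarrow> nrm2 u = 0 \<longleftrightarrow> ae_eq u (\<lambda>x. 0)"
  unfolding nrm2_def ae_eq_def by (subst integral_nonneg_eq_0_iff_AE) (auto simp: L2_integrable)

lemma nrm2_add: "L2 u \<Longrightarrow> L2 v \<Longrightarrow> nrm2 (\<lambda>x. u x + v x) = nrm2 u + nrm2 v + 2 * Re (ip u v)"
proof -
  assume u: "L2 u" and v: "L2 v"
  have "ip (\<lambda>x. u x + v x) (\<lambda>x. u x + v x) = (ip u u + ip u v) + (ip v u + ip v v)"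
    using u v by (simp add: ip_add_left ip_add_right L2_add)
  also have "\<dots> = of_real (nrm2 u) + of_real (nrm2 v) + (ip u v + cnj (ip u v))"
    unfolding ip_commute[of v u] ip_self by simp
  finally have "Re (of_real (nrm2 (\<lambda>x. u x + v x))) = Re (of_real (nrm2 u) + of_real (nrm2 v) + (ip u v + cnj (ip u v)))"
    unfolding ip_self by (rule arg_cong)
  then show ?thesis by simp
qed

lemma nrm2_cmult: "nrm2 (\<lambda>x. c * u x) = (cmod c)\<^sup>2 * nrm2 u"
  unfolding nrm2_def by (simp add: norm_mult power_mult_distrib)

lemma nrm2_diff: "L2 u \<Longrightarrow> L2 v \<Longrightarrow> nrm2 (\<lambda>x. u x - v x) = nrm2 u + nrm2 v - 2 * Re (ip u v)"
  using nrm2_add[of u "\<lambda>x. (-1) * v x"] L2_cmult[of v "-1"] nrm2_cmult[of "-1" v] ip_cmult_right[of u "-1" v] by simp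

lemma nrm2_parallelogram:
  "L2 u \<Longrightarrow> L2 v \<Longrightarrow> nrm2 (\<lambda>x. u x + v x) + nrm2 (\<lambda>x. u x - v x) = 2 * nrm2 u + 2 * nrm2 v"
  by (simp add: nrm2_add nrm2_diff)

lemma nrm2_add_le: "L2 u \<Longrightarrow> L2 v \<Longrightarrow> nrm2 (\<lambda>x. u x + v x) \<le> 2 * nrm2 u + 2 * nrm2 v"
  using nrm2_parallelogram[of u v] nrm2_nonneg[of "\<lambda>x. u x - v x"] by linarith

lemma nrm2_diff_commute: "nrm2 (\<lambda>x. u x - v x) = nrm2 (\<lambda>x. v x - u x)"
  unfolding nrm2_def by (simp add: norm_minus_commute)

lemma ip_Cauchy_Schwarz:
  assumes u: "L2 u" and v: "L2 v" shows "(cmod (ip u v))\<^sup>2 \<le> nrm2 u * nrm2 v"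
proof -
  define a where "a = ip u v"
  \<comment> \<open>The factor \<open>a\<close> in front of \<open>v\<close> fixes the phase, so
    that nonnegativity of the norm becomes a real quadratic inequality in \<open>s\<close>.\<close>
  have key: "nrm2 u * s\<^sup>2 - 2 * s * (cmod a)\<^sup>2 + (cmod a)\<^sup>2 * nrm2 v \<ge> 0" for s :: real
  proof -
    have "0 \<le> nrm2 (\<lambda>x. of_real s * u x - a * v x)" by (rule nrm2_nonneg)
    also have "\<dots> = s\<^sup>2 * nrm2 u + (cmod a)\<^sup>2 * nrm2 v - 2 * Re (of_real s * (cnj a * a))"
      using u v by (simp add: nrm2_diff L2_cmult nrm2_cmult ip_cmult_left ip_cmult_right a_def[symmetric])
    also have "cnj a * a = of_real ((cmod a)\<^sup>2)" by (subst mult.commute) (simp only: complex_norm_square)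
    finally show ?thesis by (simp add: algebra_simps)
  qed
  show ?thesis
  proof (cases "nrm2 v = 0")
    case True
    have "(cmod a)\<^sup>2 = 0"
    proof (rule ccontr)
      assume "(cmod a)\<^sup>2 \<noteq> 0"
      then have A: "(cmod a)\<^sup>2 > 0" by simp
      \<comment> \<open>With \<open>nrm2 v = 0\<close> the quadratic is negative for small positive
        \<open>s\<close> unless \<open>a = 0\<close>. The added one makes the explicit choice of
        \<open>s\<close> meaningful even if \<open>nrm2 u = 0\<close>.\<close>
      define U where "U = nrm2 u + 1"
      have U: "U > 0" "nrm2 u \<le> U" unfolding U_def using nrm2_nonneg[of u] by auto
      define s where "s = (cmod a)\<^sup>2 / U"
      have s: "s > 0" using A U by (simp add: s_def)
      have "nrm2 u * s\<^sup>2 \<le> U * s\<^sup>2" using U by (intro mult_right_mono) auto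
      also have "\<dots> = s * (cmod a)\<^sup>2" using U by (simp add: s_def power2_eq_square)
      finally have "0 \<le> s * (cmod a)\<^sup>2 - 2 * s * (cmod a)\<^sup>2" using key[of s] True by simp
      then have "s * (cmod a)\<^sup>2 \<le> 0" by simp
      then show False using mult_pos_pos[OF s A] by simp
    qed
    then show ?thesis using True by (simp add: a_def)
  next
    case False
    then have V: "nrm2 v > 0" using nrm2_nonneg[of v] by linarith
    have "0 \<le> nrm2 u * (nrm2 v)\<^sup>2 - nrm2 v * (cmod a)\<^sup>2" using key[of "nrm2 v"] by (simp add: algebra_simps)
    then have "nrm2 v * (cmod a)\<^sup>2 \<le> nrm2 v * (nrm2 u * nrm2 v)" by (simp add: power2_eq_square algebra_simps)
    then show ?thesis using V by (simp add: a_def)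
  qed
qed

section \<open>Limits, projections and completeness in the Hilbert space\<close>

lemma ip_tendsto_left:
  assumes X: "\<And>n. L2 (X n)" and u: "L2 u" and lim: "(\<lambda>n. nrm2 (\<lambda>x. X n x - u x)) \<longlonglongrightarrow> 0" and v: "L2 v"
  shows "(\<lambda>n. ip (X n) v) \<longlonglongrightarrow> ip u v"
proof -
  have "(\<lambda>n. sqrt (nrm2 (\<lambda>x. X n x - u x) * nrm2 v)) \<longlonglongrightarrow> sqrt (0 * nrm2 v)"
    by (intro tendsto_intros lim)
  then have z: "(\<lambda>n. sqrt (nrm2 (\<lambda>x. X n x - u x) * nrm2 v)) \<longlonglongrightarrow> 0" by simp
  have "(\<lambda>n. ip (X n) v - ip u v) \<longlonglongrightarrow> 0"
  proof (rule Lim_null_comparison[OF always_eventually z], rule allI)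
    fix n
    have "cmod (ip (\<lambda>x. X n x - u x) v) \<le> sqrt (nrm2 (\<lambda>x. X n x - u x) * nrm2 v)"
      by (rule real_le_rsqrt[OF ip_Cauchy_Schwarz[OF L2_diff[OF X u] v]])
    then show "norm (ip (X n) v - ip u v) \<le> sqrt (nrm2 (\<lambda>x. X n x - u x) * nrm2 v)"
      using ip_diff_left[OF X u v] by simp
  qed
  then show ?thesis using Lim_null by blast
qed

lemma nrm2_tendsto:
  assumes X: "\<And>n. L2 (X n)" and u: "L2 u" and lim: "(\<lambda>n. nrm2 (\<lambda>x. X n x - u x)) \<longlonglongrightarrow> 0"
  shows "(\<lambda>n. nrm2 (X n)) \<longlonglongrightarrow> nrm2 u"
proof -
  have "nrm2 (X n) = nrm2 (\<lambda>x. X n x - u x) - nrm2 u + 2 * Re (ip (X n) u)" for n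
    using nrm2_diff[OF X u, of n] by simp
  moreover have "(\<lambda>n. nrm2 (\<lambda>x. X n x - u x) - nrm2 u + 2 * Re (ip (X n) u)) \<longlonglongrightarrow> 0 - nrm2 u + 2 * Re (ip u u)"
    by (intro tendsto_intros lim ip_tendsto_left X u)
  ultimately show ?thesis by (simp add: ip_self)
qed

lemma proj_onto_one:
  assumes a: "L2 a" and h: "L2 h" shows "\<exists>c. ip (\<lambda>x. h x - c * a x) a = 0"
proof (cases "nrm2 a = 0")
  case True
  then have "ip h a = 0" using ip_Cauchy_Schwarz[OF h a] by simp
  then show ?thesis by (intro exI[of _ 0]) simp
next
  case False
  have "ip (\<lambda>x. h x - c * a x) a = ip h a - c * ip a a" for c
    using ip_diff_left[OF h L2_cmult[OF a] a] by (simp add: ip_cmult_left)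
  from this[of "ip h a / ip a a"] have "ip (\<lambda>x. h x - (ip h a / ip a a) * a x) a = 0"
    using False by (simp add: ip_self)
  then show ?thesis by blast
qed

text \<open>Gram-Schmidt: \<open>b\<close> is replaced by its component orthogonal to
  \<open>a\<close>, and \<open>h\<close> is freed of both directions in turn. Degenerate vectors are
  absorbed by the null case of \<open>proj_onto_one\<close>.\<close>

lemma proj_onto_two:
  assumes a: "L2 a" and b: "L2 b" and h: "L2 h"
  shows "\<exists>c d. ip (\<lambda>x. h x - c * a x - d * b x) a = 0 \<and> ip (\<lambda>x. h x - c * a x - d * b x) b = 0"
proof -
  note L = L2_diff L2_cmult L2_add a b h
  obtain k where k: "ip (\<lambda>x. b x - k * a x) a = 0" using proj_onto_one[OF a b] by blast
  obtain d where d: "ip (\<lambda>x. h x - d * a x) a = 0" using proj_onto_one[OF a h] by blast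
  obtain e where e: "ip (\<lambda>x. (h x - d * a x) - e * (b x - k * a x)) (\<lambda>x. b x - k * a x) = 0"
    using proj_onto_one[of "\<lambda>x. b x - k * a x" "\<lambda>x. h x - d * a x"] L by blast
  define f where "f = (\<lambda>x. (h x - d * a x) - e * (b x - k * a x))"
  have Lf: "L2 f" unfolding f_def by (intro L)
  have fa: "ip f a = 0" unfolding f_def
    using k d by (subst ip_diff_left) (auto intro!: L simp: ip_cmult_left)
  have "ip f b = ip f (\<lambda>x. (b x - k * a x) + k * a x)" by simp
  also have "\<dots> = 0" using e fa Lf unfolding f_def[symmetric]
    by (subst ip_add_right) (auto intro!: L simp: ip_cmult_right)
  finally have "ip f b = 0" .
  moreover have "f = (\<lambda>x. h x - (d - e * k) * a x - e * b x)" by (simp add: f_def algebra_simps)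
  ultimately show ?thesis using fa by metis
qed

text \<open>Along a subsequence with \<open>nrm2 (X (s (Suc k)) - X (s k)) \<le> 8 ^ - k\<close>, the elementary bound
  \<open>g \<le> 2 ^ - k + 2 ^ k * g\<^sup>2\<close> makes the increments summable almost everywhere.\<close>

theorem L2_complete:
  assumes X: "\<And>n. L2 (X n)"
    and Cauchy: "\<And>e. e > 0 \<Longrightarrow> \<exists>N::nat. \<forall>m\<ge>N. \<forall>n\<ge>N. nrm2 (\<lambda>x. X m x - X n x) < e"
  shows "\<exists>u. L2 u \<and> (\<lambda>n. nrm2 (\<lambda>x. X n x - u x)) \<longlonglongrightarrow> 0"
proof -
  have Xm[measurable]: "X n \<in> borel_measurable lebesgue" for n using X by (simp add: L2_def)
  have nn: "(\<integral>\<^sup>+x. ennreal ((cmod (w x))\<^sup>2) \<partial>lebesgue) = ennreal (nrm2 w)" if "L2 w" for w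
    unfolding nrm2_def by (rule nn_integral_eq_integral) (auto simp: L2_integrable that)
  have "\<forall>k. \<exists>N. \<forall>m\<ge>N. \<forall>n\<ge>N. nrm2 (\<lambda>x. X m x - X n x) < (1/8)^k"
    using Cauchy by simp
  then obtain N where N: "\<And>k m n. m \<ge> N k \<Longrightarrow> n \<ge> N k \<Longrightarrow> nrm2 (\<lambda>x. X m x - X n x) < (1/8)^k"
    by metis
  \<comment> \<open>Strictly increasing indices that have passed \<open>N k\<close> at stage
    \<open>k\<close>. The rate \<open>(1/8)^k\<close> leaves \<open>(1/4)^k\<close>, still summable,
    after multiplication by \<open>2^k\<close>.\<close>
  define s where "s = rec_nat (N 0) (\<lambda>k m. max (Suc m) (N (Suc k)))"
  have s0: "s 0 = N 0" and sS: "s (Suc k) = max (Suc (s k)) (N (Suc k))" for k by (simp_all add: s_def)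
  have sN: "s k \<ge> N k" for k by (cases k) (simp_all add: s0 sS)
  have smono: "s k \<le> s (Suc k)" for k by (simp add: sS)
  have sk: "s k \<ge> k" for k by (induction k) (auto simp: sS)
  define g where "g k x = cmod (X (s (Suc k)) x - X (s k) x)" for k x
  have gm[measurable]: "g k \<in> borel_measurable lebesgue" for k unfolding g_def by measurable
  have gi: "(\<integral>\<^sup>+x. ennreal (2^k * (g k x)\<^sup>2) \<partial>lebesgue) \<le> ennreal ((1/4)^k)" for k
  proof -
    have "(\<integral>\<^sup>+x. ennreal (2^k * (g k x)\<^sup>2) \<partial>lebesgue) = ennreal (2^k) * (\<integral>\<^sup>+x. ennreal ((g k x)\<^sup>2) \<partial>lebesgue)"
      by (subst nn_integral_cmult[symmetric]) (auto simp: ennreal_mult)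
    also have "\<dots> = ennreal (2^k) * ennreal (nrm2 (\<lambda>x. X (s (Suc k)) x - X (s k) x))"
      unfolding g_def using nn[OF L2_diff[OF X X]] by simp
    also have "\<dots> = ennreal (2^k * nrm2 (\<lambda>x. X (s (Suc k)) x - X (s k) x))"
      by (simp add: ennreal_mult nrm2_nonneg)
    also have "\<dots> \<le> ennreal (2^k * (1/8)^k)"
      using N[of k "s (Suc k)" "s k"] sN[of k] smono[of k] by (intro ennreal_leI mult_left_mono) auto
    also have "2^k * (1/8)^k = ((1/4)^k :: real)" by (simp flip: power_mult_distrib)
    finally show ?thesis .
  qed
  have "(\<integral>\<^sup>+x. (\<Sum>k. ennreal (2^k * (g k x)\<^sup>2)) \<partial>lebesgue) = (\<Sum>k. \<integral>\<^sup>+x. ennreal (2^k * (g k x)\<^sup>2) \<partial>lebesgue)"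
    by (rule nn_integral_suminf) measurable
  also have "\<dots> \<le> (\<Sum>k. ennreal ((1/4)^k))" by (intro suminf_le gi) auto
  also have "\<dots> = ennreal (\<Sum>k. (1/4)^k)" by (intro suminf_ennreal2) (auto intro: summable_geometric)
  also have "\<dots> < \<infinity>" by simp
  finally have fin: "(\<integral>\<^sup>+x. (\<Sum>k. ennreal (2^k * (g k x)\<^sup>2)) \<partial>lebesgue) \<noteq> \<infinity>" by simp
  have "AE x in lebesgue. (\<Sum>k. ennreal (2^k * (g k x)\<^sup>2)) \<noteq> \<infinity>"
    by (rule nn_integral_noteq_infinite[OF _ fin]) measurable
  then have conv: "AE x in lebesgue. convergent (\<lambda>k. X (s k) x)"
  proof eventually_elim
    fix x assume a: "(\<Sum>k. ennreal (2^k * (g k x)\<^sup>2)) \<noteq> \<infinity>"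
    have s1: "summable (\<lambda>k. 2^k * (g k x)\<^sup>2)"
      using a by (intro summable_suminf_not_top) auto
    have "summable (\<lambda>k. (1/2)^k + 2^k * (g k x)\<^sup>2)"
      by (intro summable_add s1 summable_geometric) simp
    then have "summable (\<lambda>k. X (s (Suc k)) x - X (s k) x)"
    proof (rule summable_comparison_test'[where N = 0])
      fix k
      have "(2^k * g k x - 1)\<^sup>2 \<ge> 0" by simp
      then have "2 * (2^k * g k x) \<le> (2^k * g k x)\<^sup>2 + 1" unfolding power2_diff by simp
      then have "2^k * g k x \<le> (2^k * g k x)\<^sup>2 + 1"
        using zero_le_power2[of "2^k * g k x"] by (cases "2^k * g k x \<ge> 0") linarith+
      then have "(1/2)^k * (2^k * g k x) \<le> (1/2)^k * ((2^k * g k x)\<^sup>2 + 1)" by (intro mult_left_mono) auto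
      moreover have "(1/2)^k * (2^k * g k x) = g k x" by (simp only: mult.assoc[symmetric] power_mult_distrib[symmetric]) simp
      moreover have "(1/2)^k * ((2^k * g k x)\<^sup>2 + 1) = (1/2)^k + 2^k * (g k x)\<^sup>2"
        by (simp add: power_divide power2_eq_square field_simps)
      moreover have "norm (X (s (Suc k)) x - X (s k) x) = g k x" by (simp add: g_def)
      ultimately show "norm (X (s (Suc k)) x - X (s k) x) \<le> (1/2)^k + 2^k * (g k x)\<^sup>2" by linarith
    qed
    then have "convergent (\<lambda>n. \<Sum>k<n. X (s (Suc k)) x - X (s k) x)" by (simp add: summable_iff_convergent)
    then have "convergent (\<lambda>n. X (s 0) x + (\<Sum>k<n. X (s (Suc k)) x - X (s k) x))"
      by (intro convergent_add convergent_const)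
    then show "convergent (\<lambda>k. X (s k) x)"
      using sum_lessThan_telescope[of "\<lambda>k. X (s k) x"] by simp
  qed
  define u where "u x = lim (\<lambda>k. X (s k) x)" for x
  have um[measurable]: "u \<in> borel_measurable lebesgue" unfolding u_def by measurable
  have lim: "AE x in lebesgue. (\<lambda>k. X (s k) x) \<longlonglongrightarrow> u x"
    using conv unfolding u_def by eventually_elim (simp add: convergent_LIMSEQ_iff)
  have fatou: "(\<integral>\<^sup>+x. ennreal ((cmod (X m x - u x))\<^sup>2) \<partial>lebesgue) \<le> ennreal e"
    if e: "e > 0" and M: "\<And>n. n \<ge> M \<Longrightarrow> nrm2 (\<lambda>x. X m x - X n x) < e" for m e and M :: nat
  proof -
    have "(\<integral>\<^sup>+x. ennreal ((cmod (X m x - u x))\<^sup>2) \<partial>lebesgue) = (\<integral>\<^sup>+x. liminf (\<lambda>k. ennreal ((cmod (X m x - X (s (k + K)) x))\<^sup>2)) \<partial>lebesgue)" for K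
    proof (rule nn_integral_cong_AE)
      show "AE x in lebesgue. ennreal ((cmod (X m x - u x))\<^sup>2) = liminf (\<lambda>k. ennreal ((cmod (X m x - X (s (k + K)) x))\<^sup>2))"
        using lim
      proof eventually_elim
        fix x assume "(\<lambda>k. X (s k) x) \<longlonglongrightarrow> u x"
        then have "(\<lambda>k. X (s (k + K)) x) \<longlonglongrightarrow> u x" by (rule LIMSEQ_ignore_initial_segment)
        then have "(\<lambda>k. ennreal ((cmod (X m x - X (s (k + K)) x))\<^sup>2)) \<longlonglongrightarrow> ennreal ((cmod (X m x - u x))\<^sup>2)"
          by (intro tendsto_ennrealI tendsto_intros)
        then show "ennreal ((cmod (X m x - u x))\<^sup>2) = liminf (\<lambda>k. ennreal ((cmod (X m x - X (s (k + K)) x))\<^sup>2))"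
          by (rule lim_imp_Liminf[symmetric, rotated]) simp
      qed
    qed
    also have "(\<integral>\<^sup>+x. liminf (\<lambda>k. ennreal ((cmod (X m x - X (s (k + K)) x))\<^sup>2)) \<partial>lebesgue) \<le>
      liminf (\<lambda>k. \<integral>\<^sup>+x. ennreal ((cmod (X m x - X (s (k + K)) x))\<^sup>2) \<partial>lebesgue)" for K
      by (rule nn_integral_liminf) measurable
    finally have F: "(\<integral>\<^sup>+x. ennreal ((cmod (X m x - u x))\<^sup>2) \<partial>lebesgue) \<le>
      liminf (\<lambda>k. \<integral>\<^sup>+x. ennreal ((cmod (X m x - X (s (k + K)) x))\<^sup>2) \<partial>lebesgue)" for K .
    \<comment> \<open>Dropping the first \<open>M\<close> terms does not affect the limit and puts
      every index \<open>s (k + M)\<close> past \<open>M\<close>, where the hypothesis on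
      \<open>X m\<close> applies.\<close>
    have "liminf (\<lambda>k. \<integral>\<^sup>+x. ennreal ((cmod (X m x - X (s (k + M)) x))\<^sup>2) \<partial>lebesgue) \<le> liminf (\<lambda>k::nat. ennreal e)"
    proof (intro Liminf_mono always_eventually allI)
      fix k
      show "(\<integral>\<^sup>+x. ennreal ((cmod (X m x - X (s (k + M)) x))\<^sup>2) \<partial>lebesgue) \<le> ennreal e"
        unfolding nn[OF L2_diff[OF X X]] using M[of "s (k + M)"] sk[of "k + M"] by (intro ennreal_leI) simp
    qed
    then show ?thesis using F[of M] by (simp add: Liminf_const)
  qed
  have L2d: "L2 (\<lambda>x. X m x - u x) \<and> nrm2 (\<lambda>x. X m x - u x) \<le> e"
    if e: "e > 0" and M: "\<And>n. n \<ge> M \<Longrightarrow> nrm2 (\<lambda>x. X m x - X n x) < e" for m e and M :: nat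
  proof -
    have ft: "(\<integral>\<^sup>+x. ennreal ((cmod (X m x - u x))\<^sup>2) \<partial>lebesgue) \<le> ennreal e" by (rule fatou[OF e M])
    have "integrable lebesgue (\<lambda>x. (cmod (X m x - u x))\<^sup>2)"
      using le_less_trans[OF ft ennreal_less_top] by (intro integrableI_bounded) auto
    then have L: "L2 (\<lambda>x. X m x - u x)" unfolding L2_def by simp
    then show ?thesis using ft nn[OF L] e by (simp add: ennreal_le_iff)
  qed
  obtain N0 where N0: "\<forall>m\<ge>N0. \<forall>n\<ge>N0. nrm2 (\<lambda>x. X m x - X n x) < 1" using Cauchy[of 1] by auto
  have "L2 (\<lambda>x. X N0 x - u x)" using L2d[of 1 N0 N0] N0 by simp
  from L2_diff[OF X[of N0] this] have Lu: "L2 u" by (rule L2_cong_AE) (simp add: ae_eq_def)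
  have "(\<lambda>n. nrm2 (\<lambda>x. X n x - u x)) \<longlonglongrightarrow> 0"
  proof (rule LIMSEQ_I)
    fix e :: real assume e: "e > 0"
    then obtain M where M: "\<forall>m\<ge>M. \<forall>n\<ge>M. nrm2 (\<lambda>x. X m x - X n x) < e / 2" using Cauchy[of "e/2"] by auto
    show "\<exists>no. \<forall>n\<ge>no. norm (nrm2 (\<lambda>x. X n x - u x) - 0) < e"
    proof (intro exI[of _ M] allI impI)
      fix m assume "m \<ge> M"
      then have "nrm2 (\<lambda>x. X m x - u x) \<le> e / 2" using L2d[of "e/2" M m] M e by simp
      then show "norm (nrm2 (\<lambda>x. X m x - u x) - 0) < e" using e nrm2_nonneg[of "\<lambda>x. X m x - u x"] by simp
    qed
  qed
  then show ?thesis using Lu by blast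
qed

subsection \<open>The maximal operator and the adjoint of the preminimal operator\<close>

lemma L2_loc_mult:
  assumes "L2_loc f" "L2_loc g" shows "loc_int (\<lambda>x. f x * g x)"
proof (rule loc_int_bound[where g = "\<lambda>x. (f x)\<^sup>2 + (g x)\<^sup>2"])
  show "loc_int (\<lambda>x. (f x)\<^sup>2 + (g x)\<^sup>2)"
    using assms by (intro loc_int_add) (auto simp: L2_loc_def loc_int_def)
  show "norm (f x * g x) \<le> (f x)\<^sup>2 + (g x)\<^sup>2" for x
  proof -
    have "2 * (\<bar>f x\<bar> * \<bar>g x\<bar>) \<le> (f x)\<^sup>2 + (g x)\<^sup>2"
      using zero_le_power2[of "\<bar>f x\<bar> - \<bar>g x\<bar>"] by (simp add: power2_diff)
    moreover have "0 \<le> \<bar>f x\<bar> * \<bar>g x\<bar>" by simp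
    ultimately show ?thesis unfolding real_norm_def abs_mult by linarith
  qed
qed (use assms in \<open>auto simp: L2_loc_def\<close>)

lemma L2_imp_loc_int:
  assumes "L2 f" shows "loc_int f"
proof (rule loc_int_bound[where g = "\<lambda>x. 1 + (cmod (f x))\<^sup>2"])
  have "loc_int (\<lambda>x. (cmod (f x))\<^sup>2)"
    unfolding loc_int_def set_integrable_def
    by (intro allI integrable_mult_indicator L2_integrable assms) simp
  then show "loc_int (\<lambda>x. 1 + (cmod (f x))\<^sup>2)"
    by (rule loc_int_add[OF loc_int_continuous[OF continuous_on_const]])
  show "norm (f x) \<le> 1 + (cmod (f x))\<^sup>2" for x
    using zero_le_power2[of "cmod (f x) - 1"] unfolding power2_diff by (simp) (smt (verit) norm_ge_zero)
qed (use assms L2_measurable in auto)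

lemma measurable_cutoff:
  fixes u :: "real \<Rightarrow> complex"
  shows "u \<in> borel_measurable lebesgue \<Longrightarrow> (\<lambda>x. if x \<in> {a<..<b} then u x else 0) \<in> borel_measurable lebesgue"
  by (rule measurable_If_set) auto

lemma L2_cutoff_continuous:
  assumes "continuous_on UNIV u" shows "L2 (\<lambda>x. if x \<in> {a<..<b} then u x else 0)"
proof -
  have m: "u \<in> borel_measurable lebesgue"
    using loc_int_imp_measurable[OF loc_int_continuous[OF assms]] .
  have "integrable lebesgue (\<lambda>x. indicator {a..b} x *\<^sub>R (cmod (u x))\<^sup>2)"
  proof -
    have "continuous_on UNIV (\<lambda>x. (cmod (u x))\<^sup>2)" using assms by (intro continuous_intros)
    from loc_intD[OF loc_int_continuous[OF this]] show ?thesis unfolding set_integrable_def .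
  qed
  then show ?thesis
    by (rule L2_bound[OF measurable_cutoff[OF m]]) (auto simp: indicator_def)
qed

lemma L2_cutoff:
  assumes "L2 u" shows "L2 (\<lambda>x. if x \<in> {a<..<b} then u x else 0)"
  by (rule L2_bound[OF measurable_cutoff[OF L2_measurable[OF assms]] L2_integrable[OF assms]]) auto

lemma integral_compact_support:
  fixes F :: "real \<Rightarrow> 'a::euclidean_space"
  assumes "loc_int F" "\<And>x. x \<notin> {a..b} \<Longrightarrow> F x = 0"
  shows "(LINT x|lebesgue. F x) = integral {a..b} F"
proof -
  have "(LINT x|lebesgue. F x) = (LINT x:{a..b}|lebesgue. F x)"
    unfolding set_lebesgue_integral_def
    by (intro Bochner_Integration.integral_cong refl) (use assms(2) in \<open>auto simp: indicator_def\<close>)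
  also have "\<dots> = integral {a..b} F"
    by (rule set_lebesgue_integral_eq_integral(2)[OF loc_intD[OF assms(1)]])
  finally show ?thesis .
qed

lemma integral_tendsto_LINT:
  fixes F :: "real \<Rightarrow> 'a::euclidean_space"
  assumes "integrable lebesgue F"
  shows "(\<lambda>n. integral {- real n..real n} F) \<longlonglongrightarrow> (LINT x|lebesgue. F x)"
proof -
  have si: "set_integrable lebesgue A F" if "A \<in> sets lebesgue" for A
    unfolding set_integrable_def using that by (intro integrable_mult_indicator assms)
  have "(\<lambda>n. LINT x|lebesgue. indicator {- real n..real n} x *\<^sub>R F x) \<longlonglongrightarrow> (LINT x|lebesgue. F x)"
  proof (rule integral_dominated_convergence[where w = "\<lambda>x. norm (F x)"])
    show "AE x in lebesgue. (\<lambda>n. indicator {- real n..real n} x *\<^sub>R F x) \<longlonglongrightarrow> F x"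
    proof (intro AE_I2 tendsto_eventually)
      fix x :: real
      obtain N where "\<bar>x\<bar> \<le> real N" using real_arch_simple by blast
      then show "\<forall>\<^sub>F n in sequentially. indicator {- real n..real n} x *\<^sub>R F x = F x"
        by (intro eventually_sequentiallyI[of N]) (auto simp: indicator_def)
    qed
    show "(\<lambda>x. indicator {- real n..real n} x *\<^sub>R F x) \<in> borel_measurable lebesgue" for n
      using si[of "{- real n..real n}"] unfolding set_integrable_def by auto
  qed (use assms in \<open>auto simp: indicator_def\<close>)
  then show ?thesis
    using set_lebesgue_integral_eq_integral(2)[OF si] unfolding set_lebesgue_integral_def by simp
qed

section \<open>Algebra of solutions and vanishing boundary terms\<close>

lemma continuous_AE_zero:
  fixes g :: "real \<Rightarrow> 'a::real_normed_vector"
  assumes "continuous_on UNIV g" "AE x in lebesgue. x \<in> {a<..<b} \<longrightarrow> g x = 0" "x \<in> {a<..<b}"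
  shows "g x = 0"
proof (rule ccontr)
  assume gx: "g x \<noteq> 0"
  let ?U = "{y. g y \<noteq> 0} \<inter> {a<..<b}"
  have "open {y. g y \<noteq> 0}" using assms(1) by (intro open_Collect_neq) auto
  then have "open ?U" by (rule open_Int) simp
  moreover have "negligible ?U"
  proof -
    obtain N where N: "N \<in> null_sets lebesgue" "\<And>x. x \<notin> N \<Longrightarrow> x \<in> {a<..<b} \<longrightarrow> g x = 0"
      using assms(2) unfolding completion.AE_iff_null_sets by auto
    then show ?thesis using negligible_subset[of N ?U] negligible_iff_null_sets by blast
  qed
  moreover have "x \<in> ?U" using gx assms(3) by auto
  ultimately show False using open_not_negligible by blast
qed

lemma qsolD:
  assumes "qsol \<alpha> \<beta> \<tau> f u u1"
  shows "AC_loc u" "AC_loc u1" "continuous_on A u" "continuous_on A u1"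
    "AE x in lebesgue. (u has_vector_derivative \<alpha> x * u x + of_real (\<beta> x) * u1 x) (at x)"
    "AE x in lebesgue. (u1 has_vector_derivative - f x - cnj (\<alpha> x) * u1 x - of_real (\<tau> x) * u x) (at x)"
  using assms AC_loc_continuous unfolding qsol_def by blast+

lemma qsol_add:
  assumes "qsol \<alpha> \<beta> \<tau> f u u1" "qsol \<alpha> \<beta> \<tau> g v v1"
  shows "qsol \<alpha> \<beta> \<tau> (\<lambda>x. f x + g x) (\<lambda>x. u x + v x) (\<lambda>x. u1 x + v1 x)"
  unfolding qsol_def
proof (intro conjI AC_loc_add)
  show "AE x in lebesgue. ((\<lambda>x. u x + v x) has_vector_derivative \<alpha> x * (u x + v x) + of_real (\<beta> x) * (u1 x + v1 x)) (at x)"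
    using qsolD(5)[OF assms(1)] qsolD(5)[OF assms(2)]
    by eventually_elim (rule has_vector_derivative_eq_rhs[OF has_vector_derivative_add], assumption+, simp add: algebra_simps)
  show "AE x in lebesgue. ((\<lambda>x. u1 x + v1 x) has_vector_derivative
      - (f x + g x) - cnj (\<alpha> x) * (u1 x + v1 x) - of_real (\<tau> x) * (u x + v x)) (at x)"
    using qsolD(6)[OF assms(1)] qsolD(6)[OF assms(2)]
    by eventually_elim (rule has_vector_derivative_eq_rhs[OF has_vector_derivative_add], assumption+, simp add: algebra_simps)
qed (use assms qsolD in blast)+

lemma qsol_cmult:
  assumes "qsol \<alpha> \<beta> \<tau> f u u1"
  shows "qsol \<alpha> \<beta> \<tau> (\<lambda>x. c * f x) (\<lambda>x. c * u x) (\<lambda>x. c * u1 x)"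
  unfolding qsol_def
proof (intro conjI)
  show "AC_loc (\<lambda>x. c * u x)" by (rule AC_loc_linear[OF qsolD(1)[OF assms] bounded_linear_mult_right])
  show "AC_loc (\<lambda>x. c * u1 x)" by (rule AC_loc_linear[OF qsolD(2)[OF assms] bounded_linear_mult_right])
  show "AE x in lebesgue. ((\<lambda>x. c * u x) has_vector_derivative \<alpha> x * (c * u x) + of_real (\<beta> x) * (c * u1 x)) (at x)"
    using qsolD(5)[OF assms]
    by eventually_elim (rule has_vector_derivative_eq_rhs[OF has_vector_derivative_mult_right], assumption+, simp add: algebra_simps)
  show "AE x in lebesgue. ((\<lambda>x. c * u1 x) has_vector_derivative
      - (c * f x) - cnj (\<alpha> x) * (c * u1 x) - of_real (\<tau> x) * (c * u x)) (at x)"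
    using qsolD(6)[OF assms]
    by eventually_elim (rule has_vector_derivative_eq_rhs[OF has_vector_derivative_mult_right], assumption+, simp add: algebra_simps)
qed

text \<open>Where \<open>u\<close> vanishes on an interval so does its derivative, and the first
  equation reduces to \<beta> u1 = 0 almost everywhere; continuity removes the exceptional set.
  Hence compact support of \<open>u\<close> alone makes the boundary terms in Green's formula
  vanish.\<close>

lemma qsol_zero_on_interval:
  assumes u: "qsol \<alpha> \<beta> \<tau> f u u1" and b: "\<And>x. \<beta> x \<noteq> 0"
    and z: "\<And>x. x \<in> {c<..<d} \<Longrightarrow> u x = 0" and x: "x \<in> {c<..<d}"
  shows "u1 x = 0"
proof (rule continuous_AE_zero[OF qsolD(4)[OF u] _ x])
  show "AE x in lebesgue. x \<in> {c<..<d} \<longrightarrow> u1 x = 0"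
    using qsolD(5)[OF u]
  proof eventually_elim
    case (elim x)
    show ?case
    proof
      assume x: "x \<in> {c<..<d}"
      have "((\<lambda>x. 0) has_vector_derivative \<alpha> x * u x + of_real (\<beta> x) * u1 x) (at x)"
        by (rule has_vector_derivative_transform_within_open[OF elim _ x]) (use z in auto)
      then have "\<alpha> x * u x + of_real (\<beta> x) * u1 x = 0"
        using vector_derivative_unique_at has_vector_derivative_const by blast
      then show "u1 x = 0" using z[OF x] b by simp
    qed
  qed
qed

lemma qsol_compact_support:
  assumes u: "qsol \<alpha> \<beta> \<tau> f u u1" and b: "\<And>x. \<beta> x \<noteq> 0"
    and z: "\<And>x. \<bar>x\<bar> > c \<Longrightarrow> u x = 0" and x: "\<bar>x\<bar> > c"
  shows "u1 x = 0"
proof (cases "x > c")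
  case True
  show ?thesis by (rule qsol_zero_on_interval[OF u b, of c "x+1"]) (use z True in auto)
next
  case False
  show ?thesis by (rule qsol_zero_on_interval[OF u b, of "x-1" "-c"]) (use z False x in auto)
qed

text \<open>The support of one factor kills the bracket at both ends of every large interval. This
  gives at once the symmetry of the preminimal operator and the inclusion of the maximal operator in
  its adjoint.\<close>

lemma qsol_symmetric:
  assumes u: "qsol \<alpha> \<beta> \<tau> f u u1" and v: "qsol \<alpha> \<beta> \<tau> g v v1" and b: "\<And>x. \<beta> x \<noteq> 0"
    and L: "L2 u" "L2 f" "L2 v" "L2 g"
    and z: "\<And>x. \<bar>x\<bar> > c \<Longrightarrow> u x = 0"
  shows "ip f v = ip u g"
proof -
  have i: "integrable lebesgue (\<lambda>x. f x * cnj (v x) - u x * cnj (g x))"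
    by (intro Bochner_Integration.integrable_diff L2_mult_integrable L)
  have "(\<lambda>n. integral {- real n..real n} (\<lambda>x. f x * cnj (v x) - u x * cnj (g x))) \<longlonglongrightarrow> 0"
  proof (rule tendsto_eventually)
    obtain N :: nat where N: "c < real N" using reals_Archimedean2 by blast
    show "\<forall>\<^sub>F n in sequentially. integral {- real n..real n} (\<lambda>x. f x * cnj (v x) - u x * cnj (g x)) = 0"
    proof (rule eventually_sequentiallyI[of N])
      fix n assume n: "n \<ge> N"
      have "u (real n) = 0" "u (- real n) = 0" using z n N by auto
      moreover have "u1 (real n) = 0" "u1 (- real n) = 0"
        using n N by (auto intro!: qsol_compact_support[OF u b z])
      ultimately show "integral {- real n..real n} (\<lambda>x. f x * cnj (v x) - u x * cnj (g x)) = 0"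
        using green_formula[OF u v, of "- real n" "real n"] by (simp add: lagrange_def integral_unique)
    qed
  qed
  then have "(LINT x|lebesgue. f x * cnj (v x) - u x * cnj (g x)) = 0"
    using LIMSEQ_unique[OF integral_tendsto_LINT[OF i]] by blast
  then show ?thesis unfolding ip_def by (simp add: L L2_mult_integrable)
qed

text \<open>The letters stand for the Cauchy data at one point of two homogeneous solutions, and the
  first three equations say that their brackets keep the values 0, 0 and 1. The conserved bracket
  conjugates one factor and is not the determinant of the linear system for \<open>a\<close> and
  \<open>b\<close>; the two self-bracket equations are what excludes a zero determinant.\<close>

lemma fundamental_pair_nondegenerate:
  fixes a b :: complex
  assumes "p1 * cnj p2 = p2 * cnj p1" "q1 * cnj q2 = q2 * cnj q1" "p1 * cnj q2 - p2 * cnj q1 = 1"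
    and "a * cnj p2 = b * cnj p1" "a * cnj q2 = b * cnj q1"
  shows "a = 0 \<and> b = 0"
proof -
  have c1: "cnj p1 * p2 = p1 * cnj p2" using assms(1) by (simp add: mult.commute)
  have "a * (cnj p2 * cnj q1 - cnj q2 * cnj p1) = 0" using assms(4,5) by algebra
  moreover have "b * (cnj p2 * cnj q1 - cnj q2 * cnj p1) = 0" using assms(4,5) by algebra
  moreover have "cnj p2 * cnj q1 - cnj q2 * cnj p1 \<noteq> 0"
  proof
    assume z: "cnj p2 * cnj q1 - cnj q2 * cnj p1 = 0"
    have "cnj p1 * 1 = cnj p1 * (p1 * cnj q2 - p2 * cnj q1)" using assms(3) by simp
    also have "\<dots> = p1 * (cnj q2 * cnj p1) - (cnj p1 * p2) * cnj q1" by (simp add: algebra_simps)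
    also have "\<dots> = p1 * (cnj q2 * cnj p1 - cnj p2 * cnj q1)" unfolding c1 by (simp add: algebra_simps)
    also have "\<dots> = 0" using z by simp
    finally have p1: "p1 = 0" by simp
    have "cnj p2 * 1 = cnj p2 * (p1 * cnj q2 - p2 * cnj q1)" using assms(3) by simp
    also have "\<dots> = - p2 * (cnj p2 * cnj q1)" using p1 by (simp add: algebra_simps)
    also have "\<dots> = 0" using z p1 by simp
    finally have "p2 = 0" by simp
    then show False using p1 assms(3) by simp
  qed
  ultimately show ?thesis by simp
qed

locale quasi_system =
  fixes \<alpha> :: "real \<Rightarrow> complex" and \<beta> \<tau> :: "real \<Rightarrow> real"
  assumes a: "loc_int \<alpha>" and b: "loc_int \<beta>" and t: "loc_int \<tau>" and bnz: "\<And>x. \<beta> x \<noteq> 0"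
begin

text \<open>The last clause is how the pair is used: Cauchy data whose brackets with both solutions
  vanish at a point are zero. It holds at every point because homogeneous brackets are constant and
  the unit data at 0 fix their values.\<close>

lemma fundamental_system:
  obtains \<theta> \<theta>' \<eta> \<eta>' where "qsol \<alpha> \<beta> \<tau> (\<lambda>x. 0) \<theta> \<theta>'" "qsol \<alpha> \<beta> \<tau> (\<lambda>x. 0) \<eta> \<eta>'"
    "\<theta> 0 = 1" "\<theta>' 0 = 0" "\<eta> 0 = 0" "\<eta>' 0 = 1"
    "\<And>x c d. c * cnj (\<theta>' x) = d * cnj (\<theta> x) \<Longrightarrow> c * cnj (\<eta>' x) = d * cnj (\<eta> x) \<Longrightarrow> c = 0 \<and> d = 0"
proof -
  have z: "loc_int (\<lambda>x. 0 :: complex)" by (intro loc_int_continuous continuous_intros)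
  obtain \<theta> \<theta>' where 1: "qsol \<alpha> \<beta> \<tau> (\<lambda>x. 0) \<theta> \<theta>'" "\<theta> 0 = 1" "\<theta>' 0 = 0" using qsol_exists[OF a b t z] by blast
  obtain \<eta> \<eta>' where 2: "qsol \<alpha> \<beta> \<tau> (\<lambda>x. 0) \<eta> \<eta>'" "\<eta> 0 = 0" "\<eta>' 0 = 1" using qsol_exists[OF a b t z] by blast
  have const: "lagrange u u1 v v1 x = lagrange u u1 v v1 0"
    if "qsol \<alpha> \<beta> \<tau> (\<lambda>x. 0) u u1" "qsol \<alpha> \<beta> \<tau> (\<lambda>x. 0) v v1" for u u1 v v1 x
  proof (cases "0 \<le> x")
    case True
    from green_formula[OF that this] show ?thesis
      by simp
  next
    case False
    then have "x \<le> 0" by simp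
    from green_formula[OF that this] show ?thesis
      by simp
  qed
  show ?thesis
  proof (rule that[OF 1(1) 2(1) 1(2,3) 2(2,3)])
    fix x c d assume "c * cnj (\<theta>' x) = d * cnj (\<theta> x)" "c * cnj (\<eta>' x) = d * cnj (\<eta> x)"
    then show "c = 0 \<and> d = 0"
      using const[OF 1(1) 1(1), of x] const[OF 2(1) 2(1), of x] const[OF 1(1) 2(1), of x] 1(2,3) 2(2,3)
      by (intro fundamental_pair_nondegenerate[of "\<theta> x" "\<theta>' x" "\<eta> x" "\<eta>' x"]) (simp_all add: lagrange_def)
  qed
qed

text \<open>The component of \<open>v - y\<close> on \<open>(-N, N)\<close> that is orthogonal to the solutions of the homogeneous
  equation is itself the right-hand side of a compactly supported solution, hence orthogonal to
  \<open>v - y\<close>, hence zero.\<close>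

theorem adjoint_preminimal:
  assumes v: "L2 v" and w: "L2 w"
    and adj: "\<And>u u1 f. qsol \<alpha> \<beta> \<tau> f u u1 \<Longrightarrow> L2 u \<Longrightarrow> L2 f \<Longrightarrow> \<exists>c. \<forall>x. \<bar>x\<bar> > c \<longrightarrow> u x = 0 \<Longrightarrow> ip f v = ip u w"
  shows "\<exists>v' v1. qsol \<alpha> \<beta> \<tau> w v' v1 \<and> ae_eq v v'"
proof -
  obtain \<theta> \<theta>' \<eta> \<eta>' where th: "qsol \<alpha> \<beta> \<tau> (\<lambda>x. 0) \<theta> \<theta>'" and et: "qsol \<alpha> \<beta> \<tau> (\<lambda>x. 0) \<eta> \<eta>'"
    and init: "\<theta> 0 = 1" "\<theta>' 0 = 0" "\<eta> 0 = 0" "\<eta>' 0 = 1"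
    and nd: "\<And>x c d. c * cnj (\<theta>' x) = d * cnj (\<theta> x) \<Longrightarrow> c * cnj (\<eta>' x) = d * cnj (\<eta> x) \<Longrightarrow> c = 0 \<and> d = 0"
    by (rule fundamental_system) (rule that)
  \<comment> \<open>A particular solution on the whole line. Square integrability of
    \<open>y\<close> is not claimed; only its truncations enter inner products.\<close>
  obtain y y1 where y: "qsol \<alpha> \<beta> \<tau> w y y1" using qsol_exists[OF a b t L2_imp_loc_int[OF w]] by blast
  have rep: "\<exists>c d. AE x in lebesgue. x \<in> {-N<..<N} \<longrightarrow> v x = y x + c * \<theta> x + d * \<eta> x" if N: "N > 0" for N :: real
  proof -
    define J where "J = {-N<..<N}"
    define cut where "cut g x = (if x \<in> J then g x else 0)" for g :: "real \<Rightarrow> complex" and x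
    have Lc: "L2 (cut g)" if "continuous_on UNIV g" for g
      unfolding cut_def J_def by (rule L2_cutoff_continuous[OF that])
    have Lth: "L2 (cut \<theta>)" and Let: "L2 (cut \<eta>)" and Ly: "L2 (cut y)"
      using Lc qsolD(3) th et y by blast+
    have Lv: "L2 (cut v)" unfolding cut_def J_def by (rule L2_cutoff[OF v])
    have Lh: "L2 (\<lambda>x. cut v x - cut y x)" by (intro L2_diff Lv Ly)
    obtain c d where cd: "ip (\<lambda>x. (cut v x - cut y x) - c * cut \<theta> x - d * cut \<eta> x) (cut \<theta>) = 0"
      "ip (\<lambda>x. (cut v x - cut y x) - c * cut \<theta> x - d * cut \<eta> x) (cut \<eta>) = 0"
      using proj_onto_two[OF Lth Let Lh] by blast
    define f where "f x = (cut v x - cut y x) - c * cut \<theta> x - d * cut \<eta> x" for x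
    have Lf: "L2 f" unfolding f_def by (intro L2_diff L2_cmult Lth Let Lv Ly)
    have f0: "f x = 0" if "x \<notin> J" for x using that by (simp add: f_def cut_def)
    have fl: "loc_int f" by (rule L2_imp_loc_int[OF Lf])
    have fp: "f x * cnj (cut g x) = f x * cnj (g x)" for g x using f0 by (cases "x \<in> J") (auto simp: cut_def)
    have fip: "ip f (cut g) = integral {-N..N} (\<lambda>x. f x * cnj (g x))" if g: "continuous_on UNIV g" for g
      unfolding ip_def fp
    proof (rule integral_compact_support)
      show "loc_int (\<lambda>x. f x * cnj (g x))" by (intro loc_int_mult_continuous_right fl continuous_intros g)
      show "f x * cnj (g x) = 0" if "x \<notin> {-N..N}" for x using f0[of x] that by (auto simp: J_def)
    qed
    have orth: "integral {-N..N} (\<lambda>x. f x * cnj (\<theta> x)) = 0" "integral {-N..N} (\<lambda>x. f x * cnj (\<eta> x)) = 0"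
      using cd fip[OF qsolD(3)[OF th]] fip[OF qsolD(3)[OF et]] unfolding f_def[symmetric] by simp_all
    obtain u u1 where u: "qsol \<alpha> \<beta> \<tau> f u u1" "u (-N) = 0" "u1 (-N) = 0"
      using qsol_exists[OF a b t fl] by blast
    \<comment> \<open>The bracket of \<open>u\<close> with a homogeneous solution is constant
      wherever \<open>f = 0\<close>, and its change across the interval is the orthogonality
      integral. So zero data at \<open>-N\<close> give zero brackets beyond \<open>N\<close> as
      well, and \<open>nd\<close> turns these into zero data of \<open>u\<close>.\<close>
    have lz: "lagrange u u1 g g1 x = 0"
      if g: "qsol \<alpha> \<beta> \<tau> (\<lambda>x. 0) g g1" "integral {-N..N} (\<lambda>x. f x * cnj (g x)) = 0" and x: "x \<notin> J" for g g1 x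
    proof -
      have l0: "lagrange u u1 g g1 (-N) = 0" using u by (simp add: lagrange_def)
      have gf: "((\<lambda>x. f x * cnj (g x)) has_integral lagrange u u1 g g1 d - lagrange u u1 g g1 c) {c..d}" if "c \<le> d" for c d
        using green_formula[OF u(1) g(1) that] by simp
      have zero: "((\<lambda>x. f x * cnj (g x)) has_integral 0) {c..d}" if "{c..d} \<inter> J = {}" for c d
      proof (rule has_integral_is_0)
        fix x assume "x \<in> {c..d}"
        then have "x \<notin> J" using that by blast
        then show "f x * cnj (g x) = 0" using f0 by simp
      qed
      show ?thesis
      proof (cases "x \<le> -N")
        case True
        have "{x..-N} \<inter> J = {}" by (auto simp: J_def)
        then show ?thesis using has_integral_unique[OF gf[OF True] zero] l0 by simp
      next
        case False
        then have xN: "N \<le> x" using x by (auto simp: J_def)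
        have "lagrange u u1 g g1 N = 0"
          using gf[of "-N" N] N g(2) l0 by (simp add: integral_unique)
        moreover have "{N..x} \<inter> J = {}" by (auto simp: J_def)
        ultimately show ?thesis using has_integral_unique[OF gf[OF xN] zero] by simp
      qed
    qed
    have uz: "u x = 0 \<and> u1 x = 0" if "x \<notin> J" for x
      using lz[OF th orth(1) that] lz[OF et orth(2) that] unfolding lagrange_def by (intro nd[of _ x]) auto
    have "u = cut u" using uz by (auto simp: cut_def)
    then have Lu: "L2 u" using Lc[OF qsolD(3)[OF u(1)]] by simp
    have "\<exists>c. \<forall>x. \<bar>x\<bar> > c \<longrightarrow> u x = 0"
    proof (intro exI[of _ N] allI impI)
      fix x assume "N < \<bar>x\<bar>"
      then have "x \<notin> J" by (auto simp: J_def)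
      then show "u x = 0" using uz by blast
    qed
    then have "ip f v = ip u w" by (rule adj[OF u(1) Lu Lf])
    moreover have "ip f (cut y) = ip u w"
    proof -
      have uw: "ip u w = integral {-N..N} (\<lambda>x. u x * cnj (w x))"
        unfolding ip_def
      proof (rule integral_compact_support)
        show "loc_int (\<lambda>x. u x * cnj (w x))"
          by (intro loc_int_mult_continuous qsolD(3)[OF u(1)] loc_int_linear[OF L2_imp_loc_int[OF w]] bounded_linear_cnj)
        show "u x * cnj (w x) = 0" if "x \<notin> {-N..N}" for x using uz[of x] that by (auto simp: J_def)
      qed
      have g0: "((\<lambda>x. f x * cnj (y x) - u x * cnj (w x)) has_integral 0) {-N..N}"
        using green_formula[OF u(1) y, of "-N" N] N uz[of N] u(2,3) by (simp add: lagrange_def J_def)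
      have iA: "(\<lambda>x. f x * cnj (y x)) integrable_on {-N..N}"
        by (intro loc_int_integrable loc_int_mult_continuous_right fl continuous_intros qsolD(3)[OF y])
      have iB: "(\<lambda>x. u x * cnj (w x)) integrable_on {-N..N}"
        by (intro loc_int_integrable loc_int_mult_continuous qsolD(3)[OF u(1)] loc_int_linear[OF L2_imp_loc_int[OF w]] bounded_linear_cnj)
      show ?thesis unfolding fip[OF qsolD(3)[OF y]] uw
        using Henstock_Kurzweil_Integration.integral_diff[OF iA iB] integral_unique[OF g0] by simp
    qed
    moreover have "ip f v = ip f (cut v)" unfolding ip_def fp ..
    ultimately have fh: "ip f (\<lambda>x. cut v x - cut y x) = 0"
      using Lf Lv Ly by (simp add: ip_diff_right)
    have feq: "f = (\<lambda>x. (cut v x - cut y x) - c * cut \<theta> x - d * cut \<eta> x)" by (rule ext) (rule f_def)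
    have "ip f f = ip f (\<lambda>x. (cut v x - cut y x) - c * cut \<theta> x - d * cut \<eta> x)" by (subst (2) feq) (rule refl)
    also have "\<dots> = ip f (\<lambda>x. (cut v x - cut y x) - c * cut \<theta> x) - ip f (\<lambda>x. d * cut \<eta> x)"
      by (intro ip_diff_right L2_diff L2_cmult Lf Lv Ly Lth Let)
    also have "ip f (\<lambda>x. (cut v x - cut y x) - c * cut \<theta> x) = ip f (\<lambda>x. cut v x - cut y x) - ip f (\<lambda>x. c * cut \<theta> x)"
      by (intro ip_diff_right L2_diff L2_cmult Lf Lv Ly Lth Let)
    finally have "ip f f = 0" using fh cd unfolding f_def[symmetric] by (simp add: ip_cmult_right)
    then have "nrm2 f = 0" by (simp add: ip_self)
    then have "AE x in lebesgue. f x = 0" using nrm2_zero_iff[OF Lf] by (simp add: ae_eq_def)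
    then have "AE x in lebesgue. x \<in> {-N<..<N} \<longrightarrow> v x = y x + c * \<theta> x + d * \<eta> x"
      by eventually_elim (auto simp: f_def cut_def J_def algebra_simps)
    then show ?thesis by blast
  qed
  obtain c d where cd: "AE x in lebesgue. x \<in> {-1<..<1} \<longrightarrow> v x = y x + c * \<theta> x + d * \<eta> x" using rep[of 1] by auto
  \<comment> \<open>Two representations agree near 0, so their difference is a homogeneous solution
    vanishing there. Its Cauchy data at 0 are the differences of the coefficients; hence the pair
    found on \<open>(-1, 1)\<close> serves every larger interval.\<close>
  have same: "c' = c \<and> d' = d" if N: "N \<ge> 1" and r: "AE x in lebesgue. x \<in> {-N<..<N} \<longrightarrow> v x = y x + c' * \<theta> x + d' * \<eta> x" for c' d' and N :: real
  proof -
    define z where "z x = (c' - c) * \<theta> x + (d' - d) * \<eta> x" for x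
    define z1 where "z1 x = (c' - c) * \<theta>' x + (d' - d) * \<eta>' x" for x
    have zq: "qsol \<alpha> \<beta> \<tau> (\<lambda>x. 0) z z1"
      using qsol_add[OF qsol_cmult[OF th] qsol_cmult[OF et], of "c' - c" "d' - d"] unfolding z_def z1_def by simp
    have "AE x in lebesgue. x \<in> {-1<..<1} \<longrightarrow> z x = 0"
      using cd r by eventually_elim (use N in \<open>auto simp: z_def algebra_simps\<close>)
    then have z0: "z x = 0" if "x \<in> {-1<..<1}" for x
      using continuous_AE_zero[OF qsolD(3)[OF zq] _ that] by blast
    have "z 0 = 0" "z1 0 = 0" using z0 qsol_zero_on_interval[OF zq bnz, of "-1" 1 0] by auto
    then show ?thesis using init by (simp add: z_def z1_def)
  qed
  have "AE x in lebesgue. x \<in> {- real (Suc n)<..<real (Suc n)} \<longrightarrow> v x = y x + c * \<theta> x + d * \<eta> x" for n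
  proof -
    obtain c' d' where r: "AE x in lebesgue. x \<in> {- real (Suc n)<..<real (Suc n)} \<longrightarrow> v x = y x + c' * \<theta> x + d' * \<eta> x"
      using rep[of "real (Suc n)"] by auto
    from same[OF _ r] have "c' = c" "d' = d" by simp_all
    with r show ?thesis by simp
  qed
  then have "AE x in lebesgue. \<forall>n. x \<in> {- real (Suc n)<..<real (Suc n)} \<longrightarrow> v x = y x + c * \<theta> x + d * \<eta> x"
    unfolding AE_all_countable by blast
  then have "ae_eq v (\<lambda>x. y x + c * \<theta> x + d * \<eta> x)"
    unfolding ae_eq_def
  proof eventually_elim
    case (elim x)
    obtain n :: nat where "\<bar>x\<bar> < real n" using reals_Archimedean2 by blast
    then have "x \<in> {- real (Suc n)<..<real (Suc n)}" by auto
    then show ?case using elim by blast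
  qed
  moreover have "qsol \<alpha> \<beta> \<tau> w (\<lambda>x. y x + c * \<theta> x + d * \<eta> x) (\<lambda>x. y1 x + c * \<theta>' x + d * \<eta>' x)"
    using qsol_add[OF qsol_add[OF y qsol_cmult[OF th, of c]] qsol_cmult[OF et, of d]] by simp
  ultimately show ?thesis by blast
qed

end

subsection \<open>Test functions and the continuous representative of a Sobolev function\<close>

definition smooth :: "(real \<Rightarrow> real) \<Rightarrow> bool" where
  "smooth f \<longleftrightarrow> (\<exists>D::nat \<Rightarrow> real \<Rightarrow> real. D 0 = f \<and> (\<forall>n x. (D n has_real_derivative D (Suc n) x) (at x)))"

text \<open>Smoothness asks for a whole sequence of derivatives. A class in which each member has
  its derivative again in the class supplies one by iterating a choice function.\<close>

lemma smooth_class: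
  assumes S: "\<And>f. f \<in> S \<Longrightarrow> \<exists>f'\<in>S. \<forall>x. (f has_real_derivative f' x) (at x)" and f: "f \<in> S"
  shows "smooth f"
proof -
  obtain d where d: "\<And>f. f \<in> S \<Longrightarrow> d f \<in> S \<and> (\<forall>x. (f has_real_derivative d f x) (at x))"
    using S by metis
  have "(d ^^ n) f \<in> S" for n by (induction n) (auto simp: d f)
  then show ?thesis unfolding smooth_def
    by (intro exI[of _ "\<lambda>n. (d ^^ n) f"]) (auto simp: d)
qed

lemma smooth_affine:
  assumes "smooth f" shows "smooth (\<lambda>x. f (a * x + b))"
proof -
  obtain D where D: "D 0 = f" "\<And>n x. (D n has_real_derivative D (Suc n) x) (at x)"
    using assms unfolding smooth_def by blast
  have "((\<lambda>x. a ^ n * D n (a * x + b)) has_real_derivative a ^ Suc n * D (Suc n) (a * x + b)) (at x)" for n x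
    by (rule derivative_eq_intros DERIV_chain2[OF D(2)] refl | simp)+
  then show ?thesis unfolding smooth_def
    by (intro exI[of _ "\<lambda>n x. a ^ n * D n (a * x + b)"]) (simp add: D(1))
qed

text \<open>Sums of products of derivatives of two functions. The product rule keeps this class
  closed under differentiation, which replaces Leibniz's formula and its binomial
  coefficients.\<close>

inductive product_class :: "(nat \<Rightarrow> real \<Rightarrow> real) \<Rightarrow> (nat \<Rightarrow> real \<Rightarrow> real) \<Rightarrow> (real \<Rightarrow> real) \<Rightarrow> bool" for A B where
  "product_class A B (\<lambda>x. A i x * B j x)"
| "product_class A B f \<Longrightarrow> product_class A B g \<Longrightarrow> product_class A B (\<lambda>x. f x + g x)"

lemma smooth_mult:
  assumes "smooth f" "smooth g" shows "smooth (\<lambda>x. f x * g x)"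
proof -
  obtain A where A: "A 0 = f" "\<And>n x. (A n has_real_derivative A (Suc n) x) (at x)"
    using assms unfolding smooth_def by blast
  obtain B where B: "B 0 = g" "\<And>n x. (B n has_real_derivative B (Suc n) x) (at x)"
    using assms unfolding smooth_def by blast
  have "\<exists>h'\<in>Collect (product_class A B). \<forall>x. (h has_real_derivative h' x) (at x)" if "product_class A B h" for h
    using that
  proof induction
    case (1 i j)
    have "product_class A B (\<lambda>x. A (Suc i) x * B j x + A i x * B (Suc j) x)"
      by (intro product_class.intros)
    moreover have "((\<lambda>x. A i x * B j x) has_real_derivative A (Suc i) x * B j x + A i x * B (Suc j) x) (at x)" for x
      by (auto intro!: derivative_eq_intros A(2) B(2) simp: algebra_simps)
    ultimately show ?case
      by (intro bexI[of _ "\<lambda>x. A (Suc i) x * B j x + A i x * B (Suc j) x"] CollectI allI)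
  next
    case (2 f g)
    then obtain f' g' where "product_class A B f'" "product_class A B g'"
      "\<And>x. (f has_real_derivative f' x) (at x)" "\<And>x. (g has_real_derivative g' x) (at x)" by auto
    then show ?case by (intro bexI[of _ "\<lambda>x. f' x + g' x"]) (auto intro!: derivative_eq_intros product_class.intros)
  qed
  moreover have "(\<lambda>x. f x * g x) \<in> Collect (product_class A B)"
    using product_class.intros(1)[of A B 0 0] by (simp add: A(1) B(1))
  ultimately show ?thesis by (intro smooth_class[of "Collect (product_class A B)"]) auto
qed

lemma poly_exp_decay: "((\<lambda>y::real. poly q y * exp (- y)) \<longlongrightarrow> 0) at_top"
proof -
  have "((\<lambda>y::real. \<Sum>i\<le>degree q. coeff q i * (y ^ i / exp y)) \<longlongrightarrow> (\<Sum>i\<le>degree q. coeff q i * 0)) at_top"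
    by (intro tendsto_sum tendsto_mult tendsto_const tendsto_power_div_exp_0)
  then show ?thesis by (simp add: poly_altdef sum_distrib_right exp_minus divide_inverse mult.assoc)
qed

text \<open>The classical flat function exp (-1/x), with polynomial factors in 1/x so that the
  family is closed under differentiation: the polynomial q turns into X^2 (q - q').\<close>

definition flat_exp :: "real poly \<Rightarrow> real \<Rightarrow> real" where
  "flat_exp q x = (if x > 0 then poly q (1 / x) * exp (- (1 / x)) else 0)"

lemma flat_exp_deriv: "(flat_exp q has_real_derivative flat_exp ([:0,0,1:] * (q - pderiv q)) x) (at x)"
proof -
  consider "x > 0" | "x < 0" | "x = 0" by linarith
  then show ?thesis
  proof cases
    case 1
    have "((\<lambda>x. poly q (1 / x) * exp (- (1 / x))) has_real_derivative flat_exp ([:0,0,1:] * (q - pderiv q)) x) (at x)"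
      using 1 by (auto intro!: derivative_eq_intros simp: flat_exp_def field_simps power2_eq_square)
    then show ?thesis
      by (rule has_field_derivative_transform_within_open[where S = "{0<..}"]) (use 1 in \<open>auto simp: flat_exp_def\<close>)
  next
    case 2
    have "((\<lambda>x. 0) has_real_derivative flat_exp ([:0,0,1:] * (q - pderiv q)) x) (at x)"
      using 2 by (simp add: flat_exp_def)
    then show ?thesis
      by (rule has_field_derivative_transform_within_open[where S = "{..<0}"]) (use 2 in \<open>auto simp: flat_exp_def\<close>)
  next
    case 3
    \<comment> \<open>The extra factor \<open>[:0,1:]\<close> is the \<open>1 / h\<close> of the
      difference quotient at 0.\<close>
    have r: "((\<lambda>h. poly ([:0,1:] * q) (1 / h) * exp (- (1 / h))) \<longlongrightarrow> 0) (at_right 0)"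
      using filterlim_compose[OF poly_exp_decay[of "[:0,1:] * q"] filterlim_inverse_at_top_right] by (simp add: inverse_eq_divide)
    have "((\<lambda>h. (flat_exp q (0 + h) - flat_exp q 0) / h) \<longlongrightarrow> 0) (at 0)"
    proof (rule filterlim_split_at)
      show "((\<lambda>h. (flat_exp q (0 + h) - flat_exp q 0) / h) \<longlongrightarrow> 0) (at_right 0)"
      proof (rule Lim_transform_eventually[OF r])
        show "\<forall>\<^sub>F h in at_right 0. poly ([:0,1:] * q) (1 / h) * exp (- (1 / h)) = (flat_exp q (0 + h) - flat_exp q 0) / h"
          using eventually_at_right_less[of "0::real"] by eventually_elim (simp add: flat_exp_def)
      qed
      show "((\<lambda>h. (flat_exp q (0 + h) - flat_exp q 0) / h) \<longlongrightarrow> 0) (at_left 0)"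
        by (rule tendsto_eventually) (auto simp: flat_exp_def eventually_at_filter)
    qed
    then show ?thesis unfolding DERIV_def 3 by (simp add: flat_exp_def)
  qed
qed

lemma smooth_flat_exp: "smooth (flat_exp q)"
  by (rule smooth_class[of "range flat_exp"]) (use flat_exp_deriv in blast)+

text \<open>Increasing \<open>n\<close> steepens both flanks while the support stays in the interval
  from \<open>a\<close> to \<open>b\<close>, so that the bumps approach the indicator of the open
  interval from below.\<close>

definition bump :: "real \<Rightarrow> real \<Rightarrow> nat \<Rightarrow> real \<Rightarrow> real" where
  "bump a b n x = flat_exp 1 (real n * (x - a)) * flat_exp 1 (real n * (b - x))"

lemma smooth_bump: "smooth (bump a b n)"
proof -
  have "bump a b n = (\<lambda>x. flat_exp 1 (real n * x + - (real n * a)) * flat_exp 1 (- real n * x + real n * b))"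
    by (auto simp: bump_def algebra_simps)
  then show ?thesis by (simp only:) (intro smooth_mult smooth_affine smooth_flat_exp)
qed

lemma smooth_continuous: "smooth f \<Longrightarrow> continuous_on A f"
  unfolding smooth_def by (metis DERIV_isCont continuous_at_imp_continuous_on)

lemma flat_exp_1_bounds: "0 \<le> flat_exp 1 x" "flat_exp 1 x \<le> 1"
  by (auto simp: flat_exp_def)

lemma bump_bounds: "0 \<le> bump a b n x" "bump a b n x \<le> 1"
  using flat_exp_1_bounds by (auto simp: bump_def intro: mult_le_one)

lemma bump_support: "x \<notin> {a<..<b} \<Longrightarrow> bump a b n x = 0"
  by (auto simp: bump_def flat_exp_def zero_less_mult_iff)

lemma bump_pos: "n > 0 \<Longrightarrow> x \<in> {a<..<b} \<Longrightarrow> bump a b n x > 0"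
  by (auto simp: bump_def flat_exp_def)

lemma bump_tendsto: "(\<lambda>n. bump a b n x) \<longlonglongrightarrow> indicator {a<..<b} x"
proof (cases "x \<in> {a<..<b}")
  case True
  have e: "(\<lambda>n. flat_exp 1 (real n * c)) \<longlonglongrightarrow> 1" if c: "c > 0" for c
  proof -
    have "(\<lambda>n. exp (- (inverse c * inverse (real n)))) \<longlonglongrightarrow> exp (- (inverse c * 0))"
      by (intro tendsto_intros lim_inverse_n)
    then have "(\<lambda>n. exp (- (inverse c * inverse (real n)))) \<longlonglongrightarrow> 1" by simp
    then show ?thesis
    proof (rule Lim_transform_eventually)
      show "\<forall>\<^sub>F n in sequentially. exp (- (inverse c * inverse (real n))) = flat_exp 1 (real n * c)"
        using eventually_gt_at_top[of 0] by eventually_elim (use c in \<open>simp add: flat_exp_def field_simps\<close>)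
    qed
  qed
  have "(\<lambda>n. bump a b n x) \<longlonglongrightarrow> 1 * 1"
    unfolding bump_def using True by (intro tendsto_mult e) auto
  then show ?thesis using True by simp
qed (simp add: bump_support)

section \<open>Primitives of smooth functions and du Bois-Reymond's argument\<close>

lemma prim_deriv_continuous:
  fixes f :: "real \<Rightarrow> real"
  assumes f: "continuous_on UNIV f"
  shows "(prim t f has_real_derivative f x) (at x)"
proof -
  have x: "x \<in> {x-1<..<x+1}" by simp
  have "((\<lambda>y. integral {x-1..y} f) has_vector_derivative f x) (at x within {x-1..x+1})"
    by (rule integral_has_vector_derivative) (use f continuous_on_subset in auto)
  then have "((\<lambda>y. integral {x-1..y} f) has_vector_derivative f x) (at x)"
    by (simp add: at_within_Icc_at)
  then have "((\<lambda>y. prim t f (x-1) + integral {x-1..y} f) has_vector_derivative 0 + f x) (at x)"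
    by (intro has_vector_derivative_add has_vector_derivative_const)
  then have "(prim t f has_vector_derivative 0 + f x) (at x)"
  proof (rule has_vector_derivative_transform_within_open[OF _ _ x])
    show "prim t f (x-1) + integral {x-1..y} f = prim t f y" if "y \<in> {x-1<..<x+1}" for y
      using prim_diff[OF loc_int_continuous[OF f], of "x-1" y t] that by (simp add: algebra_simps)
  qed simp
  then show ?thesis by (simp add: has_real_derivative_iff_has_vector_derivative)
qed

lemma smooth_primitive:
  assumes "smooth f" shows "smooth (prim t f)"
proof -
  obtain D where D: "D 0 = f" "\<And>n x. (D n has_real_derivative D (Suc n) x) (at x)"
    using assms unfolding smooth_def by blast
  show ?thesis unfolding smooth_def
    by (intro exI[of _ "case_nat (prim t f) D"])
      (auto split: nat.split intro!: D(2) simp: D(1) prim_deriv_continuous smooth_continuous assms)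
qed

lemma smooth_diff_cmult:
  assumes "smooth f" "smooth g" shows "smooth (\<lambda>x. f x - c * g x)"
proof -
  obtain A where A: "A 0 = f" "\<And>n x. (A n has_real_derivative A (Suc n) x) (at x)"
    using assms unfolding smooth_def by blast
  obtain B where B: "B 0 = g" "\<And>n x. (B n has_real_derivative B (Suc n) x) (at x)"
    using assms unfolding smooth_def by blast
  show ?thesis unfolding smooth_def
    by (intro exI[of _ "\<lambda>n x. A n x - c * B n x"]) (auto intro!: derivative_eq_intros A(2) B(2) simp: A(1) B(1))
qed

text \<open>The primitive of \<open>h\<close> is identically zero, and Lebesgue's differentiation
  theorem recovers \<open>h\<close> from it.\<close>

lemma AE_zero_of_integrals_zero:
  fixes h :: "real \<Rightarrow> 'a::euclidean_space"
  assumes h: "loc_int h" and z: "\<And>a b. a \<le> b \<Longrightarrow> integral {a..b} h = 0"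
  shows "AE x in lebesgue. h x = 0"
proof -
  have "prim 0 h = (\<lambda>x. 0)"
  proof
    fix x show "prim 0 h x = 0"
      using prim_diff[OF h, of 0 x 0] prim_diff[OF h, of x 0 0] z[of 0 x] z[of x 0] by (cases "0 \<le> x") auto
  qed
  then have "AE x in lebesgue. ((\<lambda>x. 0) has_vector_derivative h x) (at x)"
    using AE_prim_has_vector_derivative[OF h, of 0] by simp
  then show ?thesis
    by eventually_elim (rule vector_derivative_unique_at[OF _ has_vector_derivative_const])
qed

lemma L2_loc_imp_loc_int: "L2_loc f \<Longrightarrow> loc_int f"
proof -
  have "L2_loc (\<lambda>x. 1)" unfolding L2_loc_def
    using absolutely_integrable_continuous_real[OF continuous_on_const, of _ _ "1::real"] by simp
  then show "L2_loc f \<Longrightarrow> loc_int f" using L2_loc_mult[of f "\<lambda>x. 1"] by simp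
qed

lemma integral_diff_cmult:
  fixes f g :: "real \<Rightarrow> real"
  assumes "f integrable_on S" "g integrable_on S"
  shows "integral S (\<lambda>x. f x - c * g x) = integral S f - c * integral S g"
  using Henstock_Kurzweil_Integration.integral_diff[OF assms(1) integrable_on_mult_right[OF assms(2), of c]] by simp

text \<open>With \<open>G\<close> a primitive of the weak derivative, \<open>p - G\<close> has weak
  derivative zero. It is therefore orthogonal to every test function of mean zero, which forces it
  to be constant almost everywhere.\<close>

theorem W12_loc_representative:
  assumes "W12_loc p"
  obtains P g where "AC_loc P" "L2_loc g" "AE x in lebesgue. (P has_real_derivative g x) (at x)"
    "AE x in lebesgue. p x = P x"
proof -
  obtain g where pL: "L2_loc p" and g: "L2_loc g"
    and weak: "\<And>\<phi> \<phi>'. test_fun \<phi> \<Longrightarrow> (\<And>x. (\<phi> has_real_derivative \<phi>' x) (at x)) \<Longrightarrow>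
            (LINT x|lebesgue. p x * \<phi>' x) = - (LINT x|lebesgue. g x * \<phi> x)"
    using assms unfolding W12_loc_def by blast
  have pl: "loc_int p" and gl: "loc_int g" using L2_loc_imp_loc_int pL g by auto
  define G where "G = prim 0 g"
  have GA: "AC_loc G" unfolding G_def by (rule AC_loc_prim[OF gl])
  have Gd: "AE x in lebesgue. (G has_real_derivative g x) (at x)"
    using AE_prim_has_vector_derivative[OF gl, of 0]
    unfolding G_def has_real_derivative_iff_has_vector_derivative .
  have Gl: "loc_int G" by (rule loc_int_continuous[OF AC_loc_continuous[OF GA]])
  define h where "h x = p x - G x" for x
  have hl: "loc_int h" unfolding h_def by (intro loc_int_diff pl Gl)
  define \<rho> where "\<rho> = bump 0 1 1"
  have rs: "smooth \<rho>" unfolding \<rho>_def by (rule smooth_bump)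
  have lm: "loc_int (\<lambda>x. f x * \<psi> x)" if "loc_int f" "smooth \<psi>" for f \<psi> :: "real \<Rightarrow> real"
    using loc_int_mult_continuous_real[OF smooth_continuous[OF that(2)] that(1)] by (simp add: mult.commute)
  \<comment> \<open>A smooth function of mean zero supported in \<open>(-K, K)\<close> is the
    derivative of a test function. The weak derivative of \<open>p\<close> and integration by parts
    for \<open>G\<close> then give the same value with \<open>p\<close> and with
    \<open>G\<close>.\<close>
  have mean: "integral {-K..K} (\<lambda>x. h x * f x) = 0"
    if f: "smooth f" and sup: "\<And>x. x \<notin> {-K<..<K} \<Longrightarrow> f x = 0" and K: "K > 0" and f0: "integral {-K..K} f = 0" for f K
  proof -
    have fl: "loc_int f" by (rule loc_int_continuous[OF smooth_continuous[OF f]])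
    define \<phi> where "\<phi> = prim (-K) f"
    have ps: "smooth \<phi>" unfolding \<phi>_def by (rule smooth_primitive[OF f])
    have pd: "(\<phi> has_real_derivative f x) (at x)" for x
      unfolding \<phi>_def by (rule prim_deriv_continuous[OF smooth_continuous[OF f]])
    have p0: "\<phi> x = 0" if "x \<notin> {-K<..<K}" for x
    proof (cases "x \<le> -K")
      case True
      have "integral {x..-K} f = 0" using sup by (intro integral_unique has_integral_is_0) auto
      then show ?thesis using prim_diff[OF fl True, of "-K"] by (simp add: \<phi>_def)
    next
      case False
      then have x: "K \<le> x" using that by auto
      have "integral {K..x} f = 0" using sup by (intro integral_unique has_integral_is_0) auto
      then show ?thesis using prim_diff[OF fl x, of "-K"] prim_diff[OF fl, of "-K" K "-K"] f0 K by (simp add: \<phi>_def)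
    qed
    have tf: "test_fun \<phi>" unfolding test_fun_def
    proof
      show "\<exists>D::nat \<Rightarrow> real \<Rightarrow> real. D 0 = \<phi> \<and> (\<forall>n x. (D n has_real_derivative D (Suc n) x) (at x))"
        using ps unfolding smooth_def .
      have "\<phi> x = 0" if "\<bar>x\<bar> > K" for x by (rule p0) (use that in auto)
      then show "\<exists>c. \<forall>x. c < \<bar>x\<bar> \<longrightarrow> \<phi> x = 0" by blast
    qed
    have "(LINT x|lebesgue. p x * f x) = - (LINT x|lebesgue. g x * \<phi> x)" by (rule weak[OF tf pd])
    moreover have "(LINT x|lebesgue. p x * f x) = integral {-K..K} (\<lambda>x. p x * f x)"
      by (rule integral_compact_support[OF lm[OF pl f]]) (use sup in auto)
    moreover have "(LINT x|lebesgue. g x * \<phi> x) = integral {-K..K} (\<lambda>x. g x * \<phi> x)"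
      by (rule integral_compact_support[OF lm[OF gl ps]]) (use p0 in auto)
    ultimately have 1: "integral {-K..K} (\<lambda>x. p x * f x) = - integral {-K..K} (\<lambda>x. g x * \<phi> x)" by simp
    have "((\<lambda>x. g x * \<phi> x + G x * f x) has_integral (G K * \<phi> K - G (-K) * \<phi> (-K))) {-K..K}"
    proof (rule AC_loc_has_integral)
      show "AC_loc (\<lambda>x. G x * \<phi> x)" using AC_loc_C1[OF pd smooth_continuous[OF f]] by (rule AC_loc_mult[OF GA])
      show "AE x in lebesgue. ((\<lambda>x. G x * \<phi> x) has_vector_derivative g x * \<phi> x + G x * f x) (at x)"
        using Gd unfolding has_real_derivative_iff_has_vector_derivative[symmetric]
        by eventually_elim (auto intro!: derivative_eq_intros pd)
    qed (use K in auto)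
    then have "integral {-K..K} (\<lambda>x. g x * \<phi> x + G x * f x) = 0" using p0[of K] p0[of "-K"] by (simp add: integral_unique)
    then have 2: "integral {-K..K} (\<lambda>x. G x * f x) = - integral {-K..K} (\<lambda>x. g x * \<phi> x)"
      using loc_int_integrable[OF lm[OF gl ps]] loc_int_integrable[OF lm[OF Gl f]]
      by (simp add: Henstock_Kurzweil_Integration.integral_add)
    have "integral {-K..K} (\<lambda>x. h x * f x) = integral {-K..K} (\<lambda>x. p x * f x - G x * f x)"
      by (simp add: h_def algebra_simps)
    also have "\<dots> = 0"
      using loc_int_integrable[OF lm[OF pl f]] loc_int_integrable[OF lm[OF Gl f]] 1 2
      by (simp add: Henstock_Kurzweil_Integration.integral_diff)
    finally show ?thesis .
  qed
  define R where "R = integral {0..1} \<rho>"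
  \<comment> \<open>The only candidate for the constant value of \<open>h\<close>: its average
    against the fixed weight \<open>\<rho>\<close>.\<close>
  define k where "k = integral {0..1} (\<lambda>x. h x * \<rho> x) / R"
  have R: "R > 0"
  proof -
    have c: "continuous_on {0..1} \<rho>" by (rule smooth_continuous[OF rs])
    have "R \<ge> 0" unfolding R_def using bump_bounds(1) by (intro integral_nonneg integrable_continuous_real c) (auto simp: \<rho>_def)
    moreover have "R \<noteq> 0"
    proof
      assume "R = 0"
      then have "\<rho> (1/2) = 0"
        using integral_eq_0_iff[OF c] bump_bounds(1) unfolding R_def by (auto simp: \<rho>_def)
      then show False using bump_pos[of 1 "1/2" 0 1] by (simp add: \<rho>_def)
    qed
    ultimately show ?thesis by simp
  qed
  have restr: "integral {-K..K} f = integral {a..b} f" if "\<And>x. x \<notin> {a..b} \<Longrightarrow> f x = 0" "{a..b} \<subseteq> {-K..K}" for f :: "real \<Rightarrow> real" and a b K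
  proof -
    have "integral {-K..K} (\<lambda>x. if x \<in> {a..b} then f x else 0) = integral {a..b} f"
      unfolding integral_restrict_Int Int_absorb2[OF that(2)] ..
    moreover have "(\<lambda>x. if x \<in> {a..b} then f x else 0) = f" using that(1) by auto
    ultimately show ?thesis by simp
  qed
  have orth: "integral {a..b} (\<lambda>x. (h x - k) * \<psi> x) = 0" if ps: "smooth \<psi>" and sup: "\<And>x. x \<notin> {a<..<b} \<Longrightarrow> \<psi> x = 0" for \<psi> a b
  proof -
    \<comment> \<open>Large enough for \<open>(-K, K)\<close> to contain both the support of
      \<open>\<psi>\<close> and that of \<open>\<rho>\<close>; the coefficient \<open>c\<close>
      below subtracts the multiple of \<open>\<rho>\<close> that removes the mean of
      \<open>\<psi>\<close>.\<close>
    define K where "K = \<bar>a\<bar> + \<bar>b\<bar> + 2"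
    define c where "c = integral {a..b} \<psi> / R"
    define f where "f x = \<psi> x - c * \<rho> x" for x
    have fs: "smooth f" unfolding f_def by (rule smooth_diff_cmult[OF ps rs])
    have r0: "\<rho> x = 0" if "x \<notin> {0<..<1}" for x using bump_support[OF that] by (simp add: \<rho>_def)
    have sub: "{a..b} \<subseteq> {-K..K}" "{0..1} \<subseteq> {-K..K}" by (auto simp: K_def)
    have li: "f integrable_on {-K..K}" if "continuous_on UNIV f" for f :: "real \<Rightarrow> real"
      by (rule loc_int_integrable[OF loc_int_continuous[OF that]])
    have ip: "\<psi> integrable_on {-K..K}" "\<rho> integrable_on {-K..K}" using li smooth_continuous ps rs by blast+
    have ih: "(\<lambda>x. h x * \<psi> x) integrable_on {-K..K}" "(\<lambda>x. h x * \<rho> x) integrable_on {-K..K}"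
      using loc_int_integrable lm hl ps rs by blast+
    have rp: "integral {-K..K} \<psi> = integral {a..b} \<psi>" "integral {-K..K} \<rho> = R"
      "integral {-K..K} (\<lambda>x. h x * \<psi> x) = integral {a..b} (\<lambda>x. h x * \<psi> x)"
      "integral {-K..K} (\<lambda>x. h x * \<rho> x) = k * R"
    proof -
      have s': "\<psi> x = 0" if "x \<notin> {a..b}" for x by (rule sup) (use that in auto)
      have r': "\<rho> x = 0" if "x \<notin> {0..1}" for x by (rule r0) (use that in auto)
      show "integral {-K..K} \<psi> = integral {a..b} \<psi>" by (rule restr[OF s' sub(1)])
      show "integral {-K..K} \<rho> = R" unfolding R_def by (rule restr[OF r' sub(2)])
      show "integral {-K..K} (\<lambda>x. h x * \<psi> x) = integral {a..b} (\<lambda>x. h x * \<psi> x)"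
        by (rule restr[OF _ sub(1)], drule s', simp)
      have "integral {-K..K} (\<lambda>x. h x * \<rho> x) = integral {0..1} (\<lambda>x. h x * \<rho> x)"
        by (rule restr[OF _ sub(2)], drule r', simp)
      then show "integral {-K..K} (\<lambda>x. h x * \<rho> x) = k * R" using R by (simp add: k_def)
    qed
    have "integral {-K..K} (\<lambda>x. h x * f x) = 0"
    proof (rule mean[OF fs])
      show "f x = 0" if "x \<notin> {-K<..<K}" for x
      proof -
        have "x \<notin> {a<..<b}" "x \<notin> {0<..<1}" using that by (auto simp: K_def)
        then show ?thesis using sup r0 by (simp add: f_def)
      qed
      show "integral {-K..K} f = 0"
        unfolding f_def integral_diff_cmult[OF ip] rp using R by (simp add: c_def)
    qed (simp add: K_def)
    moreover have "(\<lambda>x. h x * f x) = (\<lambda>x. h x * \<psi> x - c * (h x * \<rho> x))" by (auto simp: f_def algebra_simps)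
    ultimately have "integral {a..b} (\<lambda>x. h x * \<psi> x) - c * (k * R) = 0"
      using integral_diff_cmult[OF ih, of c] rp by simp
    then have e: "integral {a..b} (\<lambda>x. h x * \<psi> x) = k * integral {a..b} \<psi>" using R by (simp add: c_def)
    have "integral {a..b} (\<lambda>x. (h x - k) * \<psi> x) = integral {a..b} (\<lambda>x. h x * \<psi> x - k * \<psi> x)" by (simp add: algebra_simps)
    also have "\<dots> = 0"
      using e integral_diff_cmult[OF loc_int_integrable[OF lm[OF hl ps]]
          loc_int_integrable[OF loc_int_continuous[OF smooth_continuous[OF ps]]], of a b k] by simp
    finally show ?thesis .
  qed
  have hk: "loc_int (\<lambda>x. h x - k)" by (intro loc_int_diff hl loc_int_continuous continuous_intros)
  have "AE x in lebesgue. h x - k = 0"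
  proof (rule AE_zero_of_integrals_zero[OF hk])
    fix a b :: real assume "a \<le> b"
    \<comment> \<open>Smooth bumps replace the indicator of the interval, which is not a test
      function; \<open>\<bar>h x - k\<bar>\<close> dominates all the products.\<close>
    have "(\<lambda>n. integral {a..b} (\<lambda>x. (h x - k) * bump a b n x)) \<longlonglongrightarrow> integral {a..b} (\<lambda>x. (h x - k) * indicator {a<..<b} x)"
    proof (rule dominated_convergence(2)[where h = "\<lambda>x. \<bar>h x - k\<bar>"])
      show "(\<lambda>x. (h x - k) * bump a b n x) integrable_on {a..b}" for n
        by (rule loc_int_integrable[OF lm[OF hk smooth_bump]])
      show "(\<lambda>x. \<bar>h x - k\<bar>) integrable_on {a..b}" using loc_int_integrable[OF loc_int_norm[OF hk]] by simp
      show "norm ((h x - k) * bump a b n x) \<le> \<bar>h x - k\<bar>" for n x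
        using bump_bounds[of a b n x] by (simp add: abs_mult mult_left_le)
      show "(\<lambda>n. (h x - k) * bump a b n x) \<longlonglongrightarrow> (h x - k) * indicator {a<..<b} x" for x
        by (intro tendsto_intros bump_tendsto)
    qed
    moreover have "integral {a..b} (\<lambda>x. (h x - k) * bump a b n x) = 0" for n
      by (rule orth[OF smooth_bump bump_support])
    moreover have "integral {a..b} (\<lambda>x. (h x - k) * indicator {a<..<b} x) = integral {a..b} (\<lambda>x. h x - k)"
      by (rule integral_spike[of "{a, b}"]) (auto simp: indicator_def)
    ultimately show "integral {a..b} (\<lambda>x. h x - k) = 0" by (simp add: LIMSEQ_const_iff)
  qed
  then have "AE x in lebesgue. p x = k + G x" by eventually_elim (simp add: h_def)
  moreover have "AC_loc (\<lambda>x. k + G x)" by (intro AC_loc_add AC_loc_const GA)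
  moreover have "AE x in lebesgue. ((\<lambda>x. k + G x) has_real_derivative g x) (at x)"
    using Gd by eventually_elim (auto intro!: derivative_eq_intros)
  ultimately show ?thesis using that[of "\<lambda>x. k + G x" g] g by blast
qed

subsection \<open>Cut-off functions adapted to the leading coefficient\<close>

text \<open>The exponent \<open>n + 2\<close> leaves a positive power in the derivative, so one
  formula holds on both sides of the kink and at the kink itself.\<close>

lemma max_power_deriv:
  "((\<lambda>y::real. (max 0 y) ^ (n + 2)) has_real_derivative real (n + 2) * (max 0 y) ^ (n + 1)) (at y)"
proof -
  consider "y > 0" | "y < 0" | "y = 0" by linarith
  then show ?thesis
  proof cases
    case 1
    have "((\<lambda>y::real. y ^ (n + 2)) has_real_derivative real (n + 2) * (max 0 y) ^ (n + 1)) (at y)"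
      using DERIV_pow[of "n + 2" y] 1 by simp
    then show ?thesis
      by (rule has_field_derivative_transform_within_open[where S = "{0<..}"]) (use 1 in auto)
  next
    case 2
    have "((\<lambda>y::real. 0) has_real_derivative real (n + 2) * (max 0 y) ^ (n + 1)) (at y)"
      using 2 by simp
    then show ?thesis
      by (rule has_field_derivative_transform_within_open[where S = "{..<0}"]) (use 2 in auto)
  next
    case 3
    have "((\<lambda>h. (max 0 (0 + h) ^ (n + 2) - max 0 0 ^ (n + 2)) / h) \<longlongrightarrow> 0) (at (0::real))"
    proof (rule Lim_null_comparison)
      show "\<forall>\<^sub>F h::real in at 0. norm ((max 0 (0 + h) ^ (n + 2) - max 0 0 ^ (n + 2)) / h) \<le> \<bar>h\<bar> ^ (n + 1)"
        by (intro always_eventually allI) (auto simp: max_def abs_mult mult_le_0_iff)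
      have "((\<lambda>h::real. \<bar>h\<bar> ^ (n + 1)) \<longlongrightarrow> \<bar>0\<bar> ^ (n + 1)) (at 0)" by (intro tendsto_intros)
      then show "((\<lambda>h::real. \<bar>h\<bar> ^ (n + 1)) \<longlongrightarrow> 0) (at 0)" by simp
    qed
    then show ?thesis unfolding DERIV_def 3 by simp
  qed
qed

text \<open>The third power gives two continuous derivatives, \<open>chi1\<close> and
  \<open>chi2\<close>, which suffices to differentiate p \<phi>' once. It is also the source of the
  lower bound 1/8 for \<open>\<bar>t\<bar> \<le> 1/2\<close>, as
  \<open>1 - t\<^sup>2 \<ge> 1/2\<close> there.\<close>

definition chi :: "real \<Rightarrow> real" where "chi t = (max 0 (1 - t\<^sup>2)) ^ 3"
definition chi1 :: "real \<Rightarrow> real" where "chi1 t = - 6 * t * (max 0 (1 - t\<^sup>2)) ^ 2"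
definition chi2 :: "real \<Rightarrow> real" where "chi2 t = - 6 * (max 0 (1 - t\<^sup>2)) ^ 2 + 24 * t\<^sup>2 * max 0 (1 - t\<^sup>2)"

lemma chi_deriv: "(chi has_real_derivative chi1 t) (at t)"
proof -
  have "((\<lambda>t. (max 0 (1 - t\<^sup>2)) ^ (1 + 2)) has_real_derivative (real (1 + 2) * (max 0 (1 - t\<^sup>2)) ^ (1 + 1)) * (- (2 * t))) (at t)"
    by (rule DERIV_chain2[OF max_power_deriv]) (auto intro!: derivative_eq_intros)
  then show ?thesis unfolding chi_def[abs_def] chi1_def by (simp add: numeral_3_eq_3 numeral_2_eq_2 algebra_simps)
qed

lemma chi1_deriv: "(chi1 has_real_derivative chi2 t) (at t)"
proof -
  have "((\<lambda>t. (max 0 (1 - t\<^sup>2)) ^ (0 + 2)) has_real_derivative (real (0 + 2) * (max 0 (1 - t\<^sup>2)) ^ (0 + 1)) * (- (2 * t))) (at t)"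
    by (rule DERIV_chain2[OF max_power_deriv]) (auto intro!: derivative_eq_intros)
  then have d: "((\<lambda>t. (max 0 (1 - t\<^sup>2))\<^sup>2) has_real_derivative (2 * max 0 (1 - t\<^sup>2)) * (- (2 * t))) (at t)"
    by (simp add: power2_eq_square)
  show ?thesis unfolding chi1_def[abs_def] chi2_def
    by (rule DERIV_cong[OF DERIV_mult[OF DERIV_cmult_Id d]]) (simp add: power2_eq_square algebra_simps)
qed

lemma chi2_continuous: "continuous_on A chi2"
  unfolding chi2_def[abs_def] by (intro continuous_intros)

lemma chi_zero: "\<bar>t\<bar> \<ge> 1 \<Longrightarrow> chi t = 0 \<and> chi1 t = 0 \<and> chi2 t = 0"
proof -
  assume "\<bar>t\<bar> \<ge> 1"
  then have "1 \<le> t\<^sup>2" using abs_le_square_iff[of 1 t] by simp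
  then show ?thesis by (simp add: chi_def chi1_def chi2_def)
qed

lemma chi_bounds: "0 \<le> chi t" "chi t \<le> 1" "\<bar>chi1 t\<bar> \<le> 6"
proof -
  have m: "0 \<le> max 0 (1 - t\<^sup>2)" "max 0 (1 - t\<^sup>2) \<le> 1" by auto
  show "0 \<le> chi t" "chi t \<le> 1" unfolding chi_def using m by (auto intro: power_le_one)
  show "\<bar>chi1 t\<bar> \<le> 6"
  proof (cases "\<bar>t\<bar> \<ge> 1")
    case True then show ?thesis using chi_zero by simp
  next
    case False
    have "\<bar>chi1 t\<bar> = 6 * (\<bar>t\<bar> * (max 0 (1 - t\<^sup>2))\<^sup>2)" by (simp add: chi1_def abs_mult)
    also have "\<dots> \<le> 6 * (1 * 1)" using False m by (intro mult_left_mono mult_mono power_le_one) auto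
    finally show ?thesis by simp
  qed
qed

lemma chi_half: "\<bar>t\<bar> \<le> 1 / 2 \<Longrightarrow> chi t \<ge> 1 / 8"
proof -
  assume "\<bar>t\<bar> \<le> 1 / 2"
  then have "t\<^sup>2 \<le> (1 / 2)\<^sup>2" using abs_le_square_iff[of t "1/2"] by simp
  then have "1 / 2 \<le> max 0 (1 - t\<^sup>2)" by (simp add: power2_eq_square)
  then have "(1/2)^3 \<le> (max 0 (1 - t\<^sup>2))^3" by (rule power_mono) simp
  then show ?thesis by (simp add: chi_def power3_eq_cube)
qed

lemma inverse_sqrt_shift_AC:
  fixes P :: "real \<Rightarrow> real"
  assumes P: "AC_loc P" and P0: "\<And>x. P x \<ge> 0" and e: "\<epsilon> > 0"
  shows "AC_loc (\<lambda>x. 1 / sqrt (P x + \<epsilon>))"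
proof (rule AC_loc_lipschitz_comp[OF P, where S = "{0..}" and h = "\<lambda>t. 1 / sqrt (t + \<epsilon>)"])
  show "range P \<subseteq> {0..}" using P0 by auto
  fix B :: real
  \<comment> \<open>The constant is the absolute value of the derivative at 0, its maximum on the
    half-line.\<close>
  have "norm (1 / sqrt (s + \<epsilon>) - 1 / sqrt (t + \<epsilon>)) \<le> 1 / (2 * \<epsilon> * sqrt \<epsilon>) * norm (s - t)" if "s \<in> {0..}" "t \<in> {0..}" for s t
  proof (rule field_differentiable_bound[of "{0..}" "\<lambda>t. 1 / sqrt (t + \<epsilon>)" "\<lambda>t. - 1 / (2 * (t + \<epsilon>) * sqrt (t + \<epsilon>))"])
    fix z :: real assume z: "z \<in> {0..}"
    show "((\<lambda>t. 1 / sqrt (t + \<epsilon>)) has_field_derivative - 1 / (2 * (z + \<epsilon>) * sqrt (z + \<epsilon>))) (at z within {0..})"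
      using z e by (auto intro!: derivative_eq_intros simp: field_simps power2_eq_square)
    have "2 * \<epsilon> * sqrt \<epsilon> \<le> 2 * (z + \<epsilon>) * sqrt (z + \<epsilon>)" using z e by (intro mult_mono) auto
    then show "norm (- 1 / (2 * (z + \<epsilon>) * sqrt (z + \<epsilon>))) \<le> 1 / (2 * \<epsilon> * sqrt \<epsilon>)"
      using z e by (simp add: frac_le)
  qed (use that in auto)
  then show "\<exists>C. \<forall>s\<in>{0..}. \<forall>t\<in>{0..}. \<bar>s\<bar> \<le> B \<longrightarrow> \<bar>t\<bar> \<le> B \<longrightarrow> norm (1 / sqrt (s + \<epsilon>) - 1 / sqrt (t + \<epsilon>)) \<le> C * \<bar>s - t\<bar>"
    by (intro exI[of _ "1 / (2 * \<epsilon> * sqrt \<epsilon>)"] ballI impI) simp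
qed

section \<open>Local square integrability and the construction of the cut-off\<close>

lemma L2_loc_mult_continuous:
  assumes "L2_loc f" "continuous_on UNIV c" shows "L2_loc (\<lambda>x. f x * c x)"
proof -
  have fm: "f \<in> borel_measurable lebesgue" using assms by (simp add: L2_loc_def)
  have cm: "c \<in> borel_measurable lebesgue" by (rule loc_int_imp_measurable[OF loc_int_continuous[OF assms(2)]])
  have "loc_int (\<lambda>x. (f x)\<^sup>2)" using assms unfolding L2_loc_def loc_int_def by blast
  then have "loc_int (\<lambda>x. (c x)\<^sup>2 * (f x)\<^sup>2)"
    by (rule loc_int_mult_continuous_real[OF continuous_on_power[OF assms(2)]])
  then have "loc_int (\<lambda>x. (f x * c x)\<^sup>2)" by (simp add: power_mult_distrib mult.commute)
  then show ?thesis unfolding L2_loc_def loc_int_def using borel_measurable_times[OF fm cm] by blast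
qed

lemma L2_loc_bound:
  assumes "f \<in> borel_measurable lebesgue" "L2_loc g" "AE x in lebesgue. \<bar>f x\<bar> \<le> \<bar>g x\<bar>"
  shows "L2_loc f"
  unfolding L2_loc_def set_integrable_def
proof (intro conjI allI assms(1))
  fix a b
  show "integrable lebesgue (\<lambda>x. indicat_real {a..b} x *\<^sub>R (f x)\<^sup>2)"
  proof (rule Bochner_Integration.integrable_bound)
    show "integrable lebesgue (\<lambda>x. indicat_real {a..b} x *\<^sub>R (g x)\<^sup>2)"
      using assms(2) unfolding L2_loc_def set_integrable_def by blast
    show "(\<lambda>x. indicat_real {a..b} x *\<^sub>R (f x)\<^sup>2) \<in> borel_measurable lebesgue"
      by (intro borel_measurable_scaleR borel_measurable_indicator borel_measurable_power assms(1)) simp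
    show "AE x in lebesgue. norm (indicat_real {a..b} x *\<^sub>R (f x)\<^sup>2) \<le> norm (indicat_real {a..b} x *\<^sub>R (g x)\<^sup>2)"
      using assms(3) by eventually_elim (auto simp: indicator_def abs_le_square_iff)
  qed
qed

lemma L2_loc_add: "L2_loc f \<Longrightarrow> L2_loc g \<Longrightarrow> L2_loc (\<lambda>x. f x + g x)"
proof -
  assume f: "L2_loc f" and g: "L2_loc g"
  have m: "f \<in> borel_measurable lebesgue" "g \<in> borel_measurable lebesgue" using f g by (auto simp: L2_loc_def)
  have l: "loc_int (\<lambda>x. (f x)\<^sup>2)" "loc_int (\<lambda>x. (g x)\<^sup>2)" using f g unfolding L2_loc_def loc_int_def by blast+
  have "loc_int (\<lambda>x. (f x + g x)\<^sup>2)"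
  proof (rule loc_int_bound)
    show "loc_int (\<lambda>x. 2 * (f x)\<^sup>2 + 2 * (g x)\<^sup>2)"
      by (intro loc_int_add loc_int_mult_continuous_real l continuous_intros)
    show "norm ((f x + g x)\<^sup>2) \<le> 2 * (f x)\<^sup>2 + 2 * (g x)\<^sup>2" for x
    proof -
      have "(f x + g x)\<^sup>2 \<le> 2 * (f x)\<^sup>2 + 2 * (g x)\<^sup>2"
        using zero_le_power2[of "f x - g x"] unfolding power2_sum power2_diff by linarith
      then show ?thesis by simp
    qed
  qed (use m in measurable)
  then show ?thesis unfolding L2_loc_def loc_int_def using m by (auto intro: borel_measurable_add)
qed

lemma L2_loc_continuous: "continuous_on UNIV f \<Longrightarrow> L2_loc f"
  unfolding L2_loc_def
  using loc_int_imp_measurable[OF loc_int_continuous] loc_int_continuous[of "\<lambda>x. (f x)\<^sup>2"]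
  by (auto simp: loc_int_def intro: continuous_on_power)

text \<open>The cut-off is \<open>\<phi> = chi (\<Phi> / N)\<close> with \<open>\<Phi>' = 1 / sqrt (P + \<epsilon>)\<close>. The shift by \<open>\<epsilon>\<close> is needed
  because the continuous representative \<open>P\<close> of \<open>p\<close> may vanish on a null set.\<close>

theorem cutoff_exists:
  fixes P :: "real \<Rightarrow> real"
  assumes P: "AC_loc P" and P0: "\<And>x. P x \<ge> 0" and g: "L2_loc g"
    and Pd: "AE x in lebesgue. (P has_real_derivative g x) (at x)"
    and e: "\<epsilon> > 0" and N: "N > 0"
    and M: "integral {0..M} (\<lambda>x. 1 / sqrt (P x + \<epsilon>)) \<ge> N" "integral {-M..0} (\<lambda>x. 1 / sqrt (P x + \<epsilon>)) \<ge> N" "M \<ge> 0"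
  obtains \<phi> \<phi>' \<kappa> where "\<And>x. (\<phi> has_real_derivative \<phi>' x) (at x)" "continuous_on UNIV \<phi>'"
    "AC_loc (\<lambda>x. P x * \<phi>' x)" "AE x in lebesgue. ((\<lambda>x. P x * \<phi>' x) has_real_derivative \<kappa> x) (at x)"
    "L2_loc \<kappa>" "\<And>x. \<bar>x\<bar> > M \<Longrightarrow> \<phi> x = 0 \<and> \<phi>' x = 0 \<and> \<kappa> x = 0"
    "\<And>x. 0 \<le> \<phi> x \<and> \<phi> x \<le> 1" "\<And>x. P x * (\<phi>' x)\<^sup>2 \<le> 36 / N\<^sup>2"
    "\<And>x R. \<lbrakk>\<bar>x\<bar> \<le> R; 2 * integral {-R..R} (\<lambda>x. 1 / sqrt (P x + \<epsilon>)) \<le> N\<rbrakk> \<Longrightarrow> \<phi> x \<ge> 1 / 8"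
proof -
  define k where "k x = 1 / sqrt (P x + \<epsilon>)" for x
  have Pe: "P x + \<epsilon> > 0" for x using P0[of x] e by linarith
  have k0: "k x > 0" for x using Pe[of x] by (simp add: k_def)
  have kA: "AC_loc k" unfolding k_def by (rule inverse_sqrt_shift_AC[OF P P0 e])
  have kc: "continuous_on A k" for A by (rule AC_loc_continuous[OF kA])
  have kl: "loc_int k" by (rule loc_int_continuous[OF kc])
  \<comment> \<open>This makes the bound \<open>36 / N\<^sup>2\<close> uniform in \<open>x\<close>:
    the derivative of the cut-off is \<open>chi1\<close> times \<open>k / N\<close>, and
    \<open>chi1\<close> is at most 6 in absolute value.\<close>
  have Pk: "P x * (k x)\<^sup>2 \<le> 1" for x using Pe[of x] P0[of x] e by (simp add: k_def power_divide)
  define \<Phi> where "\<Phi> = prim 0 k"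
  have \<Phi>d: "(\<Phi> has_real_derivative k x) (at x)" for x unfolding \<Phi>_def by (rule prim_deriv_continuous[OF kc])
  have \<Phi>i: "\<Phi> y - \<Phi> x = integral {x..y} k" if "x \<le> y" for x y unfolding \<Phi>_def by (rule prim_diff[OF kl that])
  have ki: "integral {x..y} k \<ge> 0" for x y using k0 by (intro integral_nonneg loc_int_integrable kl) (simp add: less_imp_le)
  have \<Phi>mono: "\<Phi> x \<le> \<Phi> y" if "x \<le> y" for x y using \<Phi>i[OF that] ki[of x y] by simp
  have \<Phi>0: "\<Phi> 0 = 0" by (simp add: \<Phi>_def)
  have \<Phi>M: "\<Phi> M \<ge> N" "\<Phi> (-M) \<le> -N" using \<Phi>i[of 0 M] \<Phi>i[of "-M" 0] M \<Phi>0 unfolding k_def by auto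
  have \<Phi>A: "AC_loc \<Phi>" by (rule AC_loc_C1[OF \<Phi>d kc])
  have \<Phi>c: "continuous_on A \<Phi>" for A by (rule AC_loc_continuous[OF \<Phi>A])
  define \<phi> where "\<phi> x = chi (\<Phi> x / N)" for x
  define \<phi>' where "\<phi>' x = chi1 (\<Phi> x / N) * k x / N" for x
  define k' where "k' x = - 1 / (2 * (P x + \<epsilon>) * sqrt (P x + \<epsilon>)) * g x" for x
  define \<phi>'' where "\<phi>'' x = chi2 (\<Phi> x / N) * (k x)\<^sup>2 / N\<^sup>2 + chi1 (\<Phi> x / N) * k' x / N" for x
  define \<kappa> where "\<kappa> x = g x * \<phi>' x + P x * \<phi>'' x" for x
  have d1: "((\<lambda>x. chi1 (\<Phi> x / N)) has_real_derivative chi2 (\<Phi> x / N) * (k x / N)) (at x)" for x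
    by (rule DERIV_chain2[OF chi1_deriv DERIV_cdivide[OF \<Phi>d]])
  have c1: "continuous_on A (\<lambda>x. chi1 (\<Phi> x / N))" for A
    using d1 by (meson DERIV_isCont continuous_at_imp_continuous_on)
  have c2: "continuous_on A (\<lambda>x. chi2 (\<Phi> x / N))" for A
    by (rule continuous_on_compose2[OF chi2_continuous[of UNIV]]) (use N in \<open>auto intro!: continuous_intros \<Phi>c\<close>)
  have Pc: "continuous_on A P" for A by (rule AC_loc_continuous[OF P])
  have A1: "AC_loc (\<lambda>x. chi1 (\<Phi> x / N))"
    by (rule AC_loc_C1[OF d1]) (use N in \<open>auto intro!: continuous_intros c2 kc\<close>)
  have kd: "AE x in lebesgue. (k has_real_derivative k' x) (at x)"
    using Pd
  proof eventually_elim
    case (elim x)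
    then show ?case unfolding k_def[abs_def] k'_def using Pe[of x]
      by (auto intro!: derivative_eq_intros simp: field_simps power2_eq_square)
  qed
  have eqA: "(\<lambda>x. P x * \<phi>' x) = (\<lambda>x. (1 / N) * (P x * (chi1 (\<Phi> x / N) * k x)))" by (auto simp: \<phi>'_def)
  show ?thesis
  proof (rule that)
    show "(\<phi> has_real_derivative \<phi>' x) (at x)" for x
      unfolding \<phi>_def[abs_def] \<phi>'_def
      using DERIV_chain2[OF chi_deriv DERIV_cdivide[OF \<Phi>d]] by simp
    show "continuous_on UNIV \<phi>'" unfolding \<phi>'_def[abs_def] using N by (intro continuous_intros c1 kc) auto
    show "AC_loc (\<lambda>x. P x * \<phi>' x)" unfolding eqA
      by (rule AC_loc_linear[OF _ bounded_linear_mult_right]) (intro AC_loc_mult P A1 kA)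
    show "AE x in lebesgue. ((\<lambda>x. P x * \<phi>' x) has_real_derivative \<kappa> x) (at x)"
      using Pd kd
    proof eventually_elim
      case (elim x)
      have "(\<phi>' has_real_derivative \<phi>'' x) (at x)" unfolding \<phi>'_def[abs_def] \<phi>''_def
        using N by (auto intro!: derivative_eq_intros d1 elim simp: field_simps power2_eq_square)
      then show ?case unfolding \<kappa>_def using elim by (auto intro!: derivative_eq_intros)
    qed
    \<comment> \<open>As \<open>g\<close> is only in \<open>L2_loc\<close>, all terms containing it
      are collected as \<open>g\<close> times a continuous function; the remainder is
      continuous.\<close>
    have "\<kappa> = (\<lambda>x. g x * (\<phi>' x + P x * (chi1 (\<Phi> x / N) * (- 1 / (2 * (P x + \<epsilon>) * sqrt (P x + \<epsilon>))) / N))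
        + P x * (chi2 (\<Phi> x / N) * (k x)\<^sup>2 / N\<^sup>2))"
      by (auto simp: \<kappa>_def \<phi>''_def k'_def algebra_simps)
    moreover have "L2_loc \<dots>"
    proof (rule L2_loc_add[OF L2_loc_mult_continuous[OF g] L2_loc_continuous])
      have nz: "2 * (P x + \<epsilon>) * sqrt (P x + \<epsilon>) \<noteq> 0" for x
        using Pe[of x] by (intro less_imp_neq[THEN not_sym] mult_pos_pos) auto
      show "continuous_on UNIV (\<lambda>x. \<phi>' x + P x * (chi1 (\<Phi> x / N) * (- 1 / (2 * (P x + \<epsilon>) * sqrt (P x + \<epsilon>))) / N))"
        unfolding \<phi>'_def[abs_def] using N by (intro continuous_intros c1 kc Pc ballI nz) auto
      show "continuous_on UNIV (\<lambda>x. P x * (chi2 (\<Phi> x / N) * (k x)\<^sup>2 / N\<^sup>2))"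
        using N by (intro continuous_intros c2 kc Pc) auto
    qed
    ultimately show "L2_loc \<kappa>" by simp
    show "\<phi> x = 0 \<and> \<phi>' x = 0 \<and> \<kappa> x = 0" if "\<bar>x\<bar> > M" for x
    proof -
      have "\<bar>\<Phi> x\<bar> \<ge> N"
      proof (cases "x > M")
        case True
        then show ?thesis using \<Phi>M(1) \<Phi>mono[of M x] by linarith
      next
        case False
        then have "x \<le> -M" using that by auto
        then show ?thesis using \<Phi>M(2) \<Phi>mono[of x "-M"] by linarith
      qed
      then have "\<bar>\<Phi> x / N\<bar> \<ge> 1" using N by (simp add: abs_divide le_divide_eq)
      from chi_zero[OF this] show ?thesis by (simp add: \<phi>_def \<phi>'_def \<kappa>_def \<phi>''_def)
    qed
    show "0 \<le> \<phi> x \<and> \<phi> x \<le> 1" for x using chi_bounds by (simp add: \<phi>_def)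
    show "P x * (\<phi>' x)\<^sup>2 \<le> 36 / N\<^sup>2" for x
    proof -
      have "(chi1 (\<Phi> x / N))\<^sup>2 \<le> 6\<^sup>2" using chi_bounds(3)[of "\<Phi> x / N"] abs_le_square_iff[of "chi1 (\<Phi> x / N)" 6] by simp
      then have "(chi1 (\<Phi> x / N))\<^sup>2 * (P x * (k x)\<^sup>2) \<le> 36 * 1" using Pk[of x] P0[of x] by (intro mult_mono) auto
      moreover have "P x * (\<phi>' x)\<^sup>2 = (chi1 (\<Phi> x / N))\<^sup>2 * (P x * (k x)\<^sup>2) / N\<^sup>2"
        by (simp add: \<phi>'_def power_mult_distrib power_divide)
      ultimately show ?thesis using N by (simp add: divide_right_mono)
    qed
    show "\<phi> x \<ge> 1 / 8" if x: "\<bar>x\<bar> \<le> R" and RN: "2 * integral {-R..R} (\<lambda>x. 1 / sqrt (P x + \<epsilon>)) \<le> N" for x R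
    proof -
      \<comment> \<open>Since \<open>\<Phi> 0 = 0\<close> lies between \<open>\<Phi> (-R)\<close>
        and \<open>\<Phi> R\<close>, their difference bounds \<open>\<bar>\<Phi> x\<bar>\<close>,
        which keeps \<open>\<Phi> x / N\<close> in the range where \<open>chi\<close> is at least
        1/8.\<close>
      have R: "\<Phi> R - \<Phi> (-R) = integral {-R..R} k" using \<Phi>i[of "-R" R] x by simp
      have "\<Phi> (-R) \<le> \<Phi> x" "\<Phi> x \<le> \<Phi> R" "\<Phi> (-R) \<le> 0" "0 \<le> \<Phi> R"
        using \<Phi>mono[of "-R" x] \<Phi>mono[of x R] \<Phi>mono[of "-R" 0] \<Phi>mono[of 0 R] x \<Phi>0 by auto
      then have "2 * \<bar>\<Phi> x\<bar> \<le> N" using R RN unfolding k_def[symmetric] by linarith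
      then have "\<bar>\<Phi> x / N\<bar> \<le> 1 / 2" using N by (simp add: abs_divide divide_le_eq)
      then show ?thesis unfolding \<phi>_def by (rule chi_half)
    qed
  qed
qed

subsection \<open>The kernel of the shifted maximal operator\<close>

lemma L2_local:
  fixes c :: "real \<Rightarrow> complex"
  assumes F: "L2_loc F" and c: "continuous_on UNIV c" and z: "\<And>x. \<bar>x\<bar> > M \<Longrightarrow> F x = 0"
  shows "L2 (\<lambda>x. of_real (F x) * c x)"
proof (rule L2_bound[where g = "\<lambda>x. indicat_real {-M..M} x *\<^sub>R (F x * cmod (c x))\<^sup>2"])
  have "F \<in> borel_measurable lebesgue" using F by (simp add: L2_loc_def)
  moreover have "c \<in> borel_measurable lebesgue" by (rule loc_int_imp_measurable[OF loc_int_continuous[OF c]])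
  ultimately show "(\<lambda>x. of_real (F x) * c x) \<in> borel_measurable lebesgue" by measurable
  have "L2_loc (\<lambda>x. F x * cmod (c x))" by (intro L2_loc_mult_continuous F continuous_intros c)
  then show "integrable lebesgue (\<lambda>x. indicat_real {-M..M} x *\<^sub>R (F x * cmod (c x))\<^sup>2)"
    unfolding L2_loc_def set_integrable_def by blast
  show "AE x in lebesgue. (cmod (of_real (F x) * c x))\<^sup>2 \<le> indicat_real {-M..M} x *\<^sub>R (F x * cmod (c x))\<^sup>2"
  proof (intro AE_I2)
    fix x
    show "(cmod (of_real (F x) * c x))\<^sup>2 \<le> indicat_real {-M..M} x *\<^sub>R (F x * cmod (c x))\<^sup>2"
    proof (cases "\<bar>x\<bar> > M")
      case True then show ?thesis using z by simp
    next
      case False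
      then have "x \<in> {-M..M}" by auto
      then show ?thesis by (simp add: norm_mult power_mult_distrib)
    qed
  qed
qed

lemma L2_mult_bounded:
  assumes v: "L2 v" and p: "continuous_on UNIV \<phi>" "\<And>x. \<bar>\<phi> x\<bar> \<le> 1"
  shows "L2 (\<lambda>x. of_real (\<phi> x) * v x)"
proof (rule L2_bound[OF _ L2_integrable[OF v]])
  have "\<phi> \<in> borel_measurable lebesgue" by (rule loc_int_imp_measurable[OF loc_int_continuous[OF p(1)]])
  then show "(\<lambda>x. of_real (\<phi> x) * v x) \<in> borel_measurable lebesgue" using L2_measurable[OF v] by measurable
  show "AE x in lebesgue. (cmod (of_real (\<phi> x) * v x))\<^sup>2 \<le> (cmod (v x))\<^sup>2"
    using p(2) by (intro AE_I2) (simp add: norm_mult power_mult_distrib mult_left_le_one_le abs_square_le_1)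
qed

context quasi_system
begin

text \<open>\<open>\<pi>\<close> plays the role of p \<phi>' in an absolutely continuous version,
  with derivative \<open>\<kappa>\<close>; it is tied to \<open>\<phi>'\<close> only almost
  everywhere, as p is. Accordingly \<open>\<beta> * \<pi>\<^sup>2\<close> is p \<phi>'^2, bounded by
  \<open>B\<close>, and \<open>Re \<alpha> * \<pi>\<close> is Q \<phi>'.\<close>

definition admissible_cutoff :: "real \<Rightarrow> (real \<Rightarrow> real) \<Rightarrow> (real \<Rightarrow> real) \<Rightarrow> (real \<Rightarrow> real) \<Rightarrow> (real \<Rightarrow> real) \<Rightarrow> real \<Rightarrow> bool" where
  "admissible_cutoff B \<phi> \<phi>' \<pi> \<kappa> M \<longleftrightarrow>
    (\<forall>x. (\<phi> has_real_derivative \<phi>' x) (at x)) \<and> continuous_on UNIV \<phi>' \<and>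
    (AE x in lebesgue. \<phi>' x = \<beta> x * \<pi> x) \<and>
    AC_loc \<pi> \<and> (AE x in lebesgue. (\<pi> has_real_derivative \<kappa> x) (at x)) \<and> L2_loc \<kappa> \<and>
    L2_loc (\<lambda>x. Re (\<alpha> x) * \<pi> x) \<and>
    (\<forall>x. \<bar>x\<bar> > M \<longrightarrow> \<phi> x = 0 \<and> \<phi>' x = 0 \<and> \<pi> x = 0 \<and> \<kappa> x = 0) \<and>
    (\<forall>x. 0 \<le> \<phi> x \<and> \<phi> x \<le> 1) \<and> (AE x in lebesgue. \<beta> x * (\<pi> x)\<^sup>2 \<le> B)"

text \<open>Up to the exact derivative of \<open>\<phi> * \<pi> * |v|\<^sup>2\<close>, the quadratic form of \<open>\<phi> v\<close> equals
  \<open>\<phi>\<^sup>2 Re (g cnj v) + \<beta> \<pi>\<^sup>2 |v|\<^sup>2\<close>.\<close>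

theorem cutoff_energy:
  assumes v: "qsol \<alpha> \<beta> \<tau> g v v1" and Lv: "L2 v" and Lg: "L2 g"
    and adm: "admissible_cutoff B \<phi> \<phi>' \<pi> \<kappa> M"
  shows "\<exists>f w1. qsol \<alpha> \<beta> \<tau> f (\<lambda>x. of_real (\<phi> x) * v x) w1 \<and> L2 f \<and>
    Re (ip f (\<lambda>x. of_real (\<phi> x) * v x)) \<le> Re (ip (\<lambda>x. of_real (\<phi> x) * g x) (\<lambda>x. of_real (\<phi> x) * v x)) + B * nrm2 v"
proof -
  have pd: "\<And>x. (\<phi> has_real_derivative \<phi>' x) (at x)" and p'c: "continuous_on UNIV \<phi>'"
    and bp: "AE x in lebesgue. \<phi>' x = \<beta> x * \<pi> x"
    and piA: "AC_loc \<pi>" and pid: "AE x in lebesgue. (\<pi> has_real_derivative \<kappa> x) (at x)" and kL: "L2_loc \<kappa>"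
    and al: "L2_loc (\<lambda>x. Re (\<alpha> x) * \<pi> x)"
    and sup: "\<And>x. \<bar>x\<bar> > M \<Longrightarrow> \<phi> x = 0 \<and> \<phi>' x = 0 \<and> \<pi> x = 0 \<and> \<kappa> x = 0"
    and p01: "\<And>x. 0 \<le> \<phi> x \<and> \<phi> x \<le> 1" and bB: "AE x in lebesgue. \<beta> x * (\<pi> x)\<^sup>2 \<le> B"
    using adm unfolding admissible_cutoff_def by blast+
  have pA: "AC_loc \<phi>" by (rule AC_loc_C1[OF pd p'c])
  have pc: "continuous_on UNIV \<phi>" by (rule AC_loc_continuous[OF pA])
  have pb: "\<bar>\<phi> x\<bar> \<le> 1" for x using p01[of x] by simp
  have vc: "continuous_on UNIV v" "continuous_on UNIV v1" using qsolD(3,4)[OF v] by blast+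
  define w where "w x = of_real (\<phi> x) * v x" for x
  \<comment> \<open>The quasi-derivative of \<open>\<phi> v\<close>: the relation
    \<open>\<phi>' = \<beta> \<pi>\<close> turns \<open>\<phi>' v\<close> into \<beta> times
    \<open>\<pi> v\<close>. In \<open>f\<close> below, the contributions of
    \<open>cnj \<alpha>\<close> and of \<alpha> combine to twice the real part; what is left of r is
    contained in \<open>v1\<close>.\<close>
  define w1 where "w1 x = of_real (\<phi> x) * v1 x + of_real (\<pi> x) * v x" for x
  define f where "f x = of_real (\<phi> x) * g x - of_real (\<kappa> x) * v x - 2 * (of_real (\<phi>' x) * v1 x)
     - 2 * (of_real (Re (\<alpha> x) * \<pi> x) * v x)" for x
  have Lf: "L2 f" unfolding f_def
    by (intro L2_diff L2_cmult L2_mult_bounded[OF Lg pc pb] L2_local[OF kL vc(1), of M]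
        L2_local[OF L2_loc_continuous[OF p'c] vc(2), of M] L2_local[OF al vc(1), of M]) (use sup in auto)
  have Lw: "L2 w" unfolding w_def by (rule L2_mult_bounded[OF Lv pc pb])
  have Lpg: "L2 (\<lambda>x. of_real (\<phi> x) * g x)" by (rule L2_mult_bounded[OF Lg pc pb])
  have cA: "AC_loc (\<lambda>x. complex_of_real (\<phi> x))" "AC_loc (\<lambda>x. complex_of_real (\<pi> x))"
    using AC_loc_linear[OF pA bounded_linear_of_real] AC_loc_linear[OF piA bounded_linear_of_real] by auto
  have cpd: "((\<lambda>x. complex_of_real (\<phi> x)) has_vector_derivative of_real (\<phi>' x)) (at x)" for x
    using bounded_linear.has_vector_derivative[OF bounded_linear_of_real pd[unfolded has_real_derivative_iff_has_vector_derivative]] .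
  have cpid: "AE x in lebesgue. ((\<lambda>x. complex_of_real (\<pi> x)) has_vector_derivative of_real (\<kappa> x)) (at x)"
    using pid unfolding has_real_derivative_iff_has_vector_derivative
    by eventually_elim (rule bounded_linear.has_vector_derivative[OF bounded_linear_of_real])
  have alpha2: "2 * complex_of_real (Re z) = z + cnj z" for z by (simp add: complex_eq_iff)
  have q: "qsol \<alpha> \<beta> \<tau> f w w1"
    unfolding qsol_def
  proof (intro conjI)
    show "AC_loc w" unfolding w_def by (intro AC_loc_mult cA qsolD(1)[OF v])
    show "AC_loc w1" unfolding w1_def by (intro AC_loc_add AC_loc_mult cA qsolD(1,2)[OF v])
    show "AE x in lebesgue. (w has_vector_derivative \<alpha> x * w x + of_real (\<beta> x) * w1 x) (at x)"
      using qsolD(5)[OF v] bp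
    proof eventually_elim
      case (elim x)
      show ?case unfolding w_def w1_def
        by (rule has_vector_derivative_eq_rhs[OF has_vector_derivative_mult[OF cpd elim(1)]])
          (simp add: elim(2) algebra_simps)
    qed
    show "AE x in lebesgue. (w1 has_vector_derivative - f x - cnj (\<alpha> x) * w1 x - of_real (\<tau> x) * w x) (at x)"
      using qsolD(5)[OF v] qsolD(6)[OF v] bp cpid
    proof eventually_elim
      case (elim x)
      have "f x = of_real (\<phi> x) * g x - of_real (\<kappa> x) * v x - 2 * (of_real (\<phi>' x) * v1 x) - (\<alpha> x + cnj (\<alpha> x)) * of_real (\<pi> x) * v x"
        unfolding f_def alpha2[symmetric] by simp
      then show ?case unfolding w1_def w_def
        by (intro has_vector_derivative_eq_rhs[OF has_vector_derivative_add[OF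
              has_vector_derivative_mult[OF cpd elim(2)] has_vector_derivative_mult[OF elim(4) elim(1)]]])
          (simp add: elim(3) algebra_simps)
    qed
  qed
  \<comment> \<open>The product \<open>\<phi> \<pi>\<close> carries the Lagrange terms:
    \<open>F\<close> is the derivative of \<open>- \<Theta>\<close>, and \<open>\<Theta>\<close>
    vanishes outside the support of the cut-off, so \<open>F\<close> has integral zero.\<close>
  define \<Theta> where "\<Theta> x = \<phi> x * \<pi> x * Re (v x * cnj (v x))" for x
  define F where "F x = Re (f x * cnj (w x)) - Re ((of_real (\<phi> x) * g x) * cnj (w x)) - \<beta> x * (\<pi> x)\<^sup>2 * (cmod (v x))\<^sup>2" for x
  have TA: "AC_loc (\<lambda>x. - \<Theta> x)" unfolding \<Theta>_def
    by (intro AC_loc_linear[OF _ bounded_linear_minus[OF bounded_linear_ident]] AC_loc_mult pA piA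
        AC_loc_linear[OF _ bounded_linear_Re] AC_loc_linear[OF _ bounded_linear_cnj] qsolD(1)[OF v])
  have Td: "AE x in lebesgue. ((\<lambda>x. - \<Theta> x) has_vector_derivative F x) (at x)"
    using qsolD(5)[OF v] bp pid
  proof eventually_elim
    case (elim x)
    have vv: "((\<lambda>x. Re (v x * cnj (v x))) has_real_derivative
        Re (v x * cnj (\<alpha> x * v x + of_real (\<beta> x) * v1 x) + (\<alpha> x * v x + of_real (\<beta> x) * v1 x) * cnj (v x))) (at x)"
      unfolding has_real_derivative_iff_has_vector_derivative
      by (rule bounded_linear.has_vector_derivative[OF bounded_linear_Re has_vector_derivative_mult[OF elim(1)
            bounded_linear.has_vector_derivative[OF bounded_linear_cnj elim(1)]]])
    have "((\<lambda>x. - \<Theta> x) has_real_derivative F x) (at x)" unfolding \<Theta>_def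
      by (rule DERIV_cong[OF DERIV_minus[OF DERIV_mult[OF DERIV_mult[OF pd elim(3)] vv]]])
        (unfold F_def f_def w_def cmod_power2, simp add: elim(2) power2_eq_square algebra_simps)
    then show ?case by (simp add: has_real_derivative_iff_has_vector_derivative)
  qed
  have bm: "\<beta> \<in> borel_measurable lebesgue" by (rule loc_int_imp_measurable[OF b])
  have pim: "\<pi> \<in> borel_measurable lebesgue"
    by (rule loc_int_imp_measurable[OF loc_int_continuous[OF AC_loc_continuous[OF piA]]])
  \<comment> \<open>Almost everywhere \<open>\<beta> \<pi>\<^sup>2\<close> equals
    \<open>\<phi>' \<pi>\<close>, which makes the integrand comparable with a product of two
    compactly supported \<open>L2\<close> functions.\<close>
  have i3: "integrable lebesgue (\<lambda>x. \<beta> x * (\<pi> x)\<^sup>2 * (cmod (v x))\<^sup>2)"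
  proof (rule Bochner_Integration.integrable_bound[where f = "\<lambda>x. of_real (\<phi>' x) * v x * cnj (of_real (\<pi> x) * v x)"])
    show "integrable lebesgue (\<lambda>x. of_real (\<phi>' x) * v x * cnj (of_real (\<pi> x) * v x))"
      by (intro L2_mult_integrable L2_local[OF L2_loc_continuous[OF p'c] vc(1), of M]
          L2_local[OF L2_loc_continuous[OF AC_loc_continuous[OF piA]] vc(1), of M]) (use sup in auto)
    show "(\<lambda>x. \<beta> x * (\<pi> x)\<^sup>2 * (cmod (v x))\<^sup>2) \<in> borel_measurable lebesgue"
      using bm pim L2_measurable[OF Lv] by measurable
    show "AE x in lebesgue. norm (\<beta> x * (\<pi> x)\<^sup>2 * (cmod (v x))\<^sup>2) \<le> norm (of_real (\<phi>' x) * v x * cnj (of_real (\<pi> x) * v x))"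
      using bp
    proof eventually_elim
      case (elim x)
      have "norm (\<beta> x * (\<pi> x)\<^sup>2 * (cmod (v x))\<^sup>2) = \<bar>\<beta> x * \<pi> x\<bar> * \<bar>\<pi> x\<bar> * (cmod (v x))\<^sup>2"
        by (simp add: abs_mult power2_eq_square)
      also have "\<dots> = norm (of_real (\<phi>' x) * v x * cnj (of_real (\<pi> x) * v x))"
        unfolding elim[symmetric] by (simp add: norm_mult power2_eq_square)
      finally show ?case by simp
    qed
  qed
  have i1: "integrable lebesgue (\<lambda>x. Re (f x * cnj (w x)))" by (intro integrable_Re L2_mult_integrable Lf Lw)
  have i2: "integrable lebesgue (\<lambda>x. Re ((of_real (\<phi> x) * g x) * cnj (w x)))" by (intro integrable_Re L2_mult_integrable Lpg Lw)
  have iF: "integrable lebesgue F" unfolding F_def by (intro Bochner_Integration.integrable_diff i1 i2 i3)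
  have "(\<lambda>n. integral {- real n..real n} F) \<longlonglongrightarrow> 0"
  proof (rule tendsto_eventually)
    obtain n0 :: nat where n0: "M < real n0" using reals_Archimedean2 by blast
    show "\<forall>\<^sub>F n in sequentially. integral {- real n..real n} F = 0"
    proof (rule eventually_sequentiallyI[of n0])
      fix n assume n: "n \<ge> n0"
      have "\<Theta> (real n) = 0" "\<Theta> (- real n) = 0" using sup[of "real n"] sup[of "- real n"] n n0 by (auto simp: \<Theta>_def)
      then show "integral {- real n..real n} F = 0"
        using AC_loc_has_integral[OF TA Td, of "- real n" "real n"] by (simp add: integral_unique)
    qed
  qed
  then have "(LINT x|lebesgue. F x) = 0"
    using LIMSEQ_unique[OF integral_tendsto_LINT[OF iF]] by blast
  then have "(LINT x|lebesgue. Re (f x * cnj (w x))) = (LINT x|lebesgue. Re ((of_real (\<phi> x) * g x) * cnj (w x)))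
      + (LINT x|lebesgue. \<beta> x * (\<pi> x)\<^sup>2 * (cmod (v x))\<^sup>2)"
    unfolding F_def using i1 i2 i3 by simp
  also have "(LINT x|lebesgue. Re (f x * cnj (w x))) = Re (ip f w)"
    unfolding ip_def by (rule integral_Re[OF L2_mult_integrable[OF Lf Lw]])
  also have "(LINT x|lebesgue. Re ((of_real (\<phi> x) * g x) * cnj (w x))) = Re (ip (\<lambda>x. of_real (\<phi> x) * g x) w)"
    unfolding ip_def by (rule integral_Re[OF L2_mult_integrable[OF Lpg Lw]])
  also have "(LINT x|lebesgue. \<beta> x * (\<pi> x)\<^sup>2 * (cmod (v x))\<^sup>2) \<le> (LINT x|lebesgue. B * (cmod (v x))\<^sup>2)"
  proof (rule integral_mono_AE[OF i3])
    show "integrable lebesgue (\<lambda>x. B * (cmod (v x))\<^sup>2)" using L2_integrable[OF Lv] by simp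
    show "AE x in lebesgue. \<beta> x * (\<pi> x)\<^sup>2 * (cmod (v x))\<^sup>2 \<le> B * (cmod (v x))\<^sup>2"
      using bB by eventually_elim (simp add: mult_right_mono)
  qed
  also have "(LINT x|lebesgue. B * (cmod (v x))\<^sup>2) = B * nrm2 v" by (simp add: nrm2_def)
  finally have "Re (ip f w) \<le> Re (ip (\<lambda>x. of_real (\<phi> x) * g x) w) + B * nrm2 v" by simp
  then show ?thesis using q Lf unfolding w_def[abs_def] by blast
qed

text \<open>Comparing the lower bound \<gamma> with the factor \<gamma> - 1 in the form of
  \<open>\<phi> v\<close> leaves \<open>nrm2 (\<phi> v) \<le> B * nrm2 v\<close>, with
  \<open>B\<close> as small as desired. The right-hand side \<open>g\<close> is prescribed only
  almost everywhere because it comes from a pair in the adjoint.\<close>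

theorem shifted_kernel_trivial:
  assumes v: "qsol \<alpha> \<beta> \<tau> g v v1" and Lv: "L2 v" and g: "ae_eq g (\<lambda>x. of_real (\<gamma> - 1) * v x)"
    and lower: "\<And>f u u1. \<lbrakk>qsol \<alpha> \<beta> \<tau> f u u1; L2 u; L2 f; \<exists>c. \<forall>x. \<bar>x\<bar> > c \<longrightarrow> u x = 0\<rbrakk> \<Longrightarrow> \<gamma> * nrm2 u \<le> Re (ip f u)"
    and cut: "\<And>R e. e > 0 \<Longrightarrow> \<exists>\<phi> \<phi>' \<pi> \<kappa> M. admissible_cutoff e \<phi> \<phi>' \<pi> \<kappa> M \<and> (\<forall>x. \<bar>x\<bar> \<le> R \<longrightarrow> \<phi> x \<ge> 1 / 8)"
  shows "ae_eq v (\<lambda>x. 0)"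
proof -
  have ae_sym: "ae_eq (\<lambda>x. of_real (\<gamma> - 1) * v x) g" using g unfolding ae_eq_def by (simp add: eq_commute)
  have Lg: "L2 g" by (rule L2_cong_AE[OF L2_cmult[OF Lv] ae_sym])
  \<comment> \<open>The factor 64 is the square of 8: on \<open>(-R, R)\<close> the cut-off is at
    least 1/8, which is all that is asked of it there.\<close>
  have small: "nrm2 (\<lambda>x. if x \<in> {-R<..<R} then v x else 0) \<le> 64 * e * nrm2 v" if e: "e > 0" for e R
  proof -
    obtain \<phi> \<phi>' \<pi> \<kappa> M where adm: "admissible_cutoff e \<phi> \<phi>' \<pi> \<kappa> M" and R: "\<And>x. \<bar>x\<bar> \<le> R \<Longrightarrow> \<phi> x \<ge> 1 / 8"
      using cut[OF e] by blast
    let ?w = "\<lambda>x. complex_of_real (\<phi> x) * v x"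
    have pc: "continuous_on UNIV \<phi>" and pb: "\<And>x. \<bar>\<phi> x\<bar> \<le> 1" and sup: "\<And>x. \<bar>x\<bar> > M \<Longrightarrow> \<phi> x = 0"
      using adm DERIV_isCont unfolding admissible_cutoff_def
      by (blast intro: continuous_at_imp_continuous_on, auto simp: abs_le_iff intro: order_trans[of _ 0])
    have Lw: "L2 ?w" by (rule L2_mult_bounded[OF Lv pc pb])
    obtain f w1 where fw: "qsol \<alpha> \<beta> \<tau> f ?w w1" "L2 f"
      and en: "Re (ip f ?w) \<le> Re (ip (\<lambda>x. of_real (\<phi> x) * g x) ?w) + e * nrm2 v"
      using cutoff_energy[OF v Lv Lg adm] by blast
    have "ip (\<lambda>x. of_real (\<phi> x) * g x) ?w = ip (\<lambda>x. of_real (\<gamma> - 1) * ?w x) ?w"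
    proof (rule ip_cong_AE)
      show "ae_eq (\<lambda>x. of_real (\<phi> x) * g x) (\<lambda>x. of_real (\<gamma> - 1) * ?w x)"
        using g unfolding ae_eq_def by eventually_elim simp
      show "ae_eq ?w ?w" by (simp add: ae_eq_def)
    qed (intro L2_mult_bounded[OF Lg pc pb] Lw)+
    also have "\<dots> = of_real ((\<gamma> - 1) * nrm2 ?w)" by (simp only: ip_cmult_left ip_self of_real_mult)
    finally have eq: "Re (ip (\<lambda>x. of_real (\<phi> x) * g x) ?w) = (\<gamma> - 1) * nrm2 ?w" by simp
    have "\<exists>c. \<forall>x. \<bar>x\<bar> > c \<longrightarrow> ?w x = 0" using sup by (intro exI[of _ M]) simp
    from lower[OF fw(1) Lw fw(2) this] en have "\<gamma> * nrm2 ?w \<le> (\<gamma> - 1) * nrm2 ?w + e * nrm2 v"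
      unfolding eq by linarith
    then have 1: "nrm2 ?w \<le> e * nrm2 v" by (simp add: algebra_simps)
    have "nrm2 (\<lambda>x. if x \<in> {-R<..<R} then v x else 0) \<le> (LINT x|lebesgue. 64 * (cmod (?w x))\<^sup>2)"
      unfolding nrm2_def
    proof (rule integral_mono_AE)
      show "AE x in lebesgue. (cmod (if x \<in> {-R<..<R} then v x else 0))\<^sup>2 \<le> 64 * (cmod (?w x))\<^sup>2"
      proof (intro AE_I2)
        fix x
        show "(cmod (if x \<in> {-R<..<R} then v x else 0))\<^sup>2 \<le> 64 * (cmod (?w x))\<^sup>2"
        proof (cases "x \<in> {-R<..<R}")
          case True
          then have "1 / 8 \<le> \<phi> x" using R[of x] by auto
          then have "(1 / 8)\<^sup>2 \<le> (\<phi> x)\<^sup>2" by (rule power_mono) simp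
          then have "1 \<le> 64 * (\<phi> x)\<^sup>2" by (simp add: power2_eq_square)
          then have "1 * (cmod (v x))\<^sup>2 \<le> 64 * (\<phi> x)\<^sup>2 * (cmod (v x))\<^sup>2" by (rule mult_right_mono) simp
          then show ?thesis using True by (simp add: norm_mult power_mult_distrib)
        next
          case False
          then show ?thesis by (subst if_not_P) auto
        qed
      qed
    qed (use L2_integrable[OF L2_cutoff[OF Lv]] L2_integrable[OF Lw] in auto)
    also have "\<dots> = 64 * nrm2 ?w" by (simp add: nrm2_def)
    finally show ?thesis using 1 by simp
  qed
  have zero: "AE x in lebesgue. x \<in> {-R<..<R} \<longrightarrow> v x = 0" for R
  proof -
    let ?c = "\<lambda>x. if x \<in> {-R<..<R} then v x else 0"
    have "nrm2 ?c \<le> 0"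
    proof (rule field_le_epsilon)
      fix e :: real assume e: "e > 0"
      have "nrm2 ?c \<le> 64 * (e / (64 * (nrm2 v + 1))) * nrm2 v" using e nrm2_nonneg[of v] by (intro small) auto
      also have "\<dots> \<le> e" using e nrm2_nonneg[of v] by (simp add: divide_simps mult_left_mono)
      finally show "nrm2 ?c \<le> 0 + e" by simp
    qed
    then have "nrm2 ?c = 0" using nrm2_nonneg[of ?c] by linarith
    then have "AE x in lebesgue. ?c x = 0" using nrm2_zero_iff[OF L2_cutoff[OF Lv]] by (simp add: ae_eq_def)
    then show ?thesis by eventually_elim auto
  qed
  then have "AE x in lebesgue. \<forall>n::nat. x \<in> {- real n<..<real n} \<longrightarrow> v x = 0"
    unfolding AE_all_countable by blast
  then show ?thesis unfolding ae_eq_def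
  proof eventually_elim
    case (elim x)
    obtain n :: nat where "\<bar>x\<bar> < real n" using reals_Archimedean2 by blast
    then have "x \<in> {- real n<..<real n}" by auto
    then show ?case using elim by blast
  qed
qed

end

subsection \<open>Symmetric operators bounded from below\<close>

lemma nrm2_tendsto_diff_shift:
  assumes "\<And>n. L2 (X n)" "L2 u" "\<And>n. L2 (Y n)" "L2 v"
    and "(\<lambda>n. nrm2 (\<lambda>x. X n x - u x)) \<longlonglongrightarrow> 0" "(\<lambda>n. nrm2 (\<lambda>x. Y n x - v x)) \<longlonglongrightarrow> 0"
  shows "(\<lambda>n. nrm2 (\<lambda>x. (X n x + c * Y n x) - (u x + c * v x))) \<longlonglongrightarrow> 0"
proof (rule tendsto_sandwich[OF always_eventually always_eventually tendsto_const])
  show "\<forall>n. 0 \<le> nrm2 (\<lambda>x. (X n x + c * Y n x) - (u x + c * v x))" by (simp add: nrm2_nonneg)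
  show "\<forall>n. nrm2 (\<lambda>x. (X n x + c * Y n x) - (u x + c * v x)) \<le>
      2 * nrm2 (\<lambda>x. X n x - u x) + 2 * ((cmod c)\<^sup>2 * nrm2 (\<lambda>x. Y n x - v x))"
  proof
    fix n
    have "(\<lambda>x. (X n x + c * Y n x) - (u x + c * v x)) = (\<lambda>x. (X n x - u x) + c * (Y n x - v x))"
      by (auto simp: algebra_simps)
    then show "nrm2 (\<lambda>x. (X n x + c * Y n x) - (u x + c * v x)) \<le>
      2 * nrm2 (\<lambda>x. X n x - u x) + 2 * ((cmod c)\<^sup>2 * nrm2 (\<lambda>x. Y n x - v x))"
      using nrm2_add_le[of "\<lambda>x. X n x - u x" "\<lambda>x. c * (Y n x - v x)"] assms(1-4)
      by (simp add: L2_diff L2_cmult nrm2_cmult[of c "\<lambda>x. Y n x - v x"])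
  qed
  have "(\<lambda>n. 2 * nrm2 (\<lambda>x. X n x - u x) + 2 * ((cmod c)\<^sup>2 * nrm2 (\<lambda>x. Y n x - v x))) \<longlonglongrightarrow> 2 * 0 + 2 * ((cmod c)\<^sup>2 * 0)"
    by (intro tendsto_intros assms)
  then show "(\<lambda>n. 2 * nrm2 (\<lambda>x. X n x - u x) + 2 * ((cmod c)\<^sup>2 * nrm2 (\<lambda>x. Y n x - v x))) \<longlonglongrightarrow> 0" by simp
qed

text \<open>Subtracting a small positive multiple of \<open>ip r t\<close> times \<open>t\<close>
  from \<open>r\<close> would lower the norm to first order unless that inner product is
  zero.\<close>

lemma minimal_norm_imp_orthogonal:
  assumes r: "L2 r" and t: "L2 t" and min: "\<And>z. nrm2 r \<le> nrm2 (\<lambda>x. r x - z * t x)"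
  shows "ip t r = 0"
proof (rule ccontr)
  define a where "a = ip r t"
  assume "ip t r \<noteq> 0"
  then have a: "(cmod a)\<^sup>2 > 0" using ip_commute[of r t] by (simp add: a_def)
  have key: "0 \<le> s\<^sup>2 * (cmod a)\<^sup>2 * nrm2 t - 2 * s * (cmod a)\<^sup>2" for s :: real
  proof -
    have "nrm2 (\<lambda>x. r x - (of_real s * a) * t x) = nrm2 r + (cmod (of_real s * a))\<^sup>2 * nrm2 t - 2 * Re (cnj (of_real s * a) * a)"
      by (subst nrm2_diff[OF r L2_cmult[OF t]]) (simp only: nrm2_cmult ip_cmult_right a_def)
    moreover have "Re (cnj (of_real s * a) * a) = s * (cmod a)\<^sup>2"
      unfolding cmod_power2 by (simp add: power2_eq_square algebra_simps)
    moreover have "(cmod (of_real s * a))\<^sup>2 = s\<^sup>2 * (cmod a)\<^sup>2" by (simp add: norm_mult power_mult_distrib)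
    ultimately show ?thesis using min[of "of_real s * a"] by simp
  qed
  \<comment> \<open>Small enough for the quadratic term to be at most half of the linear term; the
    added one covers \<open>nrm2 t = 0\<close>.\<close>
  define s where "s = 1 / (nrm2 t + 1)"
  have s: "s > 0" "s * nrm2 t \<le> 1" using nrm2_nonneg[of t] by (simp_all add: s_def divide_simps)
  have "s\<^sup>2 * (cmod a)\<^sup>2 * nrm2 t = (s * (cmod a)\<^sup>2) * (s * nrm2 t)" by (simp add: power2_eq_square)
  also have "\<dots> \<le> (s * (cmod a)\<^sup>2) * 1" using s by (intro mult_left_mono) auto
  finally have "s * (cmod a)\<^sup>2 \<le> 0" using key[of s] by simp
  then show False using mult_pos_pos[OF s(1) a] by simp
qed

lemma adjoint_tendsto:
  assumes G: "\<And>u f. (u, f) \<in> G \<Longrightarrow> L2 u \<and> L2 f" and uf: "(u, f) \<in> op_closure G" and vw: "(v, w) \<in> adjoint G"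
  shows "ip f v = ip u w"
proof -
  obtain X where X: "\<And>n. X n \<in> G" and L: "L2 u" "L2 f"
    and l: "(\<lambda>n. nrm2 (\<lambda>x. fst (X n) x - u x)) \<longlonglongrightarrow> 0" "(\<lambda>n. nrm2 (\<lambda>x. snd (X n) x - f x)) \<longlonglongrightarrow> 0"
    using uf unfolding op_closure_def by blast
  have XL: "L2 (fst (X n))" "L2 (snd (X n))" for n using G X by (metis prod.collapse)+
  have Lv: "L2 v" "L2 w" using vw by (auto simp: adjoint_def)
  have "ip (snd (X n)) v = ip (fst (X n)) w" for n
    using vw X[of n] unfolding adjoint_def by (auto simp: case_prod_beta)
  moreover have "(\<lambda>n. ip (snd (X n)) v) \<longlonglongrightarrow> ip f v" by (rule ip_tendsto_left[OF XL(2) L(2) l(2) Lv(1)])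
  moreover have "(\<lambda>n. ip (fst (X n)) w) \<longlonglongrightarrow> ip u w" by (rule ip_tendsto_left[OF XL(1) L(1) l(1) Lv(2)])
  ultimately show ?thesis using LIMSEQ_unique by simp
qed

text \<open>The residual of the best approximation of \<open>f\<^sub>0 + \<lambda> u\<^sub>0\<close> by the range of \<open>G + \<lambda>\<close>, where
  \<open>\<lambda> = 1 - \<gamma>\<close> makes \<open>G + \<lambda> \<ge> 1\<close>, lies in the kernel of the adjoint of \<open>G + \<lambda>\<close>.\<close>

theorem adjoint_subset_closure:
  fixes G :: op_graph
  assumes G: "\<And>u f. (u, f) \<in> G \<Longrightarrow> L2 u \<and> L2 f"
    and zero: "((\<lambda>x. 0), (\<lambda>x. 0)) \<in> G"
    and lin: "\<And>u f v g c. (u, f) \<in> G \<Longrightarrow> (v, g) \<in> G \<Longrightarrow> ((\<lambda>x. u x + c * v x), (\<lambda>x. f x + c * g x)) \<in> G"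
    and sym: "G \<subseteq> adjoint G"
    and lower: "\<And>u f. (u, f) \<in> G \<Longrightarrow> \<gamma> * nrm2 u \<le> Re (ip f u)"
    and ker: "\<And>r. (r, \<lambda>x. of_real (\<gamma> - 1) * r x) \<in> adjoint G \<Longrightarrow> ae_eq r (\<lambda>x. 0)"
    and u0: "(u0, f0) \<in> adjoint G"
  shows "(u0, f0) \<in> op_closure G"
proof -
  define l where "l = complex_of_real (1 - \<gamma>)"
  define T where "T X = (\<lambda>x. snd X x + l * fst X x)" for X :: "(real \<Rightarrow> complex) \<times> (real \<Rightarrow> complex)"
  have L0: "L2 u0" "L2 f0" using u0 by (auto simp: adjoint_def)
  define t0 where "t0 = (\<lambda>x. f0 x + l * u0 x)"
  have Lt0: "L2 t0" unfolding t0_def by (intro L2_add L2_cmult L0)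
  have GL: "L2 (fst X)" "L2 (snd X)" "L2 (T X)" if "X \<in> G" for X
  proof -
    show "L2 (fst X)" "L2 (snd X)" using G that by (metis prod.collapse)+
    then show "L2 (T X)" unfolding T_def by (intro L2_add L2_cmult)
  qed
  have comb: "((\<lambda>x. fst X x + c * fst Y x), (\<lambda>x. snd X x + c * snd Y x)) \<in> G" if "X \<in> G" "Y \<in> G" for X Y c
    using lin[of "fst X" "snd X" "fst Y" "snd Y"] that by simp
  have Tcomb: "T ((\<lambda>x. fst X x + c * fst Y x), (\<lambda>x. snd X x + c * snd Y x)) = (\<lambda>x. T X x + c * T Y x)" for X Y c
    by (auto simp: T_def algebra_simps)
  \<comment> \<open>The shifted form dominates \<open>nrm2 (fst X)\<close>, and Cauchy-Schwarz
    passes this on to the norm of the image. Cauchy sequences of images therefore come from Cauchy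
    sequences of arguments.\<close>
  have coercive: "nrm2 (fst X) \<le> nrm2 (T X)" if X: "X \<in> G" for X
  proof -
    have "ip (T X) (fst X) = ip (snd X) (fst X) + l * of_real (nrm2 (fst X))"
      unfolding T_def using GL[OF X] by (simp add: ip_add_left L2_cmult ip_cmult_left ip_self)
    then have "Re (ip (T X) (fst X)) = Re (ip (snd X) (fst X)) + (1 - \<gamma>) * nrm2 (fst X)"
      by (simp only: l_def plus_complex.sel of_real_mult[symmetric] Re_complex_of_real)
    then have "nrm2 (fst X) \<le> Re (ip (T X) (fst X))"
      using lower[of "fst X" "snd X"] X by (simp add: algebra_simps)
    also have "\<dots> \<le> cmod (ip (T X) (fst X))" by (rule complex_Re_le_cmod)
    finally have "(nrm2 (fst X))\<^sup>2 \<le> (cmod (ip (T X) (fst X)))\<^sup>2" using nrm2_nonneg by (intro power_mono)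
    also have "\<dots> \<le> nrm2 (T X) * nrm2 (fst X)" by (rule ip_Cauchy_Schwarz[OF GL(3,1)[OF X]])
    finally have "nrm2 (fst X) * nrm2 (fst X) \<le> nrm2 (T X) * nrm2 (fst X)" by (simp add: power2_eq_square)
    then show ?thesis
      using nrm2_nonneg[of "fst X"] nrm2_nonneg[of "T X"] by (cases "nrm2 (fst X) = 0") (auto simp: mult_le_cancel_right)
  qed
  define D where "D = (\<lambda>X. nrm2 (\<lambda>x. T X x - t0 x)) ` G"
  define d where "d = Inf D"
  have Dne: "D \<noteq> {}" using zero by (auto simp: D_def)
  have Dbd: "bdd_below D" unfolding D_def by (rule bdd_belowI[of _ 0]) (auto simp: nrm2_nonneg)
  have dle: "d \<le> nrm2 (\<lambda>x. T X x - t0 x)" if "X \<in> G" for X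
    unfolding d_def by (rule cInf_lower[OF _ Dbd]) (use that in \<open>auto simp: D_def\<close>)
  have "\<exists>X\<in>G. nrm2 (\<lambda>x. T X x - t0 x) < d + inverse (real (Suc n))" for n
    using cInf_lessD[OF Dne, of "d + inverse (real (Suc n))"] unfolding d_def D_def by auto
  then obtain X where XG: "\<And>n. X n \<in> G" and Xd: "\<And>n. nrm2 (\<lambda>x. T (X n) x - t0 x) < d + inverse (real (Suc n))"
    by metis
  \<comment> \<open>As in the projection theorem, the parallelogram law is applied to two
    near-minimizers. The image of their midpoint is a competitor, and this supplies the lower bound
    \<open>4 * d\<close> for the sum.\<close>
  have close: "nrm2 (\<lambda>x. T (X m) x - T (X n) x) \<le> 2 * inverse (real (Suc m)) + 2 * inverse (real (Suc n))" for m n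
  proof -
    let ?a = "\<lambda>x. T (X m) x - t0 x" and ?b = "\<lambda>x. T (X n) x - t0 x"
    define z1 where "z1 x = fst (X m) x + 1 * fst (X n) x" for x
    define z2 where "z2 x = snd (X m) x + 1 * snd (X n) x" for x
    have "(z1, z2) \<in> G" unfolding z1_def[abs_def] z2_def[abs_def] by (rule comb[OF XG XG])
    \<comment> \<open>Linearity is available only in the form \<open>u + c v\<close>; the midpoint
      is the zero pair plus half of the sum.\<close>
    from lin[OF zero this, of "1/2"]
    have HG: "((\<lambda>x. z1 x / 2), (\<lambda>x. z2 x / 2)) \<in> G" (is "?H \<in> G") by simp
    have TH: "T ?H = (\<lambda>x. (1/2) * (T (X m) x + T (X n) x))"
      unfolding T_def by (rule ext) (simp add: z1_def z2_def field_simps)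
    have La: "L2 ?a" "L2 ?b" using GL(3)[OF XG] Lt0 by (auto intro: L2_diff)
    have "(\<lambda>x. ?a x + ?b x) = (\<lambda>x. 2 * (T ?H x - t0 x))" unfolding TH by (auto simp: algebra_simps)
    then have "nrm2 (\<lambda>x. ?a x + ?b x) = (cmod 2)\<^sup>2 * nrm2 (\<lambda>x. T ?H x - t0 x)" by (simp only: nrm2_cmult)
    then have "nrm2 (\<lambda>x. ?a x + ?b x) \<ge> 4 * d" using dle[OF HG] by simp
    moreover have "(\<lambda>x. ?a x - ?b x) = (\<lambda>x. T (X m) x - T (X n) x)" by auto
    ultimately have "nrm2 (\<lambda>x. T (X m) x - T (X n) x) \<le> 2 * nrm2 ?a + 2 * nrm2 ?b - 4 * d"
      using nrm2_parallelogram[OF La] by simp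
    then show ?thesis using Xd[of m] Xd[of n] by linarith
  qed
  have Tcauchy: "\<exists>N. \<forall>m\<ge>N. \<forall>n\<ge>N. nrm2 (\<lambda>x. T (X m) x - T (X n) x) < e" if e: "e > 0" for e
  proof -
    obtain N :: nat where N: "inverse (real (Suc N)) < e / 4" using reals_Archimedean[of "e/4"] e by auto
    show ?thesis
    proof (intro exI[of _ N] allI impI)
      fix m n assume "m \<ge> N" "n \<ge> N"
      then have "inverse (real (Suc m)) \<le> inverse (real (Suc N))" "inverse (real (Suc n)) \<le> inverse (real (Suc N))"
        by (auto intro: le_imp_inverse_le)
      then show "nrm2 (\<lambda>x. T (X m) x - T (X n) x) < e" using close[of m n] N by linarith
    qed
  qed
  have udiff: "nrm2 (\<lambda>x. fst (X m) x - fst (X n) x) \<le> nrm2 (\<lambda>x. T (X m) x - T (X n) x)" for m n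
    using coercive[OF comb[OF XG XG, of m "-1" n]] unfolding Tcomb by simp
  have ucauchy: "\<exists>N. \<forall>m\<ge>N. \<forall>n\<ge>N. nrm2 (\<lambda>x. fst (X m) x - fst (X n) x) < e" if e: "e > 0" for e
    using Tcauchy[OF e] udiff by (meson le_less_trans)
  obtain u where Lu: "L2 u" and ulim: "(\<lambda>n. nrm2 (\<lambda>x. fst (X n) x - u x)) \<longlonglongrightarrow> 0"
    using L2_complete[OF GL(1)[OF XG] ucauchy] by blast
  obtain t where Lt: "L2 t" and tlim: "(\<lambda>n. nrm2 (\<lambda>x. T (X n) x - t x)) \<longlonglongrightarrow> 0"
    using L2_complete[OF GL(3)[OF XG] Tcauchy] by blast
  define f where "f = (\<lambda>x. t x + (- l) * u x)"
  have Lf: "L2 f" unfolding f_def by (intro L2_add L2_cmult Lt Lu)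
  have "(\<lambda>n. nrm2 (\<lambda>x. (T (X n) x + (- l) * fst (X n) x) - (t x + (- l) * u x))) \<longlonglongrightarrow> 0"
    by (rule nrm2_tendsto_diff_shift[OF GL(3)[OF XG] Lt GL(1)[OF XG] Lu tlim ulim])
  then have flim: "(\<lambda>n. nrm2 (\<lambda>x. snd (X n) x - f x)) \<longlonglongrightarrow> 0"
    by (simp add: T_def f_def)
  have ufcl: "(u, f) \<in> op_closure G" unfolding op_closure_def using Lu Lf XG ulim flim by blast
  define r where "r = (\<lambda>x. t0 x - t x)"
  have Lr: "L2 r" unfolding r_def by (intro L2_diff Lt0 Lt)
  \<comment> \<open>The infimum \<open>d\<close> separates the two sides: the limit shows
    \<open>nrm2 r \<le> d\<close>, while \<open>T (X n) + z T Y\<close> is again a value of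
    \<open>T\<close> on \<open>G\<close>, so that the limit of its distances to \<open>t0\<close> is
    at least \<open>d\<close>.\<close>
  have rmin: "nrm2 r \<le> nrm2 (\<lambda>x. r x - z * T Y x)" if Y: "Y \<in> G" for Y z
  proof -
    have "(\<lambda>n. nrm2 (\<lambda>x. T (X n) x - t0 x)) \<longlonglongrightarrow> nrm2 (\<lambda>x. t x - t0 x)"
    proof (rule nrm2_tendsto)
      have "(\<lambda>x. (T (X n) x - t0 x) - (t x - t0 x)) = (\<lambda>x. T (X n) x - t x)" for n by auto
      then show "(\<lambda>n. nrm2 (\<lambda>x. (T (X n) x - t0 x) - (t x - t0 x))) \<longlonglongrightarrow> 0" using tlim by simp
    qed (intro L2_diff GL(3)[OF XG] Lt Lt0)+
    moreover have "(\<lambda>n. d + inverse (real (Suc n))) \<longlonglongrightarrow> d + 0" by (intro tendsto_intros LIMSEQ_inverse_real_of_nat)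
    ultimately have "nrm2 (\<lambda>x. t x - t0 x) \<le> d + 0"
      by (rule LIMSEQ_le) (use Xd less_imp_le in blast)
    then have 1: "nrm2 r \<le> d" unfolding r_def by (subst nrm2_diff_commute) simp
    have "(\<lambda>n. nrm2 (\<lambda>x. (T (X n) x + z * T Y x) - t0 x)) \<longlonglongrightarrow> nrm2 (\<lambda>x. (t x + z * T Y x) - t0 x)"
    proof (rule nrm2_tendsto)
      have "(\<lambda>x. ((T (X n) x + z * T Y x) - t0 x) - ((t x + z * T Y x) - t0 x)) = (\<lambda>x. T (X n) x - t x)" for n by auto
      then show "(\<lambda>n. nrm2 (\<lambda>x. ((T (X n) x + z * T Y x) - t0 x) - ((t x + z * T Y x) - t0 x))) \<longlonglongrightarrow> 0" using tlim by simp
    qed (intro L2_diff L2_add L2_cmult GL(3)[OF XG] GL(3)[OF Y] Lt Lt0)+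
    moreover have "d \<le> nrm2 (\<lambda>x. (T (X n) x + z * T Y x) - t0 x)" for n
      using dle[OF comb[OF XG Y, of n z]] unfolding Tcomb .
    ultimately have "d \<le> nrm2 (\<lambda>x. (t x + z * T Y x) - t0 x)"
      by (intro LIMSEQ_le_const[of _ _ d]) auto
    also have "\<dots> = nrm2 (\<lambda>x. t0 x - (t x + z * T Y x))" by (rule nrm2_diff_commute)
    also have "(\<lambda>x. t0 x - (t x + z * T Y x)) = (\<lambda>x. r x - z * T Y x)" by (auto simp: r_def)
    finally show ?thesis using 1 by simp
  qed
  have orth: "ip (T Y) r = 0" if "Y \<in> G" for Y
    by (rule minimal_norm_imp_orthogonal[OF Lr GL(3)[OF that] rmin[OF that]])
  have "(r, \<lambda>x. of_real (\<gamma> - 1) * r x) \<in> adjoint G"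
    unfolding adjoint_def
  proof (simp only: mem_Collect_eq case_prod_conv, intro conjI Lr L2_cmult ballI)
    fix Y assume Y: "Y \<in> G"
    have "ip (T Y) r = ip (snd Y) r + l * ip (fst Y) r"
      unfolding T_def using GL[OF Y] Lr by (simp add: ip_add_left L2_cmult ip_cmult_left)
    then have "ip (snd Y) r = cnj (of_real (\<gamma> - 1)) * ip (fst Y) r"
      using orth[OF Y] by (simp add: l_def algebra_simps add_eq_0_iff)
    then have "ip (snd Y) r = ip (fst Y) (\<lambda>x. of_real (\<gamma> - 1) * r x)" by (simp only: ip_cmult_right)
    then show "case Y of (u, f) \<Rightarrow> ip f r = ip u (\<lambda>x. of_real (\<gamma> - 1) * r x)" by (simp add: case_prod_beta)
  qed
  then have "ae_eq r (\<lambda>x. 0)" by (rule ker)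
  then have t0t: "AE x in lebesgue. t0 x = t x" unfolding ae_eq_def r_def by eventually_elim simp
  \<comment> \<open>A second use of the trivial kernel. From \<open>t0 = t\<close> a.e. follows
    \<open>f0 - f = - l * (u0 - u)\<close>, so the difference of the given pair and the limit pair
    is again an element of the kernel.\<close>
  have "(\<lambda>x. u0 x - u x, \<lambda>x. of_real (\<gamma> - 1) * (u0 x - u x)) \<in> adjoint G"
    unfolding adjoint_def
  proof (simp only: mem_Collect_eq case_prod_conv, intro conjI L2_cmult L2_diff L0 Lu ballI)
    fix Y assume Y: "Y \<in> G"
    obtain y g where yg: "Y = (y, g)" by (cases Y)
    have Lyg: "L2 y" "L2 g" using GL[OF Y] yg by auto
    have 1: "ip g u0 = ip y f0" using u0 Y yg by (auto simp: adjoint_def)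
    have "(y, g) \<in> adjoint G" using Y yg sym by blast
    from adjoint_tendsto[OF _ ufcl this] G have "ip f y = ip u g" by blast
    then have 2: "ip y f = ip g u" by (metis ip_commute)
    have "ip g (\<lambda>x. u0 x - u x) = ip y (\<lambda>x. f0 x - f x)"
      using 1 2 Lyg L0 Lu Lf by (simp add: ip_diff_right)
    also have "\<dots> = ip y (\<lambda>x. of_real (\<gamma> - 1) * (u0 x - u x))"
    proof (rule ip_cong_AE)
      show "ae_eq (\<lambda>x. f0 x - f x) (\<lambda>x. of_real (\<gamma> - 1) * (u0 x - u x))"
        using t0t unfolding ae_eq_def
      proof eventually_elim
        case (elim x)
        have "f0 x = t x - l * u0 x" using elim by (simp add: t0_def algebra_simps)
        then show ?case by (simp add: f_def l_def algebra_simps)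
      qed
    qed (use Lyg L0 Lf in \<open>auto simp: ae_eq_def intro: L2_diff\<close>)
    finally show "case Y of (y, g) \<Rightarrow> ip g (\<lambda>x. u0 x - u x) = ip y (\<lambda>x. of_real (\<gamma> - 1) * (u0 x - u x))"
      by (simp add: yg)
  qed
  then have uu: "ae_eq (\<lambda>x. u0 x - u x) (\<lambda>x. 0)" by (rule ker)
  have ff: "AE x in lebesgue. f x = f0 x"
    using t0t uu unfolding ae_eq_def
  proof eventually_elim
    case (elim x)
    then have "t x = f0 x + l * u0 x" "u0 x = u x" by (simp_all add: t0_def)
    then show ?case by (simp add: f_def)
  qed
  \<comment> \<open>The closure is defined on representatives; since \<open>nrm2\<close> ignores
    null sets, the same sequence approximates \<open>u0\<close> and \<open>f0\<close>.\<close>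
  have "nrm2 (\<lambda>x. fst (X n) x - u x) = nrm2 (\<lambda>x. fst (X n) x - u0 x)" for n
    by (rule nrm2_cong_AE) (use uu GL[OF XG] Lu in \<open>auto simp: ae_eq_def intro: L2_diff\<close>)
  moreover have "nrm2 (\<lambda>x. snd (X n) x - f x) = nrm2 (\<lambda>x. snd (X n) x - f0 x)" for n
    by (rule nrm2_cong_AE) (use ff GL[OF XG] Lf in \<open>auto simp: ae_eq_def intro: L2_diff\<close>)
  ultimately show ?thesis unfolding op_closure_def using L0 XG ulim flim by (auto intro!: exI[of _ X])
qed

subsection \<open>Essential self-adjointness\<close>

text \<open>Growing intervals and decreasing shifts are run through the same index, which makes the
  integrands increase to p^(-1/2) on \<open>A\<close>; monotone convergence then gives divergence.
  The limit is taken with \<open>p\<close>, which is positive everywhere, and \<open>P\<close>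
  replaces it under the integral. A bound for all large \<open>n\<close> allows the two half-lines
  to share one index.\<close>

lemma nn_integral_tail_large:
  fixes p :: "real \<Rightarrow> real" and lo hi :: "nat \<Rightarrow> real"
  assumes pm: "p \<in> borel_measurable lebesgue" and p0: "\<And>x. p x > 0"
    and inf: "(\<integral>\<^sup>+ x. ennreal (indicator A x * (1 / sqrt (p x))) \<partial>lebesgue) = \<infinity>"
    and mono: "\<And>m n. m \<le> n \<Longrightarrow> {lo m..hi m} \<subseteq> {lo n..hi n}"
    and un: "(\<Union>n. {lo n..hi n}) = A"
    and P: "AC_loc P" "\<And>x. P x \<ge> 0" "AE x in lebesgue. p x = P x"
  shows "\<exists>n0. \<forall>n\<ge>n0. N \<le> integral {lo n..hi n} (\<lambda>x. 1 / sqrt (P x + inverse (real (Suc n))))"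
proof -
  define F where "F n x = ennreal (indicator {lo n..hi n} x * (1 / sqrt (p x + inverse (real (Suc n)))))" for n x
  have Fi: "incseq F"
  proof (intro incseq_SucI le_funI)
    fix n x
    have pe: "p x + inverse (real (Suc m)) > 0" for m using p0[of x] by (intro add_pos_pos) auto
    have "inverse (real (Suc (Suc n))) \<le> inverse (real (Suc n))" by (intro le_imp_inverse_le) auto
    then have "1 / sqrt (p x + inverse (real (Suc n))) \<le> 1 / sqrt (p x + inverse (real (Suc (Suc n))))"
      using pe[of n] pe[of "Suc n"] by (intro frac_le) (auto simp del: of_nat_Suc)
    moreover have "indicat_real {lo n..hi n} x \<le> indicator {lo (Suc n)..hi (Suc n)} x"
      using mono[of n "Suc n"] by (auto simp: indicator_def subset_eq)
    ultimately show "F n x \<le> F (Suc n) x" unfolding F_def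
      using pe[of n] by (intro ennreal_leI mult_mono) auto
  qed
  have Fm: "F n \<in> borel_measurable lebesgue" for n
    unfolding F_def using pm by (intro measurable_compose[OF _ measurable_ennreal] borel_measurable_times borel_measurable_indicator borel_measurable_divide borel_measurable_const borel_measurable_sqrt borel_measurable_add) auto
  have lim: "(\<lambda>n. F n x) \<longlonglongrightarrow> ennreal (indicator A x * (1 / sqrt (p x)))" for x
    unfolding F_def
  proof (intro tendsto_ennrealI tendsto_mult)
    show "(\<lambda>n. indicat_real {lo n..hi n} x) \<longlonglongrightarrow> indicator A x"
    proof (rule tendsto_eventually)
      show "\<forall>\<^sub>F n in sequentially. indicat_real {lo n..hi n} x = indicator A x"
      proof (cases "x \<in> A")
        case True
        then obtain n1 where "x \<in> {lo n1..hi n1}" using un by blast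
        then have "x \<in> {lo n..hi n}" if "n \<ge> n1" for n using mono[OF that] by blast
        then show ?thesis using True by (intro eventually_sequentiallyI[of n1]) simp
      next
        case False
        then have "x \<notin> {lo n..hi n}" for n using un by blast
        then show ?thesis using False by simp
      qed
    qed
    have "(\<lambda>n. 1 / sqrt (p x + inverse (real (Suc n)))) \<longlonglongrightarrow> 1 / sqrt (p x + 0)"
      using p0[of x] by (intro tendsto_intros LIMSEQ_inverse_real_of_nat) auto
    then show "(\<lambda>n. 1 / sqrt (p x + inverse (real (Suc n)))) \<longlonglongrightarrow> 1 / sqrt (p x)" by simp
  qed
  have "(\<lambda>n. \<integral>\<^sup>+x. F n x \<partial>lebesgue) \<longlonglongrightarrow> (\<integral>\<^sup>+x. ennreal (indicator A x * (1 / sqrt (p x))) \<partial>lebesgue)"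
    by (rule nn_integral_LIMSEQ[OF Fi Fm lim])
  then have "\<forall>\<^sub>F n in sequentially. ennreal N < (\<integral>\<^sup>+x. F n x \<partial>lebesgue)"
    unfolding inf by (rule order_tendstoD(1)) simp
  then obtain n0 where n0: "\<And>n. n \<ge> n0 \<Longrightarrow> ennreal N < (\<integral>\<^sup>+x. F n x \<partial>lebesgue)"
    by (auto simp: eventually_sequentially)
  have FP: "(\<integral>\<^sup>+x. F n x \<partial>lebesgue) = ennreal (integral {lo n..hi n} (\<lambda>x. 1 / sqrt (P x + inverse (real (Suc n)))))" for n
  proof -
    let ?k = "\<lambda>x. 1 / sqrt (P x + inverse (real (Suc n)))"
    have "loc_int ?k" by (intro loc_int_continuous AC_loc_continuous inverse_sqrt_shift_AC P) simp
    then have si: "set_integrable lebesgue {lo n..hi n} ?k" by (rule loc_intD)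
    have "(\<integral>\<^sup>+x. F n x \<partial>lebesgue) = (\<integral>\<^sup>+x. ennreal (indicat_real {lo n..hi n} x *\<^sub>R ?k x) \<partial>lebesgue)"
      by (rule nn_integral_cong_AE) (use P(3) in \<open>eventually_elim, simp add: F_def\<close>)
    also have "\<dots> = ennreal (LINT x|lebesgue. indicat_real {lo n..hi n} x *\<^sub>R ?k x)"
    proof (rule nn_integral_eq_integral)
      show "integrable lebesgue (\<lambda>x. indicat_real {lo n..hi n} x *\<^sub>R ?k x)" using si unfolding set_integrable_def .
      show "AE x in lebesgue. 0 \<le> indicat_real {lo n..hi n} x *\<^sub>R ?k x"
        using P(2) by (intro AE_I2) (simp add: add_nonneg_nonneg)
    qed
    also have "\<dots> = ennreal (integral {lo n..hi n} ?k)"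
      using set_lebesgue_integral_eq_integral(2)[OF si] unfolding set_lebesgue_integral_def by simp
    finally show ?thesis .
  qed
  have "N \<le> integral {lo n..hi n} (\<lambda>x. 1 / sqrt (P x + inverse (real (Suc n))))" if "n \<ge> n0" for n
    using n0[OF that] unfolding FP by (meson ennreal_leI linorder_not_le nle_le)
  then show ?thesis by blast
qed

text \<open>Since \<open>p\<close> vanishes nowhere, the defining relations of the quasi-derivatives
  can be solved for the derivatives, which determines the existentially quantified \<open>d\<close>
  and \<open>d1\<close>.\<close>

lemma l_expr_iff_qsol:
  assumes "\<And>x. p x \<noteq> 0"
  shows "l_expr p Q r s u f \<longleftrightarrow> (\<exists>u1. qsol (\<lambda>x. (of_real (Q x) + \<i> * of_real (r x)) / of_real (p x)) (\<lambda>x. 1 / p x)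
    (\<lambda>x. ((Q x)\<^sup>2 + (r x)\<^sup>2) / p x - s x) f u u1)"
proof -
  have 1: "(\<exists>d. (u has_vector_derivative d) (at x) \<and> u1 x = of_real (p x) * d - (of_real (Q x) + \<i> * of_real (r x)) * u x) \<longleftrightarrow>
      (u has_vector_derivative (of_real (Q x) + \<i> * of_real (r x)) / of_real (p x) * u x + of_real (1 / p x) * u1 x) (at x)" for u1 x
  proof -
    have "u1 x = of_real (p x) * d - (of_real (Q x) + \<i> * of_real (r x)) * u x \<longleftrightarrow>
        d = (of_real (Q x) + \<i> * of_real (r x)) / of_real (p x) * u x + of_real (1 / p x) * u1 x" for d
      using assms[of x] by (auto simp: field_simps)
    then show ?thesis by auto
  qed
  have 2: "(\<exists>d1. (u1 has_vector_derivative d1) (at x) \<and> f x = - (d1 + (of_real (Q x) - \<i> * of_real (r x)) / of_real (p x) * u1 x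
                    + of_real (((Q x)\<^sup>2 + (r x)\<^sup>2) / p x - s x) * u x)) \<longleftrightarrow>
      (u1 has_vector_derivative - f x - cnj ((of_real (Q x) + \<i> * of_real (r x)) / of_real (p x)) * u1 x
        - of_real (((Q x)\<^sup>2 + (r x)\<^sup>2) / p x - s x) * u x) (at x)" for u1 x
  proof -
    have "cnj ((of_real (Q x) + \<i> * of_real (r x)) / of_real (p x)) = (of_real (Q x) - \<i> * of_real (r x)) / complex_of_real (p x)"
      by simp
    moreover have "f x = - (d1 + A + B) \<longleftrightarrow> d1 = - f x - A - B" for d1 A B by (auto simp: complex_eq_iff)
    ultimately show ?thesis by auto
  qed
  show ?thesis unfolding l_expr_def is_qd1_def qsol_def 1 2 by blast
qed

theorem theorem1:
  fixes p Q r s :: "real \<Rightarrow> real"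
  assumes A: "standing_A p Q r s"
    and p_W: "W12_loc p"
    and p_pos: "\<forall>x. p x > 0"
    and int_left: "(\<integral>\<^sup>+ x. ennreal (indicator {..0} x * (1 / sqrt (p x))) \<partial>lebesgue) = \<infinity>"
    and int_right: "(\<integral>\<^sup>+ x. ennreal (indicator {0..} x * (1 / sqrt (p x))) \<partial>lebesgue) = \<infinity>"
    and bb: "bounded_below (L_00 p Q r s)"
  shows "essentially_self_adjoint (L_00 p Q r s)
     \<and> op_eq (adjoint (L_00 p Q r s)) (L_max p Q r s)
     \<and> op_eq (L_max p Q r s) (adjoint (L_max p Q r s))"
proof -
  have pp: "p x > 0" for x using p_pos by blast
  define \<alpha> where "\<alpha> = (\<lambda>x. (complex_of_real (Q x) + \<i> * of_real (r x)) / of_real (p x))"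
  define \<beta> where "\<beta> = (\<lambda>x. 1 / p x)"
  define \<tau> where "\<tau> = (\<lambda>x. ((Q x)\<^sup>2 + (r x)\<^sup>2) / p x - s x)"
  have meas: "p \<in> borel_measurable lebesgue" "Q \<in> borel_measurable lebesgue"
    and A1: "L2_loc (\<lambda>x. 1 / sqrt (p x))" and A2: "L2_loc (\<lambda>x. Q x / sqrt (p x))"
    and A3: "L2_loc (\<lambda>x. r x / sqrt (p x))" and A4: "loc_int s"
    using A pp by (auto simp: standing_A_def L1_loc_def loc_int_def abs_of_pos)
  \<comment> \<open>Each of \<beta>, \<alpha> and the quadratic part of \<tau> is built from
    products of two of the \<open>L2_loc\<close> functions that (A) provides.\<close>
  have lb: "loc_int \<beta>" using L2_loc_mult[OF A1 A1] unfolding \<beta>_def by (simp add: abs_of_pos[OF pp])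
  have lQ: "loc_int (\<lambda>x. Q x / p x)" using L2_loc_mult[OF A2 A1] by (simp add: abs_of_pos[OF pp])
  have lr: "loc_int (\<lambda>x. r x / p x)" using L2_loc_mult[OF A3 A1] by (simp add: abs_of_pos[OF pp])
  have lQ2: "loc_int (\<lambda>x. (Q x)\<^sup>2 / p x)" using L2_loc_mult[OF A2 A2] by (simp add: abs_of_pos[OF pp] power2_eq_square)
  have lr2: "loc_int (\<lambda>x. (r x)\<^sup>2 / p x)" using L2_loc_mult[OF A3 A3] by (simp add: abs_of_pos[OF pp] power2_eq_square)
  have lt: "loc_int \<tau>" unfolding \<tau>_def add_divide_distrib by (intro loc_int_diff loc_int_add lQ2 lr2 A4)
  have la: "loc_int \<alpha>"
  proof -
    have "loc_int (\<lambda>x. complex_of_real (Q x / p x) + \<i> * of_real (r x / p x))"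
      by (intro loc_int_add loc_int_linear[OF lQ] loc_int_linear[OF lr] bounded_linear_of_real
          bounded_linear_compose[OF bounded_linear_mult_right bounded_linear_of_real])
    then show ?thesis unfolding \<alpha>_def by (simp add: add_divide_distrib)
  qed
  interpret quasi_system \<alpha> \<beta> \<tau>
    by unfold_locales (use la lb lt pp in \<open>auto simp: \<beta>_def less_imp_neq[THEN not_sym]\<close>)
  have lq: "l_expr p Q r s u f \<longleftrightarrow> (\<exists>u1. qsol \<alpha> \<beta> \<tau> f u u1)" for u f
    unfolding \<alpha>_def \<beta>_def \<tau>_def by (rule l_expr_iff_qsol) (use pp in \<open>simp add: less_imp_neq[THEN not_sym]\<close>)
  let ?L = "L_max p Q r s" and ?G = "L_00 p Q r s"
  have Lmem: "(u, f) \<in> ?L \<longleftrightarrow> L2 u \<and> L2 f \<and> (\<exists>u1. qsol \<alpha> \<beta> \<tau> f u u1)" for u f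
    by (auto simp: L_max_def lq)
  have Gmem: "(u, f) \<in> ?G \<longleftrightarrow> L2 u \<and> L2 f \<and> (\<exists>u1. qsol \<alpha> \<beta> \<tau> f u u1) \<and> (\<exists>c. \<forall>x. \<bar>x\<bar> > c \<longrightarrow> u x = 0)" for u f
    by (auto simp: L_00_def Lmem)
  have GL: "?G \<subseteq> ?L" by (auto simp: L_00_def)
  have L2G: "L2 u \<and> L2 f" if "(u, f) \<in> ?G" for u f using that Gmem by blast
  have green: "ip f v = ip u g" if uf: "(u, f) \<in> ?G" and vg: "(v, g) \<in> ?L" for u f v g
  proof -
    obtain u1 v1 where q: "qsol \<alpha> \<beta> \<tau> f u u1" "qsol \<alpha> \<beta> \<tau> g v v1" using uf vg unfolding Gmem Lmem by blast
    obtain c where c: "\<And>x. \<bar>x\<bar> > c \<Longrightarrow> u x = 0" using uf unfolding Gmem by blast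
    show ?thesis
      by (rule qsol_symmetric[OF q bnz _ _ _ _ c]) (use uf vg Gmem Lmem in blast)+
  qed
  have LadjG: "?L \<subseteq> adjoint ?G"
    unfolding adjoint_def using green Lmem by fastforce
  \<comment> \<open>Pairs in the adjoint are arbitrary representatives, so the first component is
    replaced by its absolutely continuous version; the second enters \<open>l_expr\<close> only
    almost everywhere and can stay.\<close>
  have adjL: "\<exists>v'. (v', w) \<in> ?L \<and> ae_eq v v'" if vw: "(v, w) \<in> adjoint ?G" for v w
  proof -
    have L: "L2 v" "L2 w" using vw by (auto simp: adjoint_def)
    have "\<exists>v' v1. qsol \<alpha> \<beta> \<tau> w v' v1 \<and> ae_eq v v'"
    proof (rule adjoint_preminimal[OF L])
      fix u u1 f assume "qsol \<alpha> \<beta> \<tau> f u u1" "L2 u" "L2 f" "\<exists>c. \<forall>x. \<bar>x\<bar> > c \<longrightarrow> u x = 0"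
      then have "(u, f) \<in> ?G" unfolding Gmem by blast
      then show "ip f v = ip u w" using vw unfolding adjoint_def by blast
    qed
    then show ?thesis using L L2_cong_AE Lmem by blast
  qed
  obtain \<gamma> where \<gamma>: "\<And>u f. (u, f) \<in> ?G \<Longrightarrow> \<gamma> * nrm2 u \<le> Re (ip f u)"
    using bb unfolding bounded_below_def by blast
  obtain P g where P: "AC_loc P" and gL: "L2_loc g" and Pd: "AE x in lebesgue. (P has_real_derivative g x) (at x)"
    and pP: "AE x in lebesgue. p x = P x"
    using W12_loc_representative[OF p_W] .
  \<comment> \<open>\<open>P\<close> is positive only almost everywhere. The continuous function
    \<open>min P 0\<close> vanishes almost everywhere and hence everywhere.\<close>
  have P0: "P x \<ge> 0" for x
  proof -
    have "AE y in lebesgue. y \<in> {x-1<..<x+1} \<longrightarrow> min (P y) 0 = 0"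
      using pP
    proof eventually_elim
      case (elim y)
      then have "P y > 0" using pp[of y] by simp
      then show ?case by simp
    qed
    then have "min (P x) 0 = 0"
      by (rule continuous_AE_zero[rotated]) (auto intro!: continuous_intros continuous_on_min AC_loc_continuous[OF P])
    then show ?thesis by (simp add: min_def split: if_splits)
  qed
  have cut: "\<exists>\<phi> \<phi>' \<pi> \<kappa> M. admissible_cutoff e \<phi> \<phi>' \<pi> \<kappa> M \<and> (\<forall>x. \<bar>x\<bar> \<le> R \<longrightarrow> \<phi> x \<ge> 1 / 8)" if e: "e > 0" for R e
  proof -
    have sl: "loc_int (\<lambda>x. 1 / sqrt (p x))" by (rule L2_loc_imp_loc_int[OF A1])
    define K where "K = integral {-R..R} (\<lambda>x. 1 / sqrt (p x))"
    \<comment> \<open>Three demands on the scale: it is positive, it is at least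
      \<open>2 * K\<close> so that the cut-off exceeds 1/8 on \<open>{-R..R}\<close>, and it brings
      \<open>36 / N\<^sup>2\<close> below \<open>e\<close>.\<close>
    define N where "N = max (max 1 (2 * K)) (sqrt (36 / e))"
    have N: "N > 0" "2 * K \<le> N" "36 / N\<^sup>2 \<le> e"
    proof -
      show "N > 0" "2 * K \<le> N" by (auto simp: N_def)
      have "sqrt (36 / e) \<le> N" by (simp add: N_def)
      then have "36 / e \<le> N\<^sup>2" using real_sqrt_le_iff[of "36/e" "N\<^sup>2"] \<open>N > 0\<close> by simp
      then show "36 / N\<^sup>2 \<le> e" using e \<open>N > 0\<close> by (simp add: field_simps)
    qed
    have "\<exists>n0. \<forall>n\<ge>n0. N \<le> integral {0..real n} (\<lambda>x. 1 / sqrt (P x + inverse (real (Suc n))))"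
    proof (rule nn_integral_tail_large[OF meas(1) pp int_right _ _ P P0 pP])
      show "(\<Union>n. {0..real n}) = {0..}" using real_arch_simple by fastforce
    qed auto
    then obtain n1 where n1: "\<And>n. n \<ge> n1 \<Longrightarrow> N \<le> integral {0..real n} (\<lambda>x. 1 / sqrt (P x + inverse (real (Suc n))))" by blast
    have "\<exists>n0. \<forall>n\<ge>n0. N \<le> integral {- real n..0} (\<lambda>x. 1 / sqrt (P x + inverse (real (Suc n))))"
    proof (rule nn_integral_tail_large[OF meas(1) pp int_left _ _ P P0 pP])
      show "(\<Union>n. {- real n..0}) = {..0}"
      proof (intro equalityI subsetI)
        fix x :: real assume x: "x \<in> {..0}"
        obtain n where "- x \<le> real n" using real_arch_simple by blast
        then show "x \<in> (\<Union>n. {- real n..0})" using x by (intro UN_I[of n]) auto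
      qed auto
    qed auto
    then obtain n2 where n2: "\<And>n. n \<ge> n2 \<Longrightarrow> N \<le> integral {- real n..0} (\<lambda>x. 1 / sqrt (P x + inverse (real (Suc n))))" by blast
    \<comment> \<open>One number serves as the radius of the support on both sides and, through
      \<open>\<epsilon>\<close>, as the shift.\<close>
    define n where "n = max n1 n2"
    define \<epsilon> where "\<epsilon> = inverse (real (Suc n))"
    have \<epsilon>: "\<epsilon> > 0" by (simp add: \<epsilon>_def)
    obtain \<phi> \<phi>' \<kappa> where c: "\<And>x. (\<phi> has_real_derivative \<phi>' x) (at x)" "continuous_on UNIV \<phi>'"
      "AC_loc (\<lambda>x. P x * \<phi>' x)" "AE x in lebesgue. ((\<lambda>x. P x * \<phi>' x) has_real_derivative \<kappa> x) (at x)"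
      "L2_loc \<kappa>" "\<And>x. \<bar>x\<bar> > real n \<Longrightarrow> \<phi> x = 0 \<and> \<phi>' x = 0 \<and> \<kappa> x = 0"
      "\<And>x. 0 \<le> \<phi> x \<and> \<phi> x \<le> 1" "\<And>x. P x * (\<phi>' x)\<^sup>2 \<le> 36 / N\<^sup>2"
      "\<And>x R. \<lbrakk>\<bar>x\<bar> \<le> R; 2 * integral {-R..R} (\<lambda>x. 1 / sqrt (P x + \<epsilon>)) \<le> N\<rbrakk> \<Longrightarrow> \<phi> x \<ge> 1 / 8"
    proof (rule cutoff_exists[OF P P0 gL Pd \<epsilon> N(1), of "real n"])
      show "N \<le> integral {0..real n} (\<lambda>x. 1 / sqrt (P x + \<epsilon>))" "N \<le> integral {- real n..0} (\<lambda>x. 1 / sqrt (P x + \<epsilon>))"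
        unfolding \<epsilon>_def by (rule n1, simp add: n_def, rule n2, simp add: n_def)
    qed auto
    have "admissible_cutoff e \<phi> \<phi>' (\<lambda>x. P x * \<phi>' x) \<kappa> (real n)"
      unfolding admissible_cutoff_def
    proof (intro conjI allI impI c)
      show "AE x in lebesgue. \<phi>' x = \<beta> x * (P x * \<phi>' x)"
        using pP
      proof eventually_elim
        case (elim x)
        then show ?case using pp[of x] by (simp add: \<beta>_def)
      qed
      show "\<phi> x = 0" "\<phi>' x = 0" "P x * \<phi>' x = 0" "\<kappa> x = 0" if "real n < \<bar>x\<bar>" for x using c(6)[OF that] by auto
      show "0 \<le> \<phi> x" "\<phi> x \<le> 1" for x using c(7)[of x] by auto
      show "AE x in lebesgue. \<beta> x * (P x * \<phi>' x)\<^sup>2 \<le> e"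
        using pP
      proof eventually_elim
        case (elim x)
        have "\<beta> x * (P x * \<phi>' x)\<^sup>2 = P x * (\<phi>' x)\<^sup>2"
          using elim pp[of x] by (simp add: \<beta>_def power2_eq_square)
        then show ?case using c(8)[of x] N(3) by linarith
      qed
      \<comment> \<open>This term is Q \<phi>' almost everywhere. Writing it as Q / p^(1/2) times
        p^(1/2) \<phi>' uses (A) for the first factor and the bound \<open>36 / N\<^sup>2\<close>
        for the square of the second.\<close>
      show "L2_loc (\<lambda>x. Re (\<alpha> x) * (P x * \<phi>' x))"
      proof (rule L2_loc_bound)
        show "(\<lambda>x. Re (\<alpha> x) * (P x * \<phi>' x)) \<in> borel_measurable lebesgue"
          using loc_int_imp_measurable[OF loc_int_linear[OF la bounded_linear_Re]]
            loc_int_imp_measurable[OF loc_int_continuous[OF AC_loc_continuous[OF c(3)]]]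
          by (rule borel_measurable_times)
        show "L2_loc (\<lambda>x. Q x / sqrt (p x) * (6 / N))" by (rule L2_loc_mult_continuous[OF A2 continuous_on_const])
        show "AE x in lebesgue. \<bar>Re (\<alpha> x) * (P x * \<phi>' x)\<bar> \<le> \<bar>Q x / sqrt (p x) * (6 / N)\<bar>"
          using pP
        proof eventually_elim
          case (elim x)
          have Ra: "Re (\<alpha> x) = Q x / p x" by (simp add: \<alpha>_def)
          have "(sqrt (p x) * \<bar>\<phi>' x\<bar>)\<^sup>2 \<le> (6 / N)\<^sup>2"
            using c(8)[of x] elim pp[of x] by (simp add: power_mult_distrib power_divide)
          then have b: "sqrt (p x) * \<bar>\<phi>' x\<bar> \<le> 6 / N" by (rule power2_le_imp_le) (use N in simp)
          have "\<bar>Re (\<alpha> x) * (P x * \<phi>' x)\<bar> = \<bar>Q x / sqrt (p x)\<bar> * (sqrt (p x) * \<bar>\<phi>' x\<bar>)"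
            unfolding Ra elim[symmetric] using pp[of x] by (simp add: abs_mult)
          also have "\<dots> \<le> \<bar>Q x / sqrt (p x)\<bar> * (6 / N)" by (intro mult_left_mono b) simp
          finally show ?case using N(1) by (simp add: abs_mult)
        qed
      qed
    qed
    moreover have "\<phi> x \<ge> 1 / 8" if "\<bar>x\<bar> \<le> R" for x
    proof (rule c(9)[OF that])
      have kl: "loc_int (\<lambda>x. 1 / sqrt (P x + \<epsilon>))" by (intro loc_int_continuous AC_loc_continuous inverse_sqrt_shift_AC P P0 \<epsilon>)
      obtain Z where Z: "Z \<in> null_sets lebesgue" "\<And>x. x \<notin> Z \<Longrightarrow> p x = P x"
        using pP unfolding completion.AE_iff_null_sets by auto
      \<comment> \<open>\<open>K\<close> was fixed before \<open>n\<close> and hence without the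
        shift. Passing from \<open>P\<close> to \<open>p\<close> costs a null set, and the shift
        only lowers the integrand.\<close>
      have "integral {-R..R} (\<lambda>x. 1 / sqrt (P x + \<epsilon>)) = integral {-R..R} (\<lambda>x. 1 / sqrt (p x + \<epsilon>))"
        by (rule integral_spike[of Z]) (use Z in \<open>auto simp: negligible_iff_null_sets\<close>)
      moreover have "(\<lambda>x. 1 / sqrt (p x + \<epsilon>)) integrable_on {-R..R}"
        by (rule integrable_spike[OF loc_int_integrable[OF kl], of Z]) (use Z in \<open>auto simp: negligible_iff_null_sets\<close>)
      then have "integral {-R..R} (\<lambda>x. 1 / sqrt (p x + \<epsilon>)) \<le> K"
        unfolding K_def using pp \<epsilon>
        by (intro integral_le[OF _ loc_int_integrable[OF sl]]) (auto intro!: frac_le simp: less_imp_le)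
      ultimately show "2 * integral {-R..R} (\<lambda>x. 1 / sqrt (P x + \<epsilon>)) \<le> N" using N(2) by linarith
    qed
    ultimately show ?thesis by blast
  qed
  have ker: "ae_eq v (\<lambda>x. 0)" if vk: "(v, \<lambda>x. of_real (\<gamma> - 1) * v x) \<in> adjoint ?G" for v
  proof -
    obtain v' where v': "(v', \<lambda>x. of_real (\<gamma> - 1) * v x) \<in> ?L" and vv: "ae_eq v v'" using adjL[OF vk] by blast
    obtain v1 where q: "qsol \<alpha> \<beta> \<tau> (\<lambda>x. of_real (\<gamma> - 1) * v x) v' v1" and Lv: "L2 v'" using v' unfolding Lmem by blast
    have "ae_eq v' (\<lambda>x. 0)"
    proof (rule shifted_kernel_trivial[OF q Lv])
      show "ae_eq (\<lambda>x. of_real (\<gamma> - 1) * v x) (\<lambda>x. of_real (\<gamma> - 1) * v' x)"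
        using vv unfolding ae_eq_def by eventually_elim simp
    qed (use \<gamma> Gmem cut in blast)+
    then show ?thesis using vv unfolding ae_eq_def by eventually_elim simp
  qed
  have AC: "adjoint ?G \<subseteq> op_closure ?G"
  proof
    fix X assume X: "X \<in> adjoint ?G"
    obtain u0 f0 where X0: "X = (u0, f0)" by (cases X)
    have "(u0, f0) \<in> op_closure ?G"
    proof (rule adjoint_subset_closure[OF L2G _ _ order_trans[OF GL LadjG] \<gamma> ker])
      have "((\<lambda>x. 0), (\<lambda>x. 0)) \<in> ?G \<longleftrightarrow> (\<exists>u1. qsol \<alpha> \<beta> \<tau> (\<lambda>x. 0) (\<lambda>x. 0) u1)" unfolding Gmem by (simp add: L2_zero)
      moreover have "qsol \<alpha> \<beta> \<tau> (\<lambda>x. 0) (\<lambda>x. 0) (\<lambda>x. 0)"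
        unfolding qsol_def by (simp add: AC_loc_const has_vector_derivative_const)
      ultimately show "((\<lambda>x. 0), (\<lambda>x. 0)) \<in> ?G" by blast
      show "((\<lambda>x. u x + c * v x), (\<lambda>x. f x + c * g x)) \<in> ?G" if uf: "(u, f) \<in> ?G" and vg: "(v, g) \<in> ?G" for u f v g c
      proof -
        obtain u1 v1 where q: "qsol \<alpha> \<beta> \<tau> f u u1" "qsol \<alpha> \<beta> \<tau> g v v1" using uf vg unfolding Gmem by blast
        obtain c1 c2 where "\<forall>x. \<bar>x\<bar> > c1 \<longrightarrow> u x = 0" "\<forall>x. \<bar>x\<bar> > c2 \<longrightarrow> v x = 0" using uf vg unfolding Gmem by blast
        then have "\<forall>x. \<bar>x\<bar> > max c1 c2 \<longrightarrow> u x + c * v x = 0" by simp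
        moreover have "L2 (\<lambda>x. u x + c * v x)" "L2 (\<lambda>x. f x + c * g x)" using L2G[OF uf] L2G[OF vg] by (auto intro: L2_add L2_cmult)
        ultimately show ?thesis unfolding Gmem using qsol_add[OF q(1) qsol_cmult[OF q(2), of c]] by blast
      qed
      show "(u0, f0) \<in> adjoint ?G" using X X0 by simp
    qed
    then show "X \<in> op_closure ?G" using X0 by simp
  qed
  have clos: "ip f v = ip u w" if "(u, f) \<in> op_closure ?G" "(v, w) \<in> adjoint ?G" for u f v w
    by (rule adjoint_tendsto[OF L2G that])
  have clL: "L2 u \<and> L2 f" if "(u, f) \<in> op_closure ?G" for u f using that by (simp add: op_closure_def)
  \<comment> \<open>The chain from \<open>?G\<close> through \<open>?L\<close> and
    \<open>adjoint ?G\<close> to the closure holds literally between sets of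
    representatives.\<close>
  have Gcl: "?G \<subseteq> op_closure ?G" using order_trans[OF GL order_trans[OF LadjG AC]] .
  have "adjoint (op_closure ?G) = adjoint ?G"
  proof
    show "adjoint (op_closure ?G) \<subseteq> adjoint ?G" using Gcl unfolding adjoint_def by blast
    show "adjoint ?G \<subseteq> adjoint (op_closure ?G)"
    proof
      fix X assume X: "X \<in> adjoint ?G"
      obtain v w where vw: "X = (v, w)" by (cases X)
      have "L2 v" "L2 w" using X vw by (auto simp: adjoint_def)
      moreover have "\<forall>(u, f)\<in>op_closure ?G. ip f v = ip u w" using clos X vw by blast
      ultimately show "X \<in> adjoint (op_closure ?G)" unfolding vw adjoint_def by blast
    qed
  qed
  \<comment> \<open>Symmetry of the preminimal operator survives limits. Together with
    \<open>AC\<close> this identifies the closure with the adjoint of \<open>?G\<close>, which is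
    also the adjoint of the closure.\<close>
  moreover have "op_closure ?G \<subseteq> adjoint ?G"
  proof
    fix X assume X: "X \<in> op_closure ?G"
    obtain u f where uf: "X = (u, f)" by (cases X)
    have "ip g u = ip v f" if "(v, g) \<in> ?G" for v g
    proof -
      have "(v, g) \<in> adjoint ?G" using that GL LadjG by blast
      then have "ip f v = ip u g" using clos X uf by blast
      then show ?thesis by (metis ip_commute)
    qed
    then show "X \<in> adjoint ?G" unfolding uf adjoint_def using clL X uf by blast
  qed
  ultimately have cleq: "op_closure ?G = adjoint (op_closure ?G)" using AC by blast
  have refl: "op_eq H H" for H unfolding op_eq_def op_le_def ae_eq_def by (auto intro!: bexI)
  have leI: "op_le H K" if "H \<subseteq> K" for H K using that unfolding op_le_def ae_eq_def by (auto intro!: bexI)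
  have "essentially_self_adjoint ?G"
    unfolding essentially_self_adjoint_def self_adjoint_def cleq[symmetric] by (rule refl)
  moreover have adjle: "op_le (adjoint ?G) ?L"
    unfolding op_le_def
  proof (intro ballI, clarify)
    fix v w assume "(v, w) \<in> adjoint ?G"
    then obtain v' where "(v', w) \<in> ?L" "ae_eq v v'" using adjL by blast
    then show "\<exists>(v', g)\<in>?L. ae_eq v v' \<and> ae_eq w g" by (intro bexI[of _ "(v', w)"]) (auto simp: ae_eq_def)
  qed
  then have "op_eq (adjoint ?G) ?L" unfolding op_eq_def using leI[OF LadjG] by blast
  \<comment> \<open>The maximal operator lies in both the closure and the adjoint of
    \<open>?G\<close>, so \<open>clos\<close> makes it symmetric. The converse uses that adjoints
    reverse the inclusion of \<open>?G\<close> in \<open>?L\<close>.\<close>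
  moreover have "op_eq ?L (adjoint ?L)"
  proof -
    have "?L \<subseteq> adjoint ?L"
    proof
      fix X assume X: "X \<in> ?L"
      obtain v w where vw: "X = (v, w)" by (cases X)
      have "ip f v = ip u w" if "(u, f) \<in> ?L" for u f
        using clos[of u f v w] that X vw LadjG AC by blast
      then show "X \<in> adjoint ?L" using X vw Lmem unfolding adjoint_def by blast
    qed
    moreover have "adjoint ?L \<subseteq> adjoint ?G" using GL unfolding adjoint_def by blast
    then have "op_le (adjoint ?L) ?L" using adjle unfolding op_le_def by blast
    ultimately show ?thesis unfolding op_eq_def using leI by blast
  qed
  ultimately show ?thesis by blast
qed

end
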